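(* Let $A$ be a non-empty subset of $\mathbb{C}$, and let $B^1,B^2$ be two independent planar Brownian motions whose starting points are (independent and) uniformly distributed on the unit circle $\mathcal C(0,1)$. For $R\ge 1$ let $T^i_R$ be the hitting time of the circle $\mathcal C(0,R)$ by $B^i$, and let $$p_R(A)=P\big(B^1_{[0,T^1_R]}\cap A\,B^2_{[0,T^2_R]}=\varnothing\big).$$ Assume that there exist positive constants $c$ and $C$ such that $p_R(A)\ge cR^{-C}$ for all $R\ge1$. Then there exists a real number $\xi(A)$ such that, as $R\to\infty$, $p_R(A)\approx R^{-\xi(A)}$, i.e. $$\lim_{R\to\infty}\frac{\log p_R(A)}{\log R}=-\xi(A).$$
   Context: For $E_1,E_2\subset\mathbb C$, $E_1E_2=E_1.E_2=\{xy:x\in E_1,y\in E_2\}$. $\mathcal C(0,R)$ is the circle of centre $0$ and radius $R$. For a path $W$ and an interval $I$, $W_I=\{W_t:t\in I\}$. For positive functions, $f\approx g$ (logarithmic equivalence) means $\log f\sim\log g$. *)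

theory Defs
  imports "HOL-Probability.Probability" "HOL-Library.Set_Algebras"
begin

text \<open>
  Planar Brownian motion with an arbitrary (possibly random) starting point \<open>B 0\<close>: almost surely
  continuous paths, the starting point and the successive increments are independent, and
  \<open>B t - B s\<close> has independent real and imaginary parts with law \<open>N(0, t - s)\<close>, expressed through
  its joint density. \<open>normal_density\<close> takes the standard deviation, not the variance.
  Only times \<open>t \<ge> 0\<close> are relevant.
\<close>

definition (in prob_space) planar_brownian_motion :: "(real \<Rightarrow> 'a \<Rightarrow> complex) \<Rightarrow> bool" where
  "planar_brownian_motion B \<longleftrightarrow>
     (\<forall>t\<ge>0. B t \<in> borel_measurable M) \<and>
     (AE \<omega> in M. continuous_on {0..} (\<lambda>t. B t \<omega>)) \<and>
     (\<forall>(n::nat) (t :: nat \<Rightarrow> real). t 0 = 0 \<and> (\<forall>i<n. t i < t (Suc i)) \<longrightarrow>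
        indep_vars (\<lambda>_. borel)
          (\<lambda>i \<omega>. if i = 0 then B 0 \<omega> else B (t i) \<omega> - B (t (i - 1)) \<omega>) {0..n}) \<and>
     (\<forall>s t. 0 \<le> s \<and> s < t \<longrightarrow>
        distributed M lborel (\<lambda>\<omega>. B t \<omega> - B s \<omega>)
          (\<lambda>z. ennreal (normal_density 0 (sqrt (t - s)) (Re z)
                      * normal_density 0 (sqrt (t - s)) (Im z))))"

definition uniform_unit_circle :: "complex measure" where
  "uniform_unit_circle = distr (uniform_measure lborel {0..2 * pi}) borel cis"

text \<open>Independence of whole processes, i.e. of the random paths indexed by \<open>{0..}\<close>.\<close>

definition (in prob_space) indep_processes ::
    "(real \<Rightarrow> 'a \<Rightarrow> complex) \<Rightarrow> (real \<Rightarrow> 'a \<Rightarrow> complex) \<Rightarrow> bool" where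
  "indep_processes X Y \<longleftrightarrow>
     indep_var (Pi\<^sub>M {0..} (\<lambda>_. borel)) (\<lambda>\<omega>. \<lambda>t\<in>{0..}. X t \<omega>)
               (Pi\<^sub>M {0..} (\<lambda>_. borel)) (\<lambda>\<omega>. \<lambda>t\<in>{0..}. Y t \<omega>)"

text \<open>The value is \<open>\<infinity>\<close> if the path never meets the circle of radius \<open>R\<close>.\<close>

definition circle_hitting_time :: "(real \<Rightarrow> 'a \<Rightarrow> complex) \<Rightarrow> real \<Rightarrow> 'a \<Rightarrow> ereal" where
  "circle_hitting_time B R \<omega> = (INF t\<in>{t. 0 \<le> t \<and> B t \<omega> \<in> sphere 0 R}. ereal t)"

definition path_until_hit :: "(real \<Rightarrow> 'a \<Rightarrow> complex) \<Rightarrow> real \<Rightarrow> 'a \<Rightarrow> complex set" where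
  "path_until_hit B R \<omega> = (\<lambda>t. B t \<omega>) ` {t. 0 \<le> t \<and> ereal t \<le> circle_hitting_time B R \<omega>}"

text \<open>
  \<open>A\<close> is an arbitrary set of complex numbers and paths are only almost surely continuous, so the
  event below need not belong to \<open>sets M\<close>; its probability is therefore taken in the completion
  of \<open>M\<close>, which agrees with \<open>measure M\<close> on \<open>sets M\<close>. The product \<open>A * path_until_hit B2 R \<omega>\<close> is the
  elementwise product of sets.
\<close>

definition nonintersection_prob ::
    "'a measure \<Rightarrow> (real \<Rightarrow> 'a \<Rightarrow> complex) \<Rightarrow> (real \<Rightarrow> 'a \<Rightarrow> complex) \<Rightarrow> complex set \<Rightarrow> real \<Rightarrow> real" where
  "nonintersection_prob M B1 B2 A R =
     measure (completion M)
       {\<omega> \<in> space M. path_until_hit B1 R \<omega> \<inter> (A * path_until_hit B2 R \<omega>) = {}}"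

end

(*
Let D be a countable dense subset of A, containing 0 if A does. If the paths meet up to radius R for
some dilation a in A, then the first path comes arbitrarily close to the copy of the second one
dilated by some d in D. As soon as it is close, it almost surely hits that copy before radius 2R: a
second moment estimate gives a positive chance at every small scale, and the strong Markov property
turns it into probability 1. Hence p_D(2R) <= p_R(A) <= p_D(R), and all measurability and limit
questions concern the countable set D.

For countable D the probabilities p_D are submultiplicative up to constants: by the strong Markov
property at radius R, rotation averaging and Brownian scaling, the paths beyond radius 2R are, given
their past up to R, dominated by fresh paths started uniformly on a circle, with the factor 4 of the
Harnack inequality for each path; this yields p_D(2RR') <= 16 p_D(R) p_D(R'). The limit then follows
from Fekete's lemma in the variable ln R.
*)
theory Submission imports Defs begin

section \<open>Rotation invariant measures on the plane\<close>

text \<open>The set \<open>A\<close> is arbitrary, so the event for \<open>A\<close> cannot be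
  treated as measurable and has to be enclosed between events for a countable set; the logarithmic
  scale forgets the factor 2 in the radius that this costs. The comparison rests on a planar fact: a
  curve, unlike a point, is hit with positive probability. The estimate must hold for every curve,
  since the target is a piece of a Brownian path. Parametrising the curve by modulus makes the
  integral of the Gaussian density at time \<open>t\<close> along it at most of order
  \<open>1 / sqrt t\<close>, as for a segment, instead of the order \<open>1 / t\<close> of the
  density at a point. This is integrable at small times and gives a constant that depends neither on
  the curve nor on the scale. Small dilations shrink the target, so the dilations are split
  according to a lower bound on their modulus. No Brownian motion is constructed: the reference law
  comes from the increments of the given \<open>B1\<close>. The radius is a real variable, so
  Fekete's argument also uses monotonicity in the radius; the assumed polynomial lower bound keeps
  the limit finite.\<close>

definition gauss_density :: "real \<Rightarrow> complex \<Rightarrow> ennreal" where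
  "gauss_density t z = ennreal (exp (- (cmod z)\<^sup>2 / (2 * t)) / (2 * pi * t))"

definition gauss :: "real \<Rightarrow> complex measure" where
  "gauss t = density lborel (gauss_density t)"

lemma gauss_density_measurable [measurable]: "gauss_density t \<in> borel_measurable borel"
  unfolding gauss_density_def by measurable

lemma sets_gauss [simp, measurable_cong]: "sets (gauss t) = sets borel"
  and space_gauss [simp]: "space (gauss t) = UNIV"
  by (auto simp: gauss_def)

text \<open>The parameter \<open>t\<close> is a variance. The joint density depends on
  \<open>cmod z\<close> only, which is the source of the rotation invariance of Brownian motion used
  below.\<close>

lemma normal_density_product:
  assumes "t > 0"
  shows "ennreal (normal_density 0 (sqrt t) (Re z) * normal_density 0 (sqrt t) (Im z))
           = gauss_density t z"
proof -
  have "exp (- (Re z)\<^sup>2 / (2 * t)) * exp (- (Im z)\<^sup>2 / (2 * t)) = exp (- (cmod z)\<^sup>2 / (2 * t))"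
    unfolding exp_add[symmetric] cmod_power2 by (simp add: add_divide_distrib diff_divide_distrib)
  moreover have "sqrt (2 * pi * t) * sqrt (2 * pi * t) = 2 * pi * t"
    using assms by simp
  ultimately show ?thesis
    using assms unfolding gauss_density_def normal_density_def by (simp add: field_simps)
qed

text \<open>Uniqueness of translation invariant measures by Fubini, the unit ball fixing the constant.\<close>

lemma distr_lborel_rotation:
  fixes c :: complex
  assumes c: "cmod c = 1"
  shows "distr lborel borel ((*) c) = lborel"
proof (rule measure_eqI)
  fix A :: "complex set" assume "A \<in> sets (distr lborel borel ((*) c))"
  then have A [measurable]: "A \<in> sets borel" by simp
  define B :: "complex set" where "B = ball 0 1"
  have B [measurable]: "B \<in> sets borel" by (simp add: B_def)
  have c0: "c \<noteq> 0" using c by auto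
  have trans: "(\<integral>\<^sup>+x. f x \<partial>lborel) = (\<integral>\<^sup>+x. f (a + x) \<partial>lborel)"
    if [measurable]: "f \<in> borel_measurable borel" for f :: "complex \<Rightarrow> ennreal" and a
    by (subst lborel_distr_plus[of a, symmetric]) (simp add: nn_integral_distr)
  have shiftA: "(\<integral>\<^sup>+y. indicator D (a + y) \<partial>lborel) = emeasure lborel D"
    if [measurable]: "D \<in> sets borel" for D :: "complex set" and a
    using trans[of "indicator D" a] by simp
  let ?a = "emeasure (distr lborel borel ((*) c)) A"
  have rot: "?a = (\<integral>\<^sup>+x. indicator A (c * x) \<partial>lborel)"
    by (simp add: nn_integral_distr flip: nn_integral_indicator)
  \<comment> \<open>The product is written as a double integral in which, for each \<open>x\<close>,
    the ball is replaced by its translate by \<open>c * x\<close>. Exchanging the integrals then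
    moves the rotation from \<open>A\<close> to the ball.\<close>
  have "?a * emeasure lborel B = (\<integral>\<^sup>+x. indicator A (c * x) * emeasure lborel B \<partial>lborel)"
    unfolding rot by (simp add: nn_integral_multc)
  also have "\<dots> = (\<integral>\<^sup>+x. \<integral>\<^sup>+y. indicator A (c * x) * indicator B (- (c * x) + y) \<partial>lborel \<partial>lborel)"
  proof (rule nn_integral_cong)
    fix x :: complex
    show "indicator A (c * x) * emeasure lborel B
        = (\<integral>\<^sup>+y. indicator A (c * x) * indicator B (- (c * x) + y) \<partial>lborel)"
      using shiftA[OF B, of "- (c * x)"] by (subst nn_integral_cmult) auto
  qed
  also have "\<dots> = (\<integral>\<^sup>+y. \<integral>\<^sup>+x. indicator A (c * x) * indicator B (- (c * x) + y) \<partial>lborel \<partial>lborel)"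
    by (rule lborel_pair.Fubini') measurable
  also have "\<dots> = (\<integral>\<^sup>+y. \<integral>\<^sup>+x. indicator A (y + c * x) * indicator B x \<partial>lborel \<partial>lborel)"
  proof (rule nn_integral_cong)
    fix y :: complex
    have "(\<integral>\<^sup>+x. indicator A (c * x) * indicator B (- (c * x) + y) \<partial>lborel)
       = (\<integral>\<^sup>+x. indicator A (c * (y / c + x)) * (indicator B (- (c * (y / c + x)) + y) :: ennreal) \<partial>lborel)"
      by (rule trans) measurable
    \<comment> \<open>The unit ball is invariant under multiplication by \<open>- c\<close>, so the
      substitution leaves no trace of \<open>c\<close> in its indicator.\<close>
    also have "\<dots> = (\<integral>\<^sup>+x. indicator A (y + c * x) * indicator B x \<partial>lborel)"
      using c0 by (intro nn_integral_cong) (auto simp: algebra_simps B_def indicator_def norm_mult c)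
    finally show "(\<integral>\<^sup>+x. indicator A (c * x) * indicator B (- (c * x) + y) \<partial>lborel)
       = (\<integral>\<^sup>+x. indicator A (y + c * x) * (indicator B x :: ennreal) \<partial>lborel)" .
  qed
  also have "\<dots> = (\<integral>\<^sup>+x. \<integral>\<^sup>+y. indicator A (y + c * x) * indicator B x \<partial>lborel \<partial>lborel)"
    by (rule lborel_pair.Fubini') measurable
  also have "\<dots> = (\<integral>\<^sup>+x. emeasure lborel A * indicator B x \<partial>lborel)"
    proof (rule nn_integral_cong)
    fix x :: complex
    show "(\<integral>\<^sup>+y. indicator A (y + c * x) * indicator B x \<partial>lborel)
        = emeasure lborel A * indicator B x"
      using shiftA[OF A, of "c * x"] by (subst nn_integral_multc) (auto simp: add.commute)
  qed
  also have "\<dots> = emeasure lborel A * emeasure lborel B"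
    by (simp add: nn_integral_cmult)
  finally have "?a * emeasure lborel B = emeasure lborel A * emeasure lborel B" .
  moreover have "emeasure lborel B \<noteq> 0" "emeasure lborel B \<noteq> \<infinity>"
    using emeasure_lborel_ball_finite[of "0::complex" 1] open_not_negligible[of B]
    by (auto simp: B_def negligible_iff_null_sets null_sets_def)
  ultimately show "?a = emeasure lborel A"
    by (metis ennreal_mult_cancel_left mult.commute infinity_ennreal_def)
qed simp

text \<open>The number \<open>c\<close> is a positive dilation combined with a rotation. The
  dilation contributes the square of the modulus because the real dimension is 2; the rotation
  preserves Lebesgue measure.\<close>

lemma nn_integral_lborel_complex_mult:
  fixes c :: complex
  assumes c: "c \<noteq> 0" and [measurable]: "f \<in> borel_measurable borel"
  shows "(\<integral>\<^sup>+z. f z \<partial>lborel) = ennreal ((cmod c)\<^sup>2) * (\<integral>\<^sup>+z. f (c * z) \<partial>lborel)"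
proof -
  have "(\<integral>\<^sup>+z. f z \<partial>lborel) = ennreal ((cmod c)\<^sup>2) * (\<integral>\<^sup>+z. f (cmod c *\<^sub>R z) \<partial>lborel)"
    using c by (subst lborel_affine[of "cmod c" 0])
      (auto simp: nn_integral_density nn_integral_distr nn_integral_cmult)
  also have "(\<integral>\<^sup>+z. f (cmod c *\<^sub>R z) \<partial>lborel)
      = (\<integral>\<^sup>+z. f (cmod c *\<^sub>R z) \<partial>distr lborel borel ((*) (c / cmod c)))"
    using c by (subst distr_lborel_rotation) (auto simp: norm_divide)
  also have "\<dots> = (\<integral>\<^sup>+z. f (c * z) \<partial>lborel)"
    using c by (simp add: nn_integral_distr scaleR_conv_of_real)
  finally show ?thesis .
qed

text \<open>For \<open>cmod c = 1\<close> this is rotation invariance, for positive real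
  \<open>c\<close> it is Brownian scaling. Both follow from one change of variables in the
  plane.\<close>

lemma distr_gauss_mult:
  fixes c :: complex
  assumes c: "c \<noteq> 0" and t: "t > 0"
  shows "distr (gauss t) borel ((*) c) = gauss ((cmod c)\<^sup>2 * t)"
proof (rule measure_eqI)
  fix A assume "A \<in> sets (distr (gauss t) borel ((*) c))"
  then have A [measurable]: "A \<in> sets borel" by simp
  have dens: "ennreal ((cmod c)\<^sup>2) * gauss_density ((cmod c)\<^sup>2 * t) (c * z) = gauss_density t z" for z
  proof -
    have "ennreal ((cmod c)\<^sup>2) * gauss_density ((cmod c)\<^sup>2 * t) (c * z)
      = ennreal ((cmod c)\<^sup>2 * (exp (- (cmod (c * z))\<^sup>2 / (2 * ((cmod c)\<^sup>2 * t))) / (2 * pi * ((cmod c)\<^sup>2 * t))))"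
      unfolding gauss_density_def by (rule ennreal_mult''[symmetric]) (use t in simp)
    also have "\<dots> = gauss_density t z"
      unfolding gauss_density_def using c t
      by (intro arg_cong[where f=ennreal]) (simp add: norm_mult field_simps)
    finally show ?thesis .
  qed
  have "emeasure (gauss ((cmod c)\<^sup>2 * t)) A
      = (\<integral>\<^sup>+z. gauss_density ((cmod c)\<^sup>2 * t) z * indicator A z \<partial>lborel)"
    unfolding gauss_def by (simp add: emeasure_density)
  also have "\<dots> = (\<integral>\<^sup>+z. gauss_density t z * indicator A (c * z) \<partial>lborel)"
  proof -
    have "ennreal ((cmod c)\<^sup>2) * (gauss_density ((cmod c)\<^sup>2 * t) (c * z) * indicator A (c * z))
        = gauss_density t z * indicator A (c * z)" for z
      by (simp add: dens flip: mult.assoc)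
    then show ?thesis
      by (subst nn_integral_lborel_complex_mult[OF c]) (measurable, subst nn_integral_cmult[symmetric], auto)
  qed
  also have "\<dots> = emeasure (gauss t) ((*) c -` A)"
    unfolding gauss_def
    by (subst emeasure_density)
       (auto intro!: nn_integral_cong simp: indicator_def measurable_sets_borel[OF _ A])
  also have "\<dots> = emeasure (distr (gauss t) borel ((*) c)) A"
    by (subst emeasure_distr) auto
  finally show "emeasure (distr (gauss t) borel ((*) c)) A = emeasure (gauss ((cmod c)\<^sup>2 * t)) A" ..
qed simp

section \<open>Uniform measures on circles and averages over rotations\<close>

definition circ :: "real \<Rightarrow> complex measure" where
  "circ r = distr (uniform_measure lborel {0..2 * pi}) borel (\<lambda>\<theta>. of_real r * cis \<theta>)"

lemma circ_1: "circ 1 = uniform_unit_circle"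
  by (simp add: circ_def uniform_unit_circle_def)

lemma prob_space_angle: "prob_space (uniform_measure lborel {0..2 * pi})"
  by (rule prob_space_uniform_measure) auto

lemma cis_measurable [measurable]: "cis \<in> borel_measurable borel"
  by (intro borel_measurable_continuous_onI continuous_intros)

lemma sets_circ [simp, measurable_cong]: "sets (circ r) = sets borel"
  and space_circ [simp]: "space (circ r) = UNIV"
  by (auto simp: circ_def)

lemma prob_space_circ: "prob_space (circ r)"
  unfolding circ_def by (rule prob_space.prob_space_distr[OF prob_space_angle]) measurable

lemma emeasure_circ_UNIV [simp]: "emeasure (circ r) UNIV = 1"
  using prob_space.emeasure_space_1[OF prob_space_circ] by simp

lemma distr_circ_mult:
  "distr (circ r) borel ((*) (of_real a)) = circ (a * r)"
  unfolding circ_def by (subst distr_distr) (auto simp: comp_def mult.assoc)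

lemma AE_circ: "r \<ge> 0 \<Longrightarrow> AE z in circ r. cmod z = r"
  unfolding circ_def by (subst AE_distr_iff) (auto simp: norm_mult)

lemma nn_integral_circ:
  assumes [measurable]: "f \<in> borel_measurable borel"
  shows "(\<integral>\<^sup>+z. f z \<partial>circ r)
    = (\<integral>\<^sup>+\<theta>. f (of_real r * cis \<theta>) * indicator {0..2*pi} \<theta> \<partial>lborel) / ennreal (2 * pi)"
  unfolding circ_def by (simp add: nn_integral_distr nn_integral_uniform_measure)

lemma nn_integral_period_shift:
  fixes f :: "real \<Rightarrow> ennreal"
  assumes [measurable]: "f \<in> borel_measurable borel"
    and per: "\<And>x. f (x + 2 * pi) = f x" and a: "0 \<le> a" "a \<le> 2 * pi"
  shows "(\<integral>\<^sup>+x. f (a + x) * indicator {0..2*pi} x \<partial>lborel) = (\<integral>\<^sup>+x. f x * indicator {0..2*pi} x \<partial>lborel)"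
proof -
  have trans: "(\<integral>\<^sup>+x. g x \<partial>lborel) = (\<integral>\<^sup>+x. g (b + x) \<partial>lborel)"
    if [measurable]: "g \<in> borel_measurable borel" for g :: "real \<Rightarrow> ennreal" and b
    by (subst lborel_distr_plus[of b, symmetric]) (simp add: nn_integral_distr)
  have "(\<integral>\<^sup>+x. f (a + x) * indicator {0..2*pi} x \<partial>lborel)
      = (\<integral>\<^sup>+x. f x * indicator {a..a+2*pi} x \<partial>lborel)"
    by (subst (2) trans[of _ a]) (auto intro!: nn_integral_cong simp: indicator_def)
  also have "\<dots> = (\<integral>\<^sup>+x. f x * indicator {a..2*pi} x + f x * indicator {2*pi<..a+2*pi} x \<partial>lborel)"
    using a by (intro nn_integral_cong) (auto simp: indicator_def)
  also have "\<dots> = (\<integral>\<^sup>+x. f x * indicator {a..2*pi} x \<partial>lborel)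
       + (\<integral>\<^sup>+x. f x * indicator {2*pi<..a+2*pi} x \<partial>lborel)"
    by (rule nn_integral_add) auto
  also have "(\<integral>\<^sup>+x. f x * indicator {2*pi<..a+2*pi} x \<partial>lborel) = (\<integral>\<^sup>+x. f x * indicator {0<..a} x \<partial>lborel)"
    by (subst trans[of _ "2 * pi"])
       (auto intro!: nn_integral_cong simp: indicator_def add.commute[of "2 * pi"] per)
  \<comment> \<open>The points \<open>0\<close> and \<open>a\<close> are null. Moving the endpoint
    makes \<open>{0..<a}\<close> the exact complement of \<open>{a..2*pi}\<close> in the
    period.\<close>
  also have "\<dots> = (\<integral>\<^sup>+x. f x * indicator {0..<a} x \<partial>lborel)"
    by (rule nn_integral_cong_AE)
       (use AE_lborel_singleton[of 0] AE_lborel_singleton[of a] in \<open>eventually_elim, auto simp: indicator_def\<close>)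
  also have "(\<integral>\<^sup>+x. f x * indicator {a..2*pi} x \<partial>lborel) + (\<integral>\<^sup>+x. f x * indicator {0..<a} x \<partial>lborel)
      = (\<integral>\<^sup>+x. f x * indicator {a..2*pi} x + f x * indicator {0..<a} x \<partial>lborel)"
    by (rule nn_integral_add[symmetric]) auto
  also have "\<dots> = (\<integral>\<^sup>+x. f x * indicator {0..2*pi} x \<partial>lborel)"
    using a by (intro nn_integral_cong) (auto simp: indicator_def)
  finally show ?thesis .
qed

lemma nn_integral_circ_rotation:
  assumes [measurable]: "f \<in> borel_measurable borel" and c: "cmod c = 1"
  shows "(\<integral>\<^sup>+z. f (c * z) \<partial>circ r) = (\<integral>\<^sup>+z. f z \<partial>circ r)"
proof -
  obtain a where a: "0 \<le> a" "a < 2 * pi" "c = cis a"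
    using that[of "Arg2pi c"] Arg2pi[of c] c by (simp add: cis_conv_exp is_Arg_def)
  have "(\<integral>\<^sup>+\<theta>. f (of_real r * cis (a + \<theta>)) * indicator {0..2*pi} \<theta> \<partial>lborel)
      = (\<integral>\<^sup>+\<theta>. f (of_real r * cis \<theta>) * indicator {0..2*pi} \<theta> \<partial>lborel)"
  proof (rule nn_integral_period_shift[where f="\<lambda>\<theta>. f (of_real r * cis \<theta>)"])
    have "cis (x + 2 * pi) = cis x" for x by (simp add: complex_eq_iff)
    then show "f (of_real r * cis (x + 2 * pi)) = f (of_real r * cis x)" for x by simp
  qed (use a in auto)
  moreover have "c * (of_real r * cis \<theta>) = of_real r * cis (a + \<theta>)" for \<theta>
    unfolding a(3) cis_mult[symmetric] by (rule mult.left_commute)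
  ultimately show ?thesis
    by (subst (1 2) nn_integral_circ) (measurable, simp only:)
qed

lemma distr_circ_rotation: "cmod c = 1 \<Longrightarrow> distr (circ r) borel ((*) c) = circ r"
  by (rule measure_eqI)
     (auto simp: nn_integral_distr nn_integral_circ_rotation[of "indicator _"] simp flip: nn_integral_indicator)

text \<open>Averaging the invariance over a uniform rotation and exchanging the integrals gives
  polar coordinates: for fixed \<open>z\<close> and \<open>c\<close> uniform on the unit circle,
  \<open>c * z\<close> is uniform on the circle of radius \<open>cmod z\<close>.\<close>

lemma nn_integral_rotation_average:
  assumes N: "sigma_finite_measure N" "sets N = sets borel"
    and inv: "\<And>c. cmod c = 1 \<Longrightarrow> distr N borel ((*) c) = N"
    and [measurable]: "f \<in> borel_measurable borel"
  shows "(\<integral>\<^sup>+z. f z \<partial>N) = (\<integral>\<^sup>+z. (\<integral>\<^sup>+w. f w \<partial>circ (cmod z)) \<partial>N)"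
proof -
  note N(2)[measurable_cong]
  interpret N: sigma_finite_measure N by fact
  interpret C: prob_space "circ 1" by (rule prob_space_circ)
  interpret P: pair_sigma_finite "circ 1" N ..
  have "(\<integral>\<^sup>+z. f z \<partial>N) = (\<integral>\<^sup>+c. (\<integral>\<^sup>+z. f z \<partial>N) \<partial>circ 1)"
    by (simp add: C.emeasure_space_1)
  also have "\<dots> = (\<integral>\<^sup>+c. (\<integral>\<^sup>+z. f (c * z) \<partial>N) \<partial>circ 1)"
  proof (rule nn_integral_cong_AE)
    show "AE c in circ 1. (\<integral>\<^sup>+z. f z \<partial>N) = (\<integral>\<^sup>+z. f (c * z) \<partial>N)"
      using AE_circ[of 1, simplified]
    proof eventually_elim
      fix c :: complex assume "cmod c = 1"
      then show "(\<integral>\<^sup>+z. f z \<partial>N) = (\<integral>\<^sup>+z. f (c * z) \<partial>N)"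
        by (subst inv[symmetric, of c]) (auto simp: nn_integral_distr)
    qed
  qed
  also have "\<dots> = (\<integral>\<^sup>+z. (\<integral>\<^sup>+c. f (c * z) \<partial>circ 1) \<partial>N)"
    by (rule P.Fubini'[symmetric]) measurable
  also have "\<dots> = (\<integral>\<^sup>+z. (\<integral>\<^sup>+w. f w \<partial>circ (cmod z)) \<partial>N)"
  proof (rule nn_integral_cong)
    fix z :: complex
    show "(\<integral>\<^sup>+c. f (c * z) \<partial>circ 1) = (\<integral>\<^sup>+w. f w \<partial>circ (cmod z))"
    proof (cases "z = 0")
      case True then show ?thesis
        by (simp add: nn_integral_circ distr_circ_mult[of 1 0, symmetric, simplified] nn_integral_distr C.emeasure_space_1)
    next
      case False
      define u where "u = z / cmod z"
      have u: "cmod u = 1" "z = cmod z * u" using False by (auto simp: u_def norm_divide)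
      have "(\<integral>\<^sup>+w. f w \<partial>circ (cmod z)) = (\<integral>\<^sup>+w. f (u * w) \<partial>circ (cmod z))"
        by (rule nn_integral_circ_rotation[symmetric]) (use u in auto)
      also have "\<dots> = (\<integral>\<^sup>+w. f (u * w) \<partial>distr (circ 1) borel ((*) (of_real (cmod z))))"
        by (simp add: distr_circ_mult)
      also have "\<dots> = (\<integral>\<^sup>+w. f (u * (cmod z * w)) \<partial>circ 1)"
        by (simp add: nn_integral_distr)
      also have "\<dots> = (\<integral>\<^sup>+c. f (c * z) \<partial>circ 1)"
        using u(2) by (metis mult.assoc mult.commute)
      finally show ?thesis ..
    qed
  qed
  finally show ?thesis .
qed

text \<open>Symmetry alone identifies the exit law from a disc, without any Poisson kernel: when all
  moduli equal \<open>r\<close>, the average over rotations no longer depends on the point.\<close>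

lemma rotation_invariant_eq_circ:
  assumes N: "prob_space N" "sets N = sets borel"
    and inv: "\<And>c. cmod c = 1 \<Longrightarrow> distr N borel ((*) c) = N"
    and r: "AE z in N. cmod z = r"
  shows "N = circ r"
proof (rule measure_eqI)
  fix A assume "A \<in> sets N"
  then have A [measurable]: "A \<in> sets borel" using N by simp
  interpret N: prob_space N by fact
  have "emeasure N A = (\<integral>\<^sup>+z. indicator A z \<partial>N)"
    by (simp add: N)
  also have "\<dots> = (\<integral>\<^sup>+z. (\<integral>\<^sup>+w. indicator A w \<partial>circ (cmod z)) \<partial>N)"
    by (rule nn_integral_rotation_average) (auto simp: N inv N.sigma_finite_measure_axioms)
  also have "\<dots> = (\<integral>\<^sup>+z. (\<integral>\<^sup>+w. indicator A w \<partial>circ r) \<partial>N)"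
    by (rule nn_integral_cong_AE) (use r in eventually_elim, auto)
  also have "\<dots> = emeasure (circ r) A"
    by (simp add: N.emeasure_space_1)
  finally show "emeasure N A = emeasure (circ r) A" .
qed (simp add: N)

section \<open>Brownian motion as a measure on path space\<close>

definition path_set :: "(real \<Rightarrow> complex) set" where
  "path_set = {x. continuous_on {0..} x}"

text \<open>Open sets suffice as a generator stable under intersection, and their indicators are
  limits of continuous functions, which the limit in the strong Markov property requires. Only times
  in \<open>{0..}\<close> are observed, as paths are arbitrary at negative times.\<close>

definition cylinders :: "(real \<Rightarrow> complex) set set" where
  "cylinders = {{x \<in> path_set. \<forall>t\<in>J. x t \<in> U t} | J U. finite J \<and> J \<subseteq> {0..} \<and> (\<forall>t. open (U t))}"

definition paths :: "(real \<Rightarrow> complex) measure" where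
  "paths = sigma path_set cylinders"

lemma cylinders_Pow: "cylinders \<subseteq> Pow path_set"
  by (auto simp: cylinders_def)

lemma space_paths [simp]: "space paths = path_set"
  unfolding paths_def using cylinders_Pow by (rule space_measure_of)

lemma sets_paths: "sets paths = sigma_sets path_set cylinders"
  unfolding paths_def using cylinders_Pow by (rule sets_measure_of)

lemma Int_stable_cylinders: "Int_stable cylinders"
proof (rule Int_stableI)
  fix A B assume "A \<in> cylinders" "B \<in> cylinders"
  then obtain J U J' U' where
    A: "A = {x \<in> path_set. \<forall>t\<in>J. x t \<in> U t}" "finite J" "J \<subseteq> {0..}" "\<And>t. open (U t)" and
    B: "B = {x \<in> path_set. \<forall>t\<in>J'. x t \<in> U' t}" "finite J'" "J' \<subseteq> {0..}" "\<And>t. open (U' t)"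
    unfolding cylinders_def by blast
  \<comment> \<open>A time outside one of the two index sets receives the void constraint
    \<open>UNIV\<close> from it.\<close>
  let ?U = "\<lambda>t. (if t \<in> J then U t else UNIV) \<inter> (if t \<in> J' then U' t else UNIV)"
  have "A \<inter> B = {x \<in> path_set. \<forall>t\<in>J \<union> J'. x t \<in> ?U t}"
    unfolding A B by auto
  moreover have "\<forall>t. open (?U t)" using A B by auto
  ultimately show "A \<inter> B \<in> cylinders"
    unfolding cylinders_def using A(2,3) B(2,3)
    by (intro CollectI exI[of _ "J \<union> J'"] exI[of _ ?U]) auto
qed

lemma path_set_cylinder: "path_set \<in> cylinders"
  unfolding cylinders_def by (intro CollectI exI[of _ "{}"] exI[of _ "\<lambda>_. UNIV"]) auto

lemma measurable_eval_path [measurable]: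
  assumes "t \<ge> 0"
  shows "(\<lambda>x. x t) \<in> borel_measurable paths"
proof (rule borel_measurableI)
  fix S :: "complex set" assume "open S"
  then have "{x \<in> path_set. \<forall>s\<in>{t}. x s \<in> S} \<in> cylinders"
    unfolding cylinders_def using assms by (intro CollectI exI[of _ "{t}"] exI[of _ "\<lambda>_. S"]) auto
  moreover have "(\<lambda>x. x t) -` S \<inter> space paths = {x \<in> path_set. \<forall>s\<in>{t}. x s \<in> S}" by auto
  ultimately show "(\<lambda>x. x t) -` S \<inter> space paths \<in> sets paths"
    by (simp add: sets_paths)
qed

lemma measurable_path_at:
  "X \<in> M \<rightarrow>\<^sub>M paths \<Longrightarrow> t \<ge> 0 \<Longrightarrow> (\<lambda>\<omega>. X \<omega> t) \<in> borel_measurable M"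
  using measurable_compose[OF _ measurable_eval_path] by blast

lemma measurable_pathsI:
  assumes "\<And>\<omega>. \<omega> \<in> space M \<Longrightarrow> continuous_on {0..} (X \<omega>)"
    and [measurable]: "\<And>t. t \<ge> 0 \<Longrightarrow> (\<lambda>\<omega>. X \<omega> t) \<in> borel_measurable M"
  shows "X \<in> M \<rightarrow>\<^sub>M paths"
  unfolding paths_def
proof (rule measurable_measure_of[OF cylinders_Pow])
  show "X \<in> space M \<rightarrow> path_set" using assms(1) by (auto simp: path_set_def)
  fix A assume "A \<in> cylinders"
  then obtain J U where A: "A = {x \<in> path_set. \<forall>t\<in>J. x t \<in> U t}" "finite J" "J \<subseteq> {0..}" "\<And>t. open (U t)"
    unfolding cylinders_def by blast
  have "X -` A \<inter> space M = {\<omega> \<in> space M. \<forall>t\<in>J. X \<omega> t \<in> U t}"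
    unfolding A using assms(1) by (auto simp: path_set_def)
  also have "\<dots> \<in> sets M"
    using A by (intro sets.sets_Collect_finite_All) (auto intro!: measurable_sets_Collect[OF assms(2)])
  finally show "X -` A \<inter> space M \<in> sets M" .
qed

lemma paths_measurable_continuous: "X \<in> M \<rightarrow>\<^sub>M paths \<Longrightarrow> \<omega> \<in> space M \<Longrightarrow> continuous_on {0..} (X \<omega>)"
  using measurable_space[of X M paths \<omega>] by (simp add: path_set_def)

text \<open>The random time is replaced by its dyadic floor, which has countably many values, so
  that the evaluation is measurable; continuity of the path gives the limit.\<close>

lemma measurable_eval_random_time:
  assumes X: "X \<in> M \<rightarrow>\<^sub>M paths" and \<tau> [measurable]: "\<tau> \<in> borel_measurable M"
    and pos: "\<And>\<omega>. \<omega> \<in> space M \<Longrightarrow> \<tau> \<omega> \<ge> 0"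
  shows "(\<lambda>\<omega>. X \<omega> (\<tau> \<omega>)) \<in> borel_measurable M"
proof (rule borel_measurable_LIMSEQ_metric)
  define g where "g n \<omega> = nat \<lfloor>2 ^ n * \<tau> \<omega>\<rfloor>" for n :: nat and \<omega>
  show "(\<lambda>\<omega>. X \<omega> (real (g n \<omega>) / 2 ^ n)) \<in> borel_measurable M" for n
  proof (rule measurable_compose_countable[where g="g n" and f="\<lambda>k \<omega>. X \<omega> (real k / 2 ^ n)"])
    show "g n \<in> M \<rightarrow>\<^sub>M count_space UNIV" unfolding g_def by measurable
    show "(\<lambda>\<omega>. X \<omega> (real k / 2 ^ n)) \<in> borel_measurable M" for k
      by (rule measurable_path_at[OF X]) simp
  qed
  fix \<omega> assume \<omega>: "\<omega> \<in> space M"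
  have "(\<lambda>n. real (g n \<omega>) / 2 ^ n) \<longlonglongrightarrow> \<tau> \<omega>"
  proof (rule tendsto_sandwich[of "\<lambda>n. \<tau> \<omega> - 1 / 2 ^ n" _ _ "\<lambda>n. \<tau> \<omega>"])
    have fl: "real (g n \<omega>) = of_int \<lfloor>2 ^ n * \<tau> \<omega>\<rfloor>" for n
      using pos[OF \<omega>] by (simp add: g_def)
    have "(2 ^ n * \<tau> \<omega> - 1) / 2 ^ n \<le> real (g n \<omega>) / 2 ^ n" for n
      unfolding fl by (intro divide_right_mono) (linarith, simp)
    then have "\<tau> \<omega> - 1 / 2 ^ n \<le> real (g n \<omega>) / 2 ^ n" for n
      by (simp add: diff_divide_distrib)
    then show "eventually (\<lambda>n. \<tau> \<omega> - 1 / 2 ^ n \<le> real (g n \<omega>) / 2 ^ n) sequentially" by simp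
    have "real (g n \<omega>) / 2 ^ n \<le> \<tau> \<omega>" for n
      using floor_correct[of "2 ^ n * \<tau> \<omega>"] unfolding fl by (simp add: field_simps)
    then show "eventually (\<lambda>n. real (g n \<omega>) / 2 ^ n \<le> \<tau> \<omega>) sequentially" by simp
    have "(\<lambda>n. \<tau> \<omega> - (1 / 2) ^ n) \<longlonglongrightarrow> \<tau> \<omega> - 0"
      by (intro tendsto_intros LIMSEQ_power_zero) simp
    then show "(\<lambda>n. \<tau> \<omega> - 1 / 2 ^ n) \<longlonglongrightarrow> \<tau> \<omega>" by (simp add: power_divide)
  qed simp
  then show "(\<lambda>n. X \<omega> (real (g n \<omega>) / 2 ^ n)) \<longlonglongrightarrow> X \<omega> (\<tau> \<omega>)"
    by (rule continuous_on_tendsto_compose[OF paths_measurable_continuous[OF X \<omega>]])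
       (use pos[OF \<omega>] in auto)
qed

lemma paths_measure_eqI:
  assumes sets: "sets \<mu> = sets paths" "sets \<nu> = sets paths" and fin: "finite_measure \<mu>"
    and eq: "\<And>J U. finite J \<Longrightarrow> J \<subseteq> {0..} \<Longrightarrow> (\<And>t. open (U t)) \<Longrightarrow>
       emeasure \<mu> {x \<in> path_set. \<forall>t\<in>J. x t \<in> U t} = emeasure \<nu> {x \<in> path_set. \<forall>t\<in>J. x t \<in> U t}"
  shows "\<mu> = \<nu>"
proof (rule measure_eqI_generator_eq[OF Int_stable_cylinders cylinders_Pow])
  show "emeasure \<mu> A = emeasure \<nu> A" if "A \<in> cylinders" for A
    using that eq unfolding cylinders_def by blast
  show "range (\<lambda>_::nat. path_set) \<subseteq> cylinders" using path_set_cylinder by auto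
  show "emeasure \<mu> path_set \<noteq> \<infinity>"
    using fin finite_measure.emeasure_finite by fastforce
qed (auto simp: sets sets_paths)

text \<open>Cylinders form a generator stable under intersection, so independence of two random
  paths is a statement about finitely many times.\<close>

lemma (in prob_space) indep_var_pathsI:
  assumes [measurable]: "X \<in> M \<rightarrow>\<^sub>M paths" "Y \<in> M \<rightarrow>\<^sub>M paths"
    and eq: "\<And>J U J' U'. finite J \<Longrightarrow> J \<subseteq> {0..} \<Longrightarrow> (\<And>t. open (U t)) \<Longrightarrow>
       finite J' \<Longrightarrow> J' \<subseteq> {0..} \<Longrightarrow> (\<And>t. open (U' t)) \<Longrightarrow>
       prob {\<omega> \<in> space M. (\<forall>t\<in>J. X \<omega> t \<in> U t) \<and> (\<forall>t\<in>J'. Y \<omega> t \<in> U' t)}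
       = prob {\<omega> \<in> space M. \<forall>t\<in>J. X \<omega> t \<in> U t} * prob {\<omega> \<in> space M. \<forall>t\<in>J'. Y \<omega> t \<in> U' t}"
  shows "indep_var paths X paths Y"
proof -
  have gen: "sigma_sets (space M) {Z -` A \<inter> space M |A. A \<in> sets paths}
        = sigma_sets (space M) {Z -` A \<inter> space M |A. A \<in> cylinders}"
    if Z: "Z \<in> M \<rightarrow>\<^sub>M paths" for Z
  proof -
    have "Z \<in> space M \<rightarrow> path_set" using measurable_space[OF Z] by auto
    from sigma_sets_vimage_commute[OF this, of cylinders]
    have "{Z -` A \<inter> space M |A. A \<in> sets paths} = sigma_sets (space M) {Z -` A \<inter> space M |A. A \<in> cylinders}"
      by (simp add: sets_paths)
    then show ?thesis by (simp only:) (rule sigma_sets_sigma_sets_eq, auto)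
  qed
  have stable: "Int_stable {Z -` A \<inter> space M |A. A \<in> cylinders}" for Z
  proof (rule Int_stableI)
    fix a b assume "a \<in> {Z -` A \<inter> space M |A. A \<in> cylinders}" "b \<in> {Z -` A \<inter> space M |A. A \<in> cylinders}"
    then obtain A B where "a = Z -` A \<inter> space M" "b = Z -` B \<inter> space M" "A \<in> cylinders" "B \<in> cylinders" by auto
    then show "a \<inter> b \<in> {Z -` A \<inter> space M |A. A \<in> cylinders}"
      using Int_stableD[OF Int_stable_cylinders, of A B] by (intro CollectI exI[of _ "A \<inter> B"]) auto
  qed
  have cyl: "A \<in> cylinders \<Longrightarrow> A \<in> sets paths" for A by (simp add: sets_paths)
  have "indep_set (sigma_sets (space M) {X -` A \<inter> space M |A. A \<in> cylinders})
      (sigma_sets (space M) {Y -` A \<inter> space M |A. A \<in> cylinders})"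
  proof (rule indep_set_sigma_sets[OF indep_setI stable stable])
    show "{X -` A \<inter> space M |A. A \<in> cylinders} \<subseteq> events" "{Y -` A \<inter> space M |A. A \<in> cylinders} \<subseteq> events"
      using cyl by (auto intro!: measurable_sets[OF assms(1)] measurable_sets[OF assms(2)])
    fix a b assume "a \<in> {X -` A \<inter> space M |A. A \<in> cylinders}" "b \<in> {Y -` A \<inter> space M |A. A \<in> cylinders}"
    then obtain J U J' U' where
      a: "a = X -` {x \<in> path_set. \<forall>t\<in>J. x t \<in> U t} \<inter> space M" "finite J" "J \<subseteq> {0..}" "\<And>t. open (U t)" and
      b: "b = Y -` {x \<in> path_set. \<forall>t\<in>J'. x t \<in> U' t} \<inter> space M" "finite J'" "J' \<subseteq> {0..}" "\<And>t. open (U' t)"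
      unfolding cylinders_def by blast
    have [simp]: "X \<omega> \<in> path_set" "Y \<omega> \<in> path_set" if "\<omega> \<in> space M" for \<omega>
      using measurable_space[OF assms(1) that] measurable_space[OF assms(2) that] by auto
    have "a = {\<omega> \<in> space M. \<forall>t\<in>J. X \<omega> t \<in> U t}" "b = {\<omega> \<in> space M. \<forall>t\<in>J'. Y \<omega> t \<in> U' t}"
      "a \<inter> b = {\<omega> \<in> space M. (\<forall>t\<in>J. X \<omega> t \<in> U t) \<and> (\<forall>t\<in>J'. Y \<omega> t \<in> U' t)}"
      unfolding a b by auto
    then show "prob (a \<inter> b) = prob a * prob b"
      using eq[OF a(2-4) b(2-4)] by simp
  qed
  then show ?thesis
    unfolding indep_var_eq by (simp add: gen)
qed

text \<open>Time 0 is added because independence of increments is formulated for time sequences that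
  start at 0. The equivalence between the order of times and the order of indices serves to split
  such a sequence at a prescribed time.\<close>

lemma finite_time_enumeration:
  assumes "finite J" "J \<subseteq> {0::real..}"
  obtains n :: nat and t :: "nat \<Rightarrow> real" where "t 0 = 0" "\<And>i. i < n \<Longrightarrow> t i < t (Suc i)"
    "insert 0 J = t ` {0..n}" "\<And>i j. i \<le> n \<Longrightarrow> j \<le> n \<Longrightarrow> t i \<le> t j \<longleftrightarrow> i \<le> j"
proof -
  define L where "L = sorted_list_of_set (insert 0 J)"
  have L: "set L = insert 0 J"
    unfolding L_def by (rule set_sorted_list_of_set) (use assms in simp)
  then have "L \<noteq> []" by auto
  have st: "L ! i < L ! j" if "i < j" "j < length L" for i j
    using that sorted_wrt_nth_less[OF strict_sorted_list_of_set[of "insert 0 J"], of i j] unfolding L_def by blast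
  define n where "n = length L - 1"
  have n: "length L = Suc n" using \<open>L \<noteq> []\<close> by (simp add: n_def)
  have im: "insert 0 J = (!) L ` {0..n}"
    unfolding L[symmetric] set_conv_nth using n by (auto simp: image_def less_Suc_eq_le)
  have zero: "L ! 0 = 0"
  proof -
    obtain i where i: "i \<le> n" "L ! i = 0" using im by (metis (no_types, lifting) atLeastAtMost_iff imageE insertI1)
    have "L ! 0 \<in> insert 0 J" using im by auto
    then have "L ! 0 \<ge> 0" using assms(2) by auto
    with i st[of 0 i] n show ?thesis by (cases "i = 0") auto
  qed
  show thesis
  proof (rule that[of "(!) L" n, OF zero _ im])
    show "L ! i < L ! Suc i" if "i < n" for i using st[of i "Suc i"] that n by simp
    show "L ! i \<le> L ! j \<longleftrightarrow> i \<le> j" if "i \<le> n" "j \<le> n" for i j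
      using st[of i j] st[of j i] that n by (cases i j rule: linorder_cases) auto
  qed
qed

section \<open>Increments, uniqueness of the law and the Markov property\<close>

definition path_increments :: "(nat \<Rightarrow> real) \<Rightarrow> (real \<Rightarrow> complex) \<Rightarrow> nat \<Rightarrow> complex" where
  "path_increments t x i = (if i = 0 then x 0 else x (t i) - x (t (i - 1)))"

lemma path_increments_sum:
  "t 0 = 0 \<Longrightarrow> (\<Sum>k\<in>{0..i}. path_increments t x k) = x (t i)"
  by (induction i) (auto simp: path_increments_def)

lemma path_increments_sum_diff:
  assumes "t 0 = 0" "m \<le> i"
  shows "(\<Sum>k\<in>{Suc m..i}. path_increments t x k) = x (t i) - x (t m)"
  using \<open>m \<le> i\<close>
  by (induction i rule: dec_induct) (auto simp: path_increments_def)

definition increasing_times :: "nat \<Rightarrow> (nat \<Rightarrow> real) \<Rightarrow> bool" where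
  "increasing_times n t \<longleftrightarrow> t 0 = 0 \<and> (\<forall>i<n. t i < t (Suc i))"

lemma increasing_times_nonneg: "increasing_times n t \<Longrightarrow> i \<le> n \<Longrightarrow> t i \<ge> 0"
proof (induction i)
  case (Suc i) then show ?case unfolding increasing_times_def by (meson Suc_le_lessD less_imp_le order_trans)
qed (auto simp: increasing_times_def)

text \<open>Path space version of \<open>planar_brownian_motion\<close>: every path is continuous,
  not only almost every one, because \<open>X\<close> takes values in \<open>path_set\<close>, and
  the start law is explicit.\<close>

definition brownian :: "'a measure \<Rightarrow> complex measure \<Rightarrow> ('a \<Rightarrow> real \<Rightarrow> complex) \<Rightarrow> bool" where
  "brownian M \<nu> X \<longleftrightarrow> prob_space M \<and> X \<in> M \<rightarrow>\<^sub>M paths \<and> distr M borel (\<lambda>\<omega>. X \<omega> 0) = \<nu> \<and>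
     (\<forall>n t. increasing_times n t \<longrightarrow>
        prob_space.indep_vars M (\<lambda>_. borel) (\<lambda>i \<omega>. path_increments t (X \<omega>) i) {0..n}) \<and>
     (\<forall>s t. 0 \<le> s \<and> s < t \<longrightarrow> distr M borel (\<lambda>\<omega>. X \<omega> t - X \<omega> s) = gauss (t - s))"

lemma brownianD:
  assumes "brownian M \<nu> X"
  shows "prob_space M" "X \<in> M \<rightarrow>\<^sub>M paths" "distr M borel (\<lambda>\<omega>. X \<omega> 0) = \<nu>"
    "increasing_times n t \<Longrightarrow> prob_space.indep_vars M (\<lambda>_. borel) (\<lambda>i \<omega>. path_increments t (X \<omega>) i) {0..n}"
    "0 \<le> u \<Longrightarrow> u < v \<Longrightarrow> distr M borel (\<lambda>\<omega>. X \<omega> v - X \<omega> u) = gauss (v - u)"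
  using assms unfolding brownian_def by auto

lemma brownian_increments_law:
  assumes X: "brownian M \<nu> X" and t: "increasing_times n t"
  shows "distr M (Pi\<^sub>M {0..n} (\<lambda>_. borel)) (\<lambda>\<omega>. \<lambda>i\<in>{0..n}. path_increments t (X \<omega>) i)
      = Pi\<^sub>M {0..n} (\<lambda>i. if i = 0 then \<nu> else gauss (t i - t (i - 1)))"
proof -
  interpret prob_space M using brownianD(1)[OF X] .
  note [measurable] = brownianD(2)[OF X] measurable_path_at[OF brownianD(2)[OF X]]
  have meas: "(\<lambda>\<omega>. path_increments t (X \<omega>) i) \<in> borel_measurable M" if "i \<in> {0..n}" for i
    using that increasing_times_nonneg[OF t, of i] increasing_times_nonneg[OF t, of "i - 1"]
    unfolding path_increments_def by (cases "i = 0") auto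
  have "distr M (Pi\<^sub>M {0..n} (\<lambda>_. borel)) (\<lambda>\<omega>. \<lambda>i\<in>{0..n}. path_increments t (X \<omega>) i)
      = Pi\<^sub>M {0..n} (\<lambda>i. distr M borel (\<lambda>\<omega>. path_increments t (X \<omega>) i))"
    using brownianD(4)[OF X t] by (subst (asm) indep_vars_iff_distr_eq_PiM') (auto intro: meas)
  also have "\<dots> = Pi\<^sub>M {0..n} (\<lambda>i. if i = 0 then \<nu> else gauss (t i - t (i - 1)))"
  proof (rule PiM_cong)
    fix i assume i: "i \<in> {0..n}"
    show "distr M borel (\<lambda>\<omega>. path_increments t (X \<omega>) i) = (if i = 0 then \<nu> else gauss (t i - t (i - 1)))"
    proof (cases i)
      case 0 then show ?thesis using brownianD(3)[OF X] by (simp add: path_increments_def)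
    next
      case (Suc j)
      then have "t j < t i" "0 \<le> t j"
        using t i increasing_times_nonneg[OF t, of j] by (auto simp: increasing_times_def)
      then show ?thesis using brownianD(5)[OF X, of "t j" "t i"] Suc by (simp add: path_increments_def)
    qed
  qed simp
  finally show ?thesis .
qed

text \<open>Positions at finitely many times are partial sums of independent increments whose laws
  are prescribed, so the two laws agree on cylinders.\<close>

lemma brownian_law_unique:
  assumes X: "brownian M \<nu> X" and Y: "brownian N \<nu> Y"
  shows "distr M paths X = distr N paths Y"
proof (rule paths_measure_eqI)
  interpret prob_space M using brownianD(1)[OF X] .
  note [measurable] = brownianD(2)[OF X] measurable_path_at[OF brownianD(2)[OF X]]
  show "finite_measure (distr M paths X)"
    by (rule prob_space.finite_measure[OF prob_space_distr]) measurable
  fix J :: "real set" and U :: "real \<Rightarrow> complex set" assume J: "finite J" "J \<subseteq> {0..}" and U: "\<And>t. open (U t)"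
  obtain n t where t: "t 0 = 0" "\<And>i. i < n \<Longrightarrow> t i < t (Suc i)" "insert 0 J = t ` {0..n}"
    using finite_time_enumeration[OF J] by metis
  then have t': "increasing_times n t" by (simp add: increasing_times_def)
  \<comment> \<open>The cylinder in terms of increments: the position at \<open>t i\<close> is the
    sum of the increments up to index \<open>i\<close>, index 0 carrying the starting point.\<close>
  let ?S = "{d \<in> space (Pi\<^sub>M {0..n} (\<lambda>_. borel)). \<forall>i\<in>{0..n}. t i \<in> J \<longrightarrow> (\<Sum>k\<in>{0..i}. d k) \<in> U (t i)}"
  have S: "?S \<in> sets (Pi\<^sub>M {0..n} (\<lambda>_. borel))"
  proof (rule sets.sets_Collect_finite_All)
    fix i assume i: "i \<in> {0..n}"
    have "(\<lambda>d. \<Sum>k\<in>{0..i}. d k :: complex) \<in> borel_measurable (Pi\<^sub>M {0..n} (\<lambda>_. borel))"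
      using i by (intro borel_measurable_sum measurable_component_singleton) auto
    then show "{d \<in> space (Pi\<^sub>M {0..n} (\<lambda>_. borel)). t i \<in> J \<longrightarrow> (\<Sum>k\<in>{0..i}. d k) \<in> U (t i)}
        \<in> sets (Pi\<^sub>M {0..n} (\<lambda>_. borel :: complex measure))"
      using U[of "t i"] by (cases "t i \<in> J") (auto intro: measurable_sets_Collect)
  qed auto
  have eq: "emeasure (distr Q paths Z) {x \<in> path_set. \<forall>t\<in>J. x t \<in> U t}
      = emeasure (Pi\<^sub>M {0..n} (\<lambda>i. if i = 0 then \<nu> else gauss (t i - t (i - 1)))) ?S"
    if Z: "brownian Q \<nu> Z" for Q :: "'z measure" and Z
  proof -
    note [measurable] = brownianD(2)[OF Z] measurable_path_at[OF brownianD(2)[OF Z]]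
    have meas: "(\<lambda>\<omega>. \<lambda>i\<in>{0..n}. path_increments t (Z \<omega>) i) \<in> Q \<rightarrow>\<^sub>M Pi\<^sub>M {0..n} (\<lambda>_. borel)"
    proof (rule measurable_restrict)
      fix i assume "i \<in> {0..n}"
      then show "(\<lambda>\<omega>. path_increments t (Z \<omega>) i) \<in> borel_measurable Q"
        using increasing_times_nonneg[OF t', of i] increasing_times_nonneg[OF t', of "i - 1"]
        unfolding path_increments_def by (cases "i = 0") auto
    qed
    have C: "{x \<in> path_set. \<forall>t\<in>J. x t \<in> U t} \<in> sets paths"
      using J U by (auto simp: sets_paths cylinders_def intro!: sigma_sets.Basic)
    have iff: "(\<forall>s\<in>J. Z \<omega> s \<in> U s) \<longleftrightarrow>
        (\<forall>i\<in>{0..n}. t i \<in> J \<longrightarrow> (\<Sum>k\<in>{0..i}. (\<lambda>i\<in>{0..n}. path_increments t (Z \<omega>) i) k) \<in> U (t i))" for \<omega>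
    proof -
      have "(\<Sum>k\<in>{0..i}. (\<lambda>i\<in>{0..n}. path_increments t (Z \<omega>) i) k) = Z \<omega> (t i)" if "i \<in> {0..n}" for i
        using that path_increments_sum[of t "Z \<omega>" i, OF t(1)] by (subst sum.cong[OF refl]) auto
      moreover have "\<forall>s\<in>J. \<exists>i\<in>{0..n}. s = t i" using t(3) by (metis imageE insertCI)
      ultimately show ?thesis by auto
    qed
    have "emeasure (distr Q paths Z) {x \<in> path_set. \<forall>t\<in>J. x t \<in> U t}
        = emeasure Q {\<omega> \<in> space Q. \<forall>s\<in>J. Z \<omega> s \<in> U s}"
      using measurable_space[OF brownianD(2)[OF Z]]
      by (subst emeasure_distr[OF _ C]) (auto intro!: arg_cong[where f="emeasure Q"])
    also have "\<dots> = emeasure (distr Q (Pi\<^sub>M {0..n} (\<lambda>_. borel)) (\<lambda>\<omega>. \<lambda>i\<in>{0..n}. path_increments t (Z \<omega>) i)) ?S"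
      using measurable_space[OF meas]
      by (subst emeasure_distr[OF meas S]) (auto intro!: arg_cong[where f="emeasure Q"] simp: iff)
    finally show ?thesis unfolding brownian_increments_law[OF Z t'] .
  qed
  show "emeasure (distr M paths X) {x \<in> path_set. \<forall>t\<in>J. x t \<in> U t}
      = emeasure (distr N paths Y) {x \<in> path_set. \<forall>t\<in>J. x t \<in> U t}"
    using eq[OF X] eq[OF Y] by simp
qed auto

text \<open>Linear case of conformal invariance: multiplication by \<open>c\<close> rotates and
  dilates, and the time change compensates the factor \<open>(cmod c)\<^sup>2\<close> in the
  variance.\<close>

lemma brownian_mult:
  assumes X: "brownian M \<nu> X" and c: "c \<noteq> 0"
  shows "brownian M (distr \<nu> borel ((*) c)) (\<lambda>\<omega> t. c * X \<omega> (t / (cmod c)\<^sup>2))"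
proof -
  interpret prob_space M using brownianD(1)[OF X] .
  note X_meas [measurable] = brownianD(2)[OF X]
  note [measurable] = measurable_path_at[OF X_meas]
  have inc: "path_increments t (\<lambda>s. c * X \<omega> (s / (cmod c)\<^sup>2)) i
      = c * path_increments (\<lambda>i. t i / (cmod c)\<^sup>2) (X \<omega>) i" for t i \<omega>
    by (simp add: path_increments_def algebra_simps)
  show ?thesis
    unfolding brownian_def
  proof (intro conjI allI impI)
    show "(\<lambda>\<omega> t. c * X \<omega> (t / (cmod c)\<^sup>2)) \<in> M \<rightarrow>\<^sub>M paths"
    proof (rule measurable_pathsI)
      show "continuous_on {0..} (\<lambda>t. c * X \<omega> (t / (cmod c)\<^sup>2))" if "\<omega> \<in> space M" for \<omega>
        by (intro continuous_intros continuous_on_compose2[OF paths_measurable_continuous[OF X_meas that]])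
           (use c in auto)
    qed measurable
    show "distr M borel (\<lambda>\<omega>. c * X \<omega> (0 / (cmod c)\<^sup>2)) = distr \<nu> borel ((*) c)"
      unfolding brownianD(3)[OF X, symmetric] by (subst distr_distr) (auto simp: comp_def)
    fix n t assume "increasing_times n t"
    then have "increasing_times n (\<lambda>i. t i / (cmod c)\<^sup>2)"
      using c by (auto simp: increasing_times_def divide_strict_right_mono)
    from brownianD(4)[OF X this]
    show "indep_vars (\<lambda>_. borel) (\<lambda>i \<omega>. path_increments t (\<lambda>s. c * X \<omega> (s / (cmod c)\<^sup>2)) i) {0..n}"
      unfolding inc by (rule indep_vars_compose2) measurable
  next
    fix s t :: real assume st: "0 \<le> s \<and> s < t"
    let ?k = "(cmod c)\<^sup>2"
    have k: "?k > 0" using c by simp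
    have "distr M borel (\<lambda>\<omega>. c * X \<omega> (t / ?k) - c * X \<omega> (s / ?k))
        = distr (distr M borel (\<lambda>\<omega>. X \<omega> (t / ?k) - X \<omega> (s / ?k))) borel ((*) c)"
      using st by (subst distr_distr) (auto simp: comp_def right_diff_distrib)
    also have "\<dots> = distr (gauss (t / ?k - s / ?k)) borel ((*) c)"
      using st k by (subst brownianD(5)[OF X]) (auto simp: divide_strict_right_mono)
    also have "\<dots> = gauss (t - s)"
    proof -
      have "?k * (t / ?k - s / ?k) = t - s" using k by (simp add: field_simps)
      moreover have "t / ?k - s / ?k > 0" using st k by (simp add: divide_strict_right_mono)
      ultimately show ?thesis using distr_gauss_mult[OF c, of "t / ?k - s / ?k"] by simp
    qed
    finally show "distr M borel (\<lambda>\<omega>. c * X \<omega> (t / ?k) - c * X \<omega> (s / ?k)) = gauss (t - s)" .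
  qed (fact prob_space_axioms)
qed

text \<open>The past up to time \<open>s\<close> is represented by a path-valued variable, so that
  independence of past and future becomes a statement about \<open>indep_var\<close> and no
  filtration enters.\<close>

definition stop_path :: "real \<Rightarrow> (real \<Rightarrow> complex) \<Rightarrow> real \<Rightarrow> complex" where
  "stop_path s x = (\<lambda>u. x (min u s))"

definition incr_path :: "real \<Rightarrow> (real \<Rightarrow> complex) \<Rightarrow> real \<Rightarrow> complex" where
  "incr_path s x = (\<lambda>u. x (s + u) - x s)"

lemma measurable_stop_path:
  assumes X: "X \<in> M \<rightarrow>\<^sub>M paths" and \<tau> [measurable]: "\<tau> \<in> borel_measurable M"
    and pos: "\<And>\<omega>. \<omega> \<in> space M \<Longrightarrow> \<tau> \<omega> \<ge> 0"
  shows "(\<lambda>\<omega>. stop_path (\<tau> \<omega>) (X \<omega>)) \<in> M \<rightarrow>\<^sub>M paths"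
  unfolding stop_path_def
proof (rule measurable_pathsI)
  fix \<omega> assume \<omega>: "\<omega> \<in> space M"
  show "continuous_on {0..} (\<lambda>u. X \<omega> (min u (\<tau> \<omega>)))"
    using pos[OF \<omega>]
    by (intro continuous_on_compose2[OF paths_measurable_continuous[OF X \<omega>]] continuous_intros) auto
next
  fix t :: real assume "t \<ge> 0"
  then show "(\<lambda>\<omega>. X \<omega> (min t (\<tau> \<omega>))) \<in> borel_measurable M"
    using pos by (intro measurable_eval_random_time[OF X]) auto
qed

lemma measurable_shift_path:
  assumes X: "X \<in> M \<rightarrow>\<^sub>M paths" and \<tau> [measurable]: "\<tau> \<in> borel_measurable M"
    and pos: "\<And>\<omega>. \<omega> \<in> space M \<Longrightarrow> \<tau> \<omega> \<ge> 0"
  shows "(\<lambda>\<omega> u. X \<omega> (\<tau> \<omega> + u)) \<in> M \<rightarrow>\<^sub>M paths"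
proof (rule measurable_pathsI)
  fix \<omega> assume \<omega>: "\<omega> \<in> space M"
  show "continuous_on {0..} (\<lambda>u. X \<omega> (\<tau> \<omega> + u))"
    using pos[OF \<omega>]
    by (intro continuous_on_compose2[OF paths_measurable_continuous[OF X \<omega>]] continuous_intros) auto
next
  fix t :: real assume "t \<ge> 0"
  then show "(\<lambda>\<omega>. X \<omega> (\<tau> \<omega> + t)) \<in> borel_measurable M"
    using pos by (intro measurable_eval_random_time[OF X]) auto
qed

lemma measurable_translate_path:
  assumes X: "X \<in> M \<rightarrow>\<^sub>M paths" and Z [measurable]: "Z \<in> borel_measurable M"
  shows "(\<lambda>\<omega> u. Z \<omega> + X \<omega> u) \<in> M \<rightarrow>\<^sub>M paths"
proof (rule measurable_pathsI)
  show "continuous_on {0..} (\<lambda>u. Z \<omega> + X \<omega> u)" if "\<omega> \<in> space M" for \<omega>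
    by (intro continuous_intros paths_measurable_continuous[OF X that])
  show "(\<lambda>\<omega>. Z \<omega> + X \<omega> t) \<in> borel_measurable M" if "t \<ge> 0" for t
    using measurable_path_at[OF X that] by measurable
qed

lemma measurable_incr_path:
  assumes X: "X \<in> M \<rightarrow>\<^sub>M paths" and \<tau> [measurable]: "\<tau> \<in> borel_measurable M"
    and pos: "\<And>\<omega>. \<omega> \<in> space M \<Longrightarrow> \<tau> \<omega> \<ge> 0"
  shows "(\<lambda>\<omega>. incr_path (\<tau> \<omega>) (X \<omega>)) \<in> M \<rightarrow>\<^sub>M paths"
  using measurable_translate_path[OF measurable_shift_path[OF assms]
      borel_measurable_uminus[OF measurable_eval_random_time[OF assms]]]
  unfolding incr_path_def by (simp add: add.commute)

lemma (in prob_space) indep_vars_Suc_shift: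
  assumes "indep_vars (\<lambda>_. N) Z {Suc 0..Suc n}"
  shows "indep_vars (\<lambda>_. N) (\<lambda>i. Z (Suc i)) {0..n}"
  unfolding indep_vars_def2 indep_sets_def
proof (intro conjI ballI allI impI)
  note Z = assms[unfolded indep_vars_def2 indep_sets_def]
  show "random_variable N (Z (Suc i))" if "i \<in> {0..n}" for i using Z that by auto
  then show "{Z (Suc i) -` A \<inter> space M |A. A \<in> sets N} \<subseteq> events" if "i \<in> {0..n}" for i
    using that by (auto intro: measurable_sets)
  fix J A assume J: "J \<subseteq> {0..n}" "J \<noteq> {}" "finite J"
    and A: "A \<in> (\<Pi> i\<in>J. {Z (Suc i) -` A \<inter> space M |A. A \<in> sets N})"
  let ?A = "\<lambda>i. A (i - 1)"
  have "Suc ` J \<subseteq> {Suc 0..Suc n}" "Suc ` J \<noteq> {}" "finite (Suc ` J)"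
    using J by auto
  moreover have "?A \<in> (\<Pi> i\<in>Suc ` J. {Z i -` A \<inter> space M |A. A \<in> sets N})"
  proof (rule Pi_I)
    fix i assume "i \<in> Suc ` J"
    then obtain j where "j \<in> J" "i = Suc j" by auto
    then show "?A i \<in> {Z i -` A \<inter> space M |A. A \<in> sets N}" using Pi_mem[OF A, of j] by simp
  qed
  ultimately have "prob (\<Inter>j\<in>Suc ` J. ?A j) = (\<Prod>j\<in>Suc ` J. prob (?A j))"
    using Z by blast
  then show "prob (\<Inter>j\<in>J. A j) = (\<Prod>j\<in>J. prob (A j))"
    by (simp add: prod.reindex)
qed

lemma brownian_incr_path:
  assumes X: "brownian M \<nu> X" and s: "s \<ge> 0"
  shows "brownian M (return borel 0) (\<lambda>\<omega>. incr_path s (X \<omega>))"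
proof -
  interpret prob_space M using brownianD(1)[OF X] .
  note X_meas = brownianD(2)[OF X]
  show ?thesis
    unfolding brownian_def
  proof (intro conjI allI impI)
    show "(\<lambda>\<omega>. incr_path s (X \<omega>)) \<in> M \<rightarrow>\<^sub>M paths"
      by (rule measurable_incr_path[OF X_meas]) (use s in auto)
    show "distr M borel (\<lambda>\<omega>. incr_path s (X \<omega>) 0) = return borel 0"
      by (simp add: incr_path_def distr_const)
    show "distr M borel (\<lambda>\<omega>. incr_path s (X \<omega>) v - incr_path s (X \<omega>) u) = gauss (v - u)"
      if "0 \<le> u \<and> u < v" for u v
      using brownianD(5)[OF X, of "s + u" "s + v"] that s by (simp add: incr_path_def)
    fix n t assume t: "increasing_times n t"
    show "indep_vars (\<lambda>_. borel) (\<lambda>i \<omega>. path_increments t (incr_path s (X \<omega>)) i) {0..n}"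
    proof (cases "s = 0")
      case True
      have "indep_vars (\<lambda>_. borel) (\<lambda>i \<omega>. (if i = 0 then (\<lambda>_. 0) else (\<lambda>z. z)) (path_increments t (X \<omega>) i)) {0..n}"
        by (rule indep_vars_compose2[OF brownianD(4)[OF X t]]) auto
      also have "(\<lambda>i \<omega>. (if i = 0 then (\<lambda>_. 0) else (\<lambda>z. z)) (path_increments t (X \<omega>) i))
          = (\<lambda>i \<omega>. path_increments t (incr_path s (X \<omega>)) i)"
        using True by (auto simp: path_increments_def incr_path_def fun_eq_iff)
      finally show ?thesis .
    next
      case False
      \<comment> \<open>Time 0 is put in front of the shifted times. The increments of the shifted
        path after its start are those of \<open>X\<close> from index 2 on; the one at index 1, from
        time 0 to \<open>s\<close>, is replaced by 0. Strict increase requires \<open>s > 0\<close>,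
        hence the separate case \<open>s = 0\<close>.\<close>
      define t' where "t' i = (case i of 0 \<Rightarrow> 0 | Suc j \<Rightarrow> s + t j)" for i
      have t': "increasing_times (Suc n) t'"
        using t s False by (auto simp: increasing_times_def t'_def split: nat.split)
      have "indep_vars (\<lambda>_. borel) (\<lambda>i \<omega>. path_increments t' (X \<omega>) i) {Suc 0..Suc n}"
        by (rule indep_vars_subset[OF brownianD(4)[OF X t']]) auto
      from indep_vars_Suc_shift[OF this]
      have "indep_vars (\<lambda>_. borel) (\<lambda>i \<omega>. path_increments t' (X \<omega>) (Suc i)) {0..n}" .
      then have "indep_vars (\<lambda>_. borel) (\<lambda>i \<omega>. (if i = 0 then (\<lambda>_. 0) else (\<lambda>z. z)) (path_increments t' (X \<omega>) (Suc i))) {0..n}"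
        by (rule indep_vars_compose2) auto
      also have "(\<lambda>i \<omega>. (if i = 0 then (\<lambda>_. 0) else (\<lambda>z. z)) (path_increments t' (X \<omega>) (Suc i)))
          = (\<lambda>i \<omega>. path_increments t (incr_path s (X \<omega>)) i)"
        by (auto simp: path_increments_def incr_path_def t'_def fun_eq_iff split: nat.split)
      finally show ?thesis .
    qed
  qed (fact prob_space_axioms)
qed

text \<open>All observed times and \<open>s\<close> itself are put into one increasing sequence with
  \<open>t m = s\<close>. Cylinder events of the stopped path depend on the increments up to index
  \<open>m\<close>, those of the shifted path on the later ones.\<close>

lemma brownian_markov:
  assumes X: "brownian M \<nu> X" and s: "s \<ge> 0"
  shows "prob_space.indep_var M paths (\<lambda>\<omega>. stop_path s (X \<omega>)) paths (\<lambda>\<omega>. incr_path s (X \<omega>))"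
proof -
  interpret prob_space M using brownianD(1)[OF X] .
  note X_meas [measurable] = brownianD(2)[OF X]
  show ?thesis
  proof (rule indep_var_pathsI)
    show "(\<lambda>\<omega>. stop_path s (X \<omega>)) \<in> M \<rightarrow>\<^sub>M paths" "(\<lambda>\<omega>. incr_path s (X \<omega>)) \<in> M \<rightarrow>\<^sub>M paths"
      using s by (auto intro!: measurable_stop_path[OF X_meas] measurable_incr_path[OF X_meas])
    fix J J' :: "real set" and U U' :: "real \<Rightarrow> complex set"
    assume J: "finite J" "J \<subseteq> {0..}" and U: "\<And>t. open (U t)"
      and J': "finite J'" "J' \<subseteq> {0..}" and U': "\<And>t. open (U' t)"
    have fin: "finite (min s ` J \<union> {s} \<union> (+) s ` J')" "min s ` J \<union> {s} \<union> (+) s ` J' \<subseteq> {0..}"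
      using J J' s by auto
    obtain n t where t: "t 0 = 0" "\<And>i. i < n \<Longrightarrow> t i < t (Suc i)"
      "insert 0 (min s ` J \<union> {s} \<union> (+) s ` J') = t ` {0..n}"
      "\<And>i j. i \<le> n \<Longrightarrow> j \<le> n \<Longrightarrow> t i \<le> t j \<longleftrightarrow> i \<le> j"
      using finite_time_enumeration[OF fin] by metis
    then have t': "increasing_times n t" by (simp add: increasing_times_def)
    have "s \<in> t ` {0..n}" unfolding t(3)[symmetric] by simp
    then obtain m where m: "m \<le> n" "t m = s" by auto
    let ?D = "\<lambda>i \<omega>. path_increments t (X \<omega>) i"
    let ?A = "PiM {0..m} (\<lambda>_. borel :: complex measure)" and ?B = "PiM {Suc m..n} (\<lambda>_. borel :: complex measure)"
    have ind: "indep_var ?A (\<lambda>\<omega>. \<lambda>i\<in>{0..m}. ?D i \<omega>) ?B (\<lambda>\<omega>. \<lambda>i\<in>{Suc m..n}. ?D i \<omega>)"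
      by (rule indep_var_restrict[OF brownianD(4)[OF X t']]) (use m in auto)
    let ?S = "{d \<in> space ?A. \<forall>r\<in>J. \<forall>i\<in>{0..m}. t i = min s r \<longrightarrow> (\<Sum>k\<in>{0..i}. d k) \<in> U r}"
    let ?S' = "{d \<in> space ?B. \<forall>r\<in>J'. \<forall>i\<in>{m..n}. t i = s + r \<longrightarrow> (\<Sum>k\<in>{Suc m..i}. d k) \<in> U' r}"
    have S: "?S \<in> sets ?A"
    proof (intro sets.sets_Collect_finite_All)
      fix r i assume i: "i \<in> {0..m}"
      have "(\<lambda>d. \<Sum>k\<in>{0..i}. d k) \<in> borel_measurable ?A"
        using i by (intro borel_measurable_sum measurable_component_singleton) auto
      then show "{d \<in> space ?A. t i = min s r \<longrightarrow> (\<Sum>k\<in>{0..i}. d k) \<in> U r} \<in> sets ?A"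
        using U[of r] by (cases "t i = min s r") (auto intro: measurable_sets_Collect)
    qed (use J in auto)
    have S': "?S' \<in> sets ?B"
    proof (intro sets.sets_Collect_finite_All)
      fix r i assume i: "i \<in> {m..n}"
      have "(\<lambda>d. \<Sum>k\<in>{Suc m..i}. d k) \<in> borel_measurable ?B"
        using i by (intro borel_measurable_sum measurable_component_singleton) auto
      then show "{d \<in> space ?B. t i = s + r \<longrightarrow> (\<Sum>k\<in>{Suc m..i}. d k) \<in> U' r} \<in> sets ?B"
        using U'[of r] by (cases "t i = s + r") (auto intro: measurable_sets_Collect)
    qed (use J' in auto)
    have iff: "(\<forall>r\<in>J. stop_path s (X \<omega>) r \<in> U r) \<longleftrightarrow> (\<lambda>i\<in>{0..m}. ?D i \<omega>) \<in> ?S" for \<omega>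
    proof -
      have sum: "(\<Sum>k\<in>{0..i}. (\<lambda>i\<in>{0..m}. ?D i \<omega>) k) = X \<omega> (t i)" if "i \<in> {0..m}" for i
        using that path_increments_sum[of t "X \<omega>" i, OF t(1)] by (subst sum.cong[OF refl]) auto
      have "\<exists>i\<in>{0..m}. t i = min s r" if "r \<in> J" for r
      proof -
        have "min s r \<in> t ` {0..n}" using that t(3) by blast
        then obtain i where "i \<le> n" "t i = min s r" by auto
        moreover have "i \<le> m" using t(4)[of i m] m calculation by simp
        ultimately show ?thesis by auto
      qed
      then show ?thesis
        using sum by (auto simp: stop_path_def min.commute space_PiM PiE_def; metis)
    qed
    have iff': "(\<forall>r\<in>J'. incr_path s (X \<omega>) r \<in> U' r) \<longleftrightarrow> (\<lambda>i\<in>{Suc m..n}. ?D i \<omega>) \<in> ?S'" for \<omega>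
    proof -
      have sum: "(\<Sum>k\<in>{Suc m..i}. (\<lambda>i\<in>{Suc m..n}. ?D i \<omega>) k) = X \<omega> (t i) - X \<omega> s" if "i \<in> {m..n}" for i
        using that path_increments_sum_diff[of t m i "X \<omega>", OF t(1)] m by (subst sum.cong[OF refl]) auto
      have "\<exists>i\<in>{m..n}. t i = s + r" if "r \<in> J'" for r
      proof -
        have "s + r \<in> t ` {0..n}" using that t(3) by blast
        then obtain i where "i \<le> n" "t i = s + r" by auto
        moreover have "m \<le> i" using t(4)[of m i] m calculation that J' by auto
        ultimately show ?thesis by auto
      qed
      then show ?thesis
        using sum by (auto simp: incr_path_def space_PiM PiE_def; metis)
    qed
    have "prob {\<omega> \<in> space M. (\<forall>t\<in>J. stop_path s (X \<omega>) t \<in> U t) \<and> (\<forall>t\<in>J'. incr_path s (X \<omega>) t \<in> U' t)}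
       = prob ((\<lambda>\<omega>. (\<lambda>i\<in>{0..m}. ?D i \<omega>, \<lambda>i\<in>{Suc m..n}. ?D i \<omega>)) -` (?S \<times> ?S') \<inter> space M)"
      unfolding iff iff' by (intro arg_cong[where f=prob]) blast
    also have "\<dots> = prob ((\<lambda>\<omega>. \<lambda>i\<in>{0..m}. ?D i \<omega>) -` ?S \<inter> space M)
        * prob ((\<lambda>\<omega>. \<lambda>i\<in>{Suc m..n}. ?D i \<omega>) -` ?S' \<inter> space M)"
      by (rule indep_varD[OF ind S S'])
    also have "(\<lambda>\<omega>. \<lambda>i\<in>{0..m}. ?D i \<omega>) -` ?S \<inter> space M = {\<omega> \<in> space M. \<forall>t\<in>J. stop_path s (X \<omega>) t \<in> U t}"
      unfolding iff by blast
    also have "(\<lambda>\<omega>. \<lambda>i\<in>{Suc m..n}. ?D i \<omega>) -` ?S' \<inter> space M = {\<omega> \<in> space M. \<forall>t\<in>J'. incr_path s (X \<omega>) t \<in> U' t}"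
      unfolding iff' by blast
    finally show "prob {\<omega> \<in> space M. (\<forall>t\<in>J. stop_path s (X \<omega>) t \<in> U t) \<and> (\<forall>t\<in>J'. incr_path s (X \<omega>) t \<in> U' t)}
       = prob {\<omega> \<in> space M. \<forall>t\<in>J. stop_path s (X \<omega>) t \<in> U t}
         * prob {\<omega> \<in> space M. \<forall>t\<in>J'. incr_path s (X \<omega>) t \<in> U' t}" .
  qed
qed

definition start_law :: "complex measure \<Rightarrow> (real \<Rightarrow> complex) measure \<Rightarrow> (real \<Rightarrow> complex) measure" where
  "start_law \<nu> W = distr (\<nu> \<Otimes>\<^sub>M W) paths (\<lambda>(z, v) u. z + v u)"

text \<open>The Markov property at time 0 makes the starting point independent of the increments
  from it, and these have law \<open>W\<close> by uniqueness.\<close>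

lemma brownian_law:
  assumes X: "brownian M \<nu> X" and W: "brownian W (return borel 0) (\<lambda>x. x)" "sets W = sets paths"
  shows "distr M paths X = start_law \<nu> W"
proof -
  interpret prob_space M using brownianD(1)[OF X] .
  note X_meas [measurable] = brownianD(2)[OF X] and W(2)[measurable_cong]
  let ?V = "\<lambda>\<omega>. incr_path 0 (X \<omega>)"
  have V: "?V \<in> M \<rightarrow>\<^sub>M paths" by (rule measurable_incr_path[OF X_meas]) auto
  let ?Y = "\<lambda>\<omega>. stop_path 0 (X \<omega>)"
  have Y: "?Y \<in> M \<rightarrow>\<^sub>M paths" by (rule measurable_stop_path[OF X_meas]) auto
  have VW: "distr M paths ?V = W"
  proof -
    have "distr M paths ?V = distr W paths (\<lambda>x. x)"
      by (rule brownian_law_unique[OF brownian_incr_path[OF X] W(1)]) simp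
    also have "\<dots> = W" using W(2) by (intro distr_id2) simp
    finally show ?thesis .
  qed
  interpret W: prob_space W by (rule brownianD(1)[OF W(1)])
  have "indep_var paths ?Y paths ?V" by (rule brownian_markov[OF X]) simp
  then have ind: "distr M (paths \<Otimes>\<^sub>M paths) (\<lambda>\<omega>. (?Y \<omega>, ?V \<omega>)) = distr M paths ?Y \<Otimes>\<^sub>M W"
    by (simp add: indep_var_distribution_eq VW)
  have start: "distr (distr M paths ?Y) borel (\<lambda>x. x 0) = \<nu>"
    using Y by (subst distr_distr) (auto simp: comp_def stop_path_def brownianD(3)[OF X])
  have idW: "distr W paths (\<lambda>v. v) = W" using W(2) by (intro distr_id2) simp
  have "\<nu> \<Otimes>\<^sub>M W = distr (distr M paths ?Y \<Otimes>\<^sub>M W) (borel \<Otimes>\<^sub>M paths) (\<lambda>(y, v). (y 0, v))"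
    using pair_measure_distr[of "\<lambda>x. x 0" "distr M paths ?Y" borel "\<lambda>v. v" W paths] W.sigma_finite_measure_axioms
    by (simp add: start idW)
  also have "\<dots> = distr M (borel \<Otimes>\<^sub>M paths) (\<lambda>\<omega>. (X \<omega> 0, ?V \<omega>))"
    unfolding ind[symmetric] using Y V by (subst distr_distr) (auto simp: comp_def stop_path_def)
  finally have pair: "distr M (borel \<Otimes>\<^sub>M paths) (\<lambda>\<omega>. (X \<omega> 0, ?V \<omega>)) = \<nu> \<Otimes>\<^sub>M W" ..
  have meas: "(\<lambda>(z, v) u. z + v u) \<in> borel \<Otimes>\<^sub>M paths \<rightarrow>\<^sub>M paths"
    unfolding split_beta' by (rule measurable_translate_path) measurable
  have "start_law \<nu> W = distr (distr M (borel \<Otimes>\<^sub>M paths) (\<lambda>\<omega>. (X \<omega> 0, ?V \<omega>))) paths (\<lambda>(z, v) u. z + v u)"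
    unfolding start_law_def pair ..
  also have "\<dots> = distr M paths X"
    using V measurable_path_at[OF X_meas, of 0]
    by (subst distr_distr[OF meas]) (auto simp: comp_def incr_path_def)
  finally show ?thesis ..
qed

text \<open>Being Brownian is a property of the law, so the coordinate process on path space
  inherits it.\<close>

lemma brownian_distr:
  assumes X: "brownian M \<nu> X"
  shows "brownian (distr M paths X) \<nu> (\<lambda>x. x)"
proof -
  interpret M: prob_space M using brownianD(1)[OF X] .
  note X_meas [measurable] = brownianD(2)[OF X]
  interpret P: prob_space "distr M paths X" by (rule M.prob_space_distr) measurable
  show ?thesis
    unfolding brownian_def
  proof (intro conjI allI impI)
    show "distr (distr M paths X) borel (\<lambda>x. x 0) = \<nu>"
      by (subst distr_distr) (auto simp: comp_def brownianD(3)[OF X])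
    show "distr (distr M paths X) borel (\<lambda>x. x t - x s) = gauss (t - s)" if "0 \<le> s \<and> s < t" for s t
      using that by (subst distr_distr) (auto simp: comp_def brownianD(5)[OF X])
    fix n t assume t: "increasing_times n t"
    have meas: "(\<lambda>x. path_increments t x i) \<in> borel_measurable paths" if "i \<in> {0..n}" for i
      using that increasing_times_nonneg[OF t, of i] increasing_times_nonneg[OF t, of "i - 1"]
      unfolding path_increments_def by (cases "i = 0") auto
    have 1: "distr (distr M paths X) (Pi\<^sub>M {0..n} (\<lambda>_. borel)) (\<lambda>x. \<lambda>i\<in>{0..n}. path_increments t x i)
        = distr M (Pi\<^sub>M {0..n} (\<lambda>_. borel)) (\<lambda>\<omega>. \<lambda>i\<in>{0..n}. path_increments t (X \<omega>) i)"
      by (subst distr_distr) (auto simp: comp_def intro!: measurable_restrict meas)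
    have 2: "distr (distr M paths X) borel (\<lambda>x. path_increments t x i) = distr M borel (\<lambda>\<omega>. path_increments t (X \<omega>) i)"
      if "i \<in> {0..n}" for i
      using meas[OF that] by (subst distr_distr) (auto simp: comp_def)
    have m: "(\<lambda>\<omega>. path_increments t (X \<omega>) i) \<in> borel_measurable M" if "i \<in> {0..n}" for i
      using measurable_compose[OF X_meas meas[OF that]] .
    show "P.indep_vars (\<lambda>_. borel) (\<lambda>i x. path_increments t x i) {0..n}"
    proof (subst P.indep_vars_iff_distr_eq_PiM')
      have "distr M (Pi\<^sub>M {0..n} (\<lambda>_. borel)) (\<lambda>\<omega>. \<lambda>i\<in>{0..n}. path_increments t (X \<omega>) i)
          = Pi\<^sub>M {0..n} (\<lambda>i. distr M borel (\<lambda>\<omega>. path_increments t (X \<omega>) i))"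
        using brownianD(4)[OF X t] by (subst (asm) M.indep_vars_iff_distr_eq_PiM') (auto intro: m)
      then show "distr (distr M paths X) (Pi\<^sub>M {0..n} (\<lambda>_. borel)) (\<lambda>x. \<lambda>i\<in>{0..n}. path_increments t x i)
          = Pi\<^sub>M {0..n} (\<lambda>i. distr (distr M paths X) borel (\<lambda>x. path_increments t x i))"
        unfolding 1 by (simp only:) (rule PiM_cong[OF refl 2[symmetric]])
    qed (auto intro: meas)
  qed (auto intro: P.prob_space_axioms)
qed

section \<open>Exit times\<close>

text \<open>With \<open>\<ge>\<close> in place of equality, monotonicity in the radius needs no
  intermediate values.\<close>

definition hits :: "real \<Rightarrow> (real \<Rightarrow> complex) \<Rightarrow> bool" where
  "hits \<rho> x \<longleftrightarrow> (\<exists>t\<ge>0. cmod (x t) \<ge> \<rho>)"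

text \<open>The default 0 for paths that stay inside keeps the time real-valued; by
  \<open>AE_hits\<close> such paths have probability 0.\<close>

definition exit_time :: "real \<Rightarrow> (real \<Rightarrow> complex) \<Rightarrow> real" where
  "exit_time \<rho> x = (if hits \<rho> x then Inf {t. t \<ge> 0 \<and> cmod (x t) \<ge> \<rho>} else 0)"

lemma exit_time_nonneg: "exit_time \<rho> x \<ge> 0"
  unfolding exit_time_def hits_def by (auto intro!: cInf_greatest)

lemma exit_time_le: "t \<ge> 0 \<Longrightarrow> cmod (x t) \<ge> \<rho> \<Longrightarrow> exit_time \<rho> x \<le> t"
  unfolding exit_time_def hits_def by (auto intro!: cInf_lower bdd_belowI[of _ 0])

lemma before_exit_time: "0 \<le> t \<Longrightarrow> t < exit_time \<rho> x \<Longrightarrow> cmod (x t) < \<rho>"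
  using exit_time_le[of t \<rho> x] by linarith

lemma at_exit_time:
  assumes x: "x \<in> path_set" and h: "hits \<rho> x"
  shows "cmod (x (exit_time \<rho> x)) \<ge> \<rho>"
proof -
  have "continuous_on {0..} (\<lambda>t. cmod (x t))"
    using x by (auto simp: path_set_def intro: continuous_on_norm)
  then have "closed ({0..} \<inter> (\<lambda>t. cmod (x t)) -` {\<rho>..})"
    by (rule continuous_closed_preimage) auto
  moreover have "{0..} \<inter> (\<lambda>t. cmod (x t)) -` {\<rho>..} = {t. t \<ge> 0 \<and> cmod (x t) \<ge> \<rho>}" by auto
  ultimately have "Inf {t. t \<ge> 0 \<and> cmod (x t) \<ge> \<rho>} \<in> {t. t \<ge> 0 \<and> cmod (x t) \<ge> \<rho>}"
    using h by (intro closed_contains_Inf bdd_belowI[of _ 0]) (auto simp: hits_def)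
  then show ?thesis using h by (simp add: exit_time_def)
qed

lemma norm_at_exit_time:
  assumes x: "x \<in> path_set" and h: "hits \<rho> x" and start: "cmod (x 0) \<le> \<rho>"
  shows "cmod (x (exit_time \<rho> x)) = \<rho>"
proof (rule antisym[OF _ at_exit_time[OF x h]])
  let ?T = "exit_time \<rho> x"
  show "cmod (x ?T) \<le> \<rho>"
  proof (cases "?T = 0")
    case False
    then have T: "?T > 0" using exit_time_nonneg[of \<rho> x] by simp
    have cont: "continuous_on {0..?T} (\<lambda>t. cmod (x t))"
      using x by (auto simp: path_set_def intro: continuous_on_norm continuous_on_subset)
    have "closure {0..<?T} = {0..?T}" using T by simp
    with continuous_le_on_closure[of "{0..<?T}" "\<lambda>t. cmod (x t)" ?T \<rho>] cont T
    show ?thesis using before_exit_time[of _ \<rho> x] by (auto intro: less_imp_le)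
  qed (use start in simp)
qed

text \<open>Stopping time property: whether the exit occurs by time \<open>s\<close> can be read off
  from the path stopped at \<open>s\<close>.\<close>

lemma hits_stop_iff:
  assumes x: "x \<in> path_set" and s: "s \<ge> 0"
  shows "hits \<rho> (stop_path s x) \<longleftrightarrow> hits \<rho> x \<and> exit_time \<rho> x \<le> s"
proof
  assume "hits \<rho> (stop_path s x)"
  then obtain t where "t \<ge> 0" "cmod (x (min t s)) \<ge> \<rho>" by (auto simp: hits_def stop_path_def)
  then show "hits \<rho> x \<and> exit_time \<rho> x \<le> s"
    using exit_time_le[of "min t s" \<rho> x] s by (auto simp: hits_def intro!: exI[of _ "min t s"])
next
  assume "hits \<rho> x \<and> exit_time \<rho> x \<le> s"
  then show "hits \<rho> (stop_path s x)"
    using at_exit_time[OF x, of \<rho>] exit_time_nonneg[of \<rho> x]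
    by (auto simp: hits_def stop_path_def min_def intro!: exI[of _ "exit_time \<rho> x"])
qed

lemma exit_time_stop:
  assumes x: "x \<in> path_set" and h: "hits \<rho> x" "exit_time \<rho> x \<le> s"
  shows "exit_time \<rho> (stop_path s x) = exit_time \<rho> x"
proof (rule antisym)
  let ?T = "exit_time \<rho> x"
  have s: "s \<ge> 0" using h exit_time_nonneg[of \<rho> x] by linarith
  show "exit_time \<rho> (stop_path s x) \<le> ?T"
    using at_exit_time[OF x h(1)] exit_time_nonneg[of \<rho> x] h(2)
    by (intro exit_time_le) (auto simp: stop_path_def min_def)
  have h': "hits \<rho> (stop_path s x)" using hits_stop_iff[OF x s] h by blast
  have y: "stop_path s x \<in> path_set"
    using x s unfolding path_set_def stop_path_def
    by (auto intro!: continuous_on_compose2[of "{0..}" x] continuous_intros)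
  let ?T' = "exit_time \<rho> (stop_path s x)"
  have "cmod (x (min ?T' s)) \<ge> \<rho>" using at_exit_time[OF y h'] by (simp add: stop_path_def)
  then show "?T \<le> ?T'"
    using exit_time_le[of "min ?T' s" \<rho> x] exit_time_nonneg[of \<rho> "stop_path s x"] s by simp
qed

text \<open>A continuous function on a compact set attains its infimum, so approximate solutions in
  a dense subset produce a true one. This turns an uncountable existential quantifier into countable
  ones, and gives measurability of the events about exits, contacts and intersections.\<close>

lemma ex_nonpos_iff_dense_approx:
  fixes f :: "'b :: metric_space \<Rightarrow> real"
  assumes f: "continuous_on K f" and K: "compact K" and Q: "Q \<subseteq> K" "K \<subseteq> closure Q"
  shows "(\<exists>u\<in>K. f u \<le> 0) \<longleftrightarrow> (\<forall>k::nat. \<exists>q\<in>Q. f q < 1 / Suc k)"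
proof
  assume "\<exists>u\<in>K. f u \<le> 0"
  then obtain u where u: "u \<in> K" "f u \<le> 0" by auto
  show "\<forall>k::nat. \<exists>q\<in>Q. f q < 1 / Suc k"
  proof
    fix k :: nat
    have "f u < 1 / Suc k" using u by (meson le_less_trans of_nat_0_less_iff zero_less_Suc zero_less_divide_1_iff)
    then have "1 / Suc k - f u > 0" by simp
    then obtain d where d: "d > 0" "\<And>v. v \<in> K \<Longrightarrow> dist v u < d \<Longrightarrow> dist (f v) (f u) < 1 / Suc k - f u"
      using f u(1) unfolding continuous_on_iff by metis
    obtain q where q: "q \<in> Q" "dist q u < d"
      using u(1) Q(2) d(1) by (meson closure_approachable subsetD)
    then have "dist (f q) (f u) < 1 / Suc k - f u" using Q(1) by (intro d(2)) auto
    then have "f q < 1 / Suc k" by (simp add: dist_real_def)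
    then show "\<exists>q\<in>Q. f q < 1 / Suc k" using q by auto
  qed
next
  assume *: "\<forall>k::nat. \<exists>q\<in>Q. f q < 1 / Suc k"
  then have "K \<noteq> {}" using Q(1) by blast
  then obtain u where u: "u \<in> K" "\<And>v. v \<in> K \<Longrightarrow> f u \<le> f v"
    using continuous_attains_inf[of K f] f K by auto
  have "f u \<le> 0"
  proof (rule ccontr)
    assume "\<not> f u \<le> 0"
    then obtain k :: nat where "inverse (real (Suc k)) < f u" using reals_Archimedean[of "f u"] by auto
    moreover obtain q where "q \<in> Q" "f q < 1 / Suc k" using * by blast
    ultimately show False using u(2)[of q] Q(1) by (auto simp: inverse_eq_divide)
  qed
  then show "\<exists>u\<in>K. f u \<le> 0" using u by auto
qed

lemma pred_ex_nonpos:
  fixes g :: "'b :: metric_space \<Rightarrow> 'a \<Rightarrow> real"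
  assumes cont: "\<And>\<omega>. \<omega> \<in> space M \<Longrightarrow> continuous_on K (\<lambda>u. g u \<omega>)"
    and K: "compact K" and Q: "Q \<subseteq> K" "K \<subseteq> closure Q" "countable Q"
    and [measurable]: "\<And>u. u \<in> K \<Longrightarrow> g u \<in> borel_measurable M"
  shows "Measurable.pred M (\<lambda>\<omega>. \<exists>u\<in>K. g u \<omega> \<le> 0)"
proof -
  have "Measurable.pred M (\<lambda>\<omega>. \<forall>k::nat. \<exists>q\<in>Q. g q \<omega> < 1 / Suc k)"
  proof (intro pred_intros_countable)
    fix k :: nat
    have "Measurable.pred M (\<lambda>\<omega>. g q \<omega> < 1 / Suc k)" if "q \<in> Q" for q
    proof -
      have [measurable]: "g q \<in> borel_measurable M" using that Q(1) by auto
      show ?thesis by measurable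
    qed
    then show "Measurable.pred M (\<lambda>\<omega>. \<exists>q\<in>Q. g q \<omega> < 1 / Suc k)"
      unfolding pred_def by (rule sets.sets_Collect_countable_Ex'[OF _ Q(3)])
  qed
  then show ?thesis
    by (rule iffD1[OF measurable_cong, rotated]) (use ex_nonpos_iff_dense_approx[OF cont K Q(1,2)] in auto)
qed

lemma countable_rat_interval: "countable (\<rat> \<inter> {0..1::real})"
  by (rule countable_subset[OF _ countable_rat]) auto

lemma closure_rat_interval: "{0..1::real} \<subseteq> closure (\<rat> \<inter> {0..1})"
proof
  fix u :: real assume u: "u \<in> {0..1}"
  show "u \<in> closure (\<rat> \<inter> {0..1})"
    unfolding closure_approachable
  proof (intro allI impI)
    fix d :: real assume "d > 0"
    then obtain q where "q \<in> \<rat>" "max 0 (u - d) < q \<and> q < min 1 (u + d)"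
      using Rats_dense_in_real[of "max 0 (u - d)" "min 1 (u + d)"] u by auto
    then show "\<exists>q\<in>\<rat> \<inter> {0..1}. dist q u < d" by (intro bexI[of _ q]) (auto simp: dist_real_def)
  qed
qed

lemmas pred_ex_closed_time =
  pred_ex_nonpos[OF _ compact_Icc Int_lower2 closure_rat_interval countable_rat_interval]

lemma hits_before_iff:
  assumes x: "x \<in> path_set" and a: "a \<ge> 0"
  shows "hits \<rho> x \<and> exit_time \<rho> x \<le> a \<longleftrightarrow> (\<exists>u\<in>{0..1}. \<rho> - cmod (x (a * u)) \<le> 0)"
proof
  assume h: "hits \<rho> x \<and> exit_time \<rho> x \<le> a"
  let ?u = "if a = 0 then 0 else exit_time \<rho> x / a"
  have "a * ?u = exit_time \<rho> x" "?u \<in> {0..1}"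
    using h a exit_time_nonneg[of \<rho> x] by (auto simp: divide_simps)
  then show "\<exists>u\<in>{0..1}. \<rho> - cmod (x (a * u)) \<le> 0"
    using at_exit_time[OF x] h by (intro bexI[of _ ?u]) auto
next
  assume "\<exists>u\<in>{0..1}. \<rho> - cmod (x (a * u)) \<le> 0"
  then obtain u where u: "u \<in> {0..1}" "cmod (x (a * u)) \<ge> \<rho>" by auto
  then have "0 \<le> a * u" "a * u \<le> a" using a by (auto simp: mult_left_le)
  then show "hits \<rho> x \<and> exit_time \<rho> x \<le> a"
    using exit_time_le[of "a * u" \<rho> x] u(2) by (auto simp: hits_def)
qed

lemma pred_hits_before:
  assumes "a \<ge> 0"
  shows "Measurable.pred paths (\<lambda>x. hits \<rho> x \<and> exit_time \<rho> x \<le> a)"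
proof -
  have "Measurable.pred paths (\<lambda>x. \<exists>u\<in>{0..1}. \<rho> - cmod (x (a * u)) \<le> 0)"
  proof (rule pred_ex_closed_time)
    show "continuous_on {0..1} (\<lambda>u. \<rho> - cmod (x (a * u)))" if "x \<in> space paths" for x
    proof -
      have "continuous_on {0..} x" using that by (simp add: path_set_def)
      then have "continuous_on {0..1} (\<lambda>u. x (a * u))"
        by (rule continuous_on_compose2) (use assms in \<open>auto intro!: continuous_intros\<close>)
      then show ?thesis by (intro continuous_intros)
    qed
    show "(\<lambda>x. \<rho> - cmod (x (a * u))) \<in> borel_measurable paths" if "u \<in> {0..1}" for u
    proof -
      have [measurable]: "(\<lambda>x. x (a * u)) \<in> borel_measurable paths"
        using assms that by (intro measurable_eval_path) auto
      show ?thesis by measurable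
    qed
  qed
  then show ?thesis
    by (rule iffD1[OF measurable_cong, rotated]) (use hits_before_iff[OF _ assms] in auto)
qed

lemma pred_hits [measurable]: "Measurable.pred paths (hits \<rho>)"
proof -
  have "hits \<rho> x \<longleftrightarrow> (\<exists>n::nat. hits \<rho> x \<and> exit_time \<rho> x \<le> real n)" for x
    using real_arch_simple by auto
  then have "hits \<rho> = (\<lambda>x. \<exists>n::nat. hits \<rho> x \<and> exit_time \<rho> x \<le> real n)" by (intro ext)
  moreover have "Measurable.pred paths (\<lambda>x. \<exists>n::nat. hits \<rho> x \<and> exit_time \<rho> x \<le> real n)"
    by (intro pred_intros_countable pred_hits_before) simp
  ultimately show ?thesis by simp
qed

lemma exit_time_measurable [measurable]: "exit_time \<rho> \<in> borel_measurable paths"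
proof (rule borel_measurableI_le)
  fix a :: real
  show "{x \<in> space paths. exit_time \<rho> x \<le> a} \<in> sets paths"
  proof (cases "a \<ge> 0")
    case True
    have "{x \<in> space paths. exit_time \<rho> x \<le> a}
        = (space paths - {x \<in> space paths. hits \<rho> x}) \<union> {x \<in> space paths. hits \<rho> x \<and> exit_time \<rho> x \<le> a}"
      using True by (auto simp: exit_time_def)
    moreover have "\<dots> \<in> sets paths"
      using pred_hits[of \<rho>] pred_hits_before[OF True, of \<rho>] unfolding pred_def
      by (intro sets.Un sets.Diff sets.top)
    ultimately show ?thesis by (simp only:)
  next
    case False
    then have "{x \<in> space paths. exit_time \<rho> x \<le> a} = {}"
      using exit_time_nonneg[of \<rho>] by (auto intro: order_trans)
    then show ?thesis by (simp only: sets.empty_sets)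
  qed
qed

text \<open>A path that never reaches modulus \<open>\<rho>\<close> has its displacement from the
  start in a fixed ball at every time. The Gaussian law at time \<open>t\<close> gives that ball at
  most its area divided by \<open>2 * pi * t\<close>, which tends to 0.\<close>

lemma AE_hits:
  assumes X: "brownian M \<nu> X"
  shows "AE \<omega> in M. hits \<rho> (X \<omega>)"
proof -
  interpret prob_space M using brownianD(1)[OF X] .
  note X_meas [measurable] = brownianD(2)[OF X]
  note [measurable] = measurable_path_at[OF X_meas]
  have hm [measurable]: "Measurable.pred M (\<lambda>\<omega>. hits \<rho> (X \<omega>))"
    using measurable_compose[OF X_meas pred_hits] .
  define v where "v = measure lborel (ball (0::complex) (2 * \<bar>\<rho>\<bar> + 1))"
  have v: "emeasure lborel (ball (0::complex) (2 * \<bar>\<rho>\<bar> + 1)) = ennreal v"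
    unfolding v_def by (rule emeasure_eq_ennreal_measure) (metis emeasure_lborel_ball_finite infinity_ennreal_def less_irrefl)
  have bound: "emeasure M {\<omega> \<in> space M. \<not> hits \<rho> (X \<omega>)} \<le> ennreal (v / (2 * pi * t))" if t: "t > 0" for t
  proof -
    have "emeasure M {\<omega> \<in> space M. \<not> hits \<rho> (X \<omega>)}
        \<le> emeasure M ((\<lambda>\<omega>. X \<omega> t - X \<omega> 0) -` ball 0 (2 * \<bar>\<rho>\<bar> + 1) \<inter> space M)"
    proof (rule emeasure_mono)
      show "{\<omega> \<in> space M. \<not> hits \<rho> (X \<omega>)} \<subseteq> (\<lambda>\<omega>. X \<omega> t - X \<omega> 0) -` ball 0 (2 * \<bar>\<rho>\<bar> + 1) \<inter> space M"
      proof
        fix \<omega> assume \<omega>: "\<omega> \<in> {\<omega> \<in> space M. \<not> hits \<rho> (X \<omega>)}"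
        then have "\<not> hits \<rho> (X \<omega>)" by simp
        then have "\<And>u. u \<ge> 0 \<Longrightarrow> cmod (X \<omega> u) < \<rho>" unfolding hits_def by (meson not_le)
        then have "cmod (X \<omega> t) < \<rho>" "cmod (X \<omega> 0) < \<rho>" using t by simp_all
        then show "\<omega> \<in> (\<lambda>\<omega>. X \<omega> t - X \<omega> 0) -` ball 0 (2 * \<bar>\<rho>\<bar> + 1) \<inter> space M"
          using \<omega> norm_triangle_ineq4[of "X \<omega> t" "X \<omega> 0"] by simp
      qed
      show "(\<lambda>\<omega>. X \<omega> t - X \<omega> 0) -` ball 0 (2 * \<bar>\<rho>\<bar> + 1) \<inter> space M \<in> sets M"
        using t by (intro measurable_sets[where A=borel] borel_measurable_diff) auto
    qed
    also have "\<dots> = emeasure (distr M borel (\<lambda>\<omega>. X \<omega> t - X \<omega> 0)) (ball 0 (2 * \<bar>\<rho>\<bar> + 1))"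
      using t by (subst emeasure_distr) auto
    also have "\<dots> = (\<integral>\<^sup>+z. gauss_density t z * indicator (ball 0 (2 * \<bar>\<rho>\<bar> + 1)) z \<partial>lborel)"
      using t by (simp add: brownianD(5)[OF X] gauss_def emeasure_density)
    also have "\<dots> \<le> (\<integral>\<^sup>+z. ennreal (1 / (2 * pi * t)) * indicator (ball (0::complex) (2 * \<bar>\<rho>\<bar> + 1)) z \<partial>lborel)"
      unfolding gauss_density_def
      by (intro nn_integral_mono)
         (use t in \<open>auto simp: indicator_def divide_simps intro!: ennreal_leI divide_right_mono\<close>)
    also have "\<dots> = ennreal (1 / (2 * pi * t)) * ennreal v"
      by (subst nn_integral_cmult_indicator) (auto simp only: v sets_lborel intro: borel_open open_ball)
    also have "\<dots> = ennreal (v / (2 * pi * t))"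
      using t by (simp add: ennreal_mult'[symmetric] v_def)
    finally show ?thesis .
  qed
  have "emeasure M {\<omega> \<in> space M. \<not> hits \<rho> (X \<omega>)} \<le> 0"
  proof (rule LIMSEQ_le_const)
    have "(\<lambda>n. v / (2 * pi) / real (Suc n)) \<longlonglongrightarrow> 0" by (rule LIMSEQ_Suc, rule lim_const_over_n)
    then have "(\<lambda>n. ennreal (v / (2 * pi) / real (Suc n))) \<longlonglongrightarrow> ennreal 0" by (rule tendsto_ennrealI)
    then show "(\<lambda>n. ennreal (v / (2 * pi * real (Suc n)))) \<longlonglongrightarrow> 0" by (simp add: field_simps)
    show "\<exists>N. \<forall>n\<ge>N. emeasure M {\<omega> \<in> space M. \<not> hits \<rho> (X \<omega>)} \<le> ennreal (v / (2 * pi * real (Suc n)))"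
      using bound[of "real (Suc _)"] by simp
  qed
  then show ?thesis
    by (intro AE_I[of _ _ "{\<omega> \<in> space M. \<not> hits \<rho> (X \<omega>)}"]) auto
qed

section \<open>The strong Markov property\<close>

text \<open>Continuous functions increasing to the indicator of an open set. The case
  \<open>UNIV\<close> is separate because \<open>infdist\<close> to the empty set is 0.\<close>

definition soft_indicator :: "nat \<Rightarrow> complex set \<Rightarrow> complex \<Rightarrow> real" where
  "soft_indicator m U z = (if U = UNIV then 1 else min 1 (real m * infdist z (- U)))"

lemma soft_indicator_bounds: "0 \<le> soft_indicator m U z" "soft_indicator m U z \<le> 1"
  by (auto simp: soft_indicator_def infdist_nonneg)

lemma continuous_soft_indicator: "continuous_on UNIV (soft_indicator m U)"
  unfolding soft_indicator_def by (cases "U = UNIV") (auto intro!: continuous_intros)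

lemma soft_indicator_measurable [measurable]: "soft_indicator m U \<in> borel_measurable borel"
  by (intro borel_measurable_continuous_onI continuous_soft_indicator)

lemma soft_indicator_tendsto:
  assumes U: "open U"
  shows "(\<lambda>m. soft_indicator m U z) \<longlonglongrightarrow> indicator U z"
proof (cases "U = UNIV")
  case False
  show ?thesis
  proof (cases "z \<in> U")
    case True
    have "closed (- U)" "- U \<noteq> {}" using U False by auto
    then have pos: "infdist z (- U) > 0"
      using True in_closed_iff_infdist_zero[of "- U" z] infdist_nonneg[of z "- U"] by fastforce
    obtain N :: nat where N: "1 / infdist z (- U) < real N" using reals_Archimedean2 by auto
    have "soft_indicator m U z = 1" if "m \<ge> N" for m
    proof -
      have "1 / infdist z (- U) \<le> real m" using N that by linarith
      then have "1 \<le> real m * infdist z (- U)" using pos by (simp add: field_simps)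
      then show ?thesis by (simp add: soft_indicator_def)
    qed
    then show ?thesis using True
      by (intro tendsto_eventually) (auto simp: eventually_sequentially)
  next
    case z: False
    then have "infdist z (- U) = 0" by simp
    then show ?thesis using z False by (simp add: soft_indicator_def)
  qed
qed (simp add: soft_indicator_def)

lemma cylinder_sets: 
  assumes "finite J" "J \<subseteq> {0..}" "\<And>t. open (U t)"
  shows "{x \<in> path_set. \<forall>t\<in>J. x t \<in> U t} \<in> sets paths"
  using assms by (auto simp: sets_paths cylinders_def intro!: sigma_sets.Basic)

lemma stop_path_in_path_set: "x \<in> path_set \<Longrightarrow> s \<ge> 0 \<Longrightarrow> stop_path s x \<in> path_set"
  unfolding path_set_def stop_path_def
  by (auto intro!: continuous_on_compose2[of "{0..}" x] continuous_intros)

lemma stop_path_stop_path: "r \<le> s \<Longrightarrow> stop_path r (stop_path s x) = stop_path r x"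
  by (auto simp: stop_path_def min_def fun_eq_iff)

text \<open>\<open>W\<close> is the law started at 0. The locale postulates such a law and the
  Brownian property of its uniform start on the unit circle; the final theorem supplies both from
  the given processes.\<close>

locale wiener =
  fixes W :: "(real \<Rightarrow> complex) measure"
  assumes brownian_W: "brownian W (return borel 0) (\<lambda>x. x)"
    and sets_W [simp, measurable_cong]: "sets W = sets paths"
    and brownian_circ_1: "brownian (start_law (circ 1) W) (circ 1) (\<lambda>x. x)"
begin

sublocale W: prob_space W by (rule brownianD(1)[OF brownian_W])

lemma space_W [simp]: "space W = path_set"
  using sets_eq_imp_space_eq[OF sets_W] by simp

lemma distr_incr_path:
  assumes X: "brownian M \<nu> X" and s: "s \<ge> 0"
  shows "distr M paths (\<lambda>\<omega>. incr_path s (X \<omega>)) = W"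
proof -
  have "distr M paths (\<lambda>\<omega>. incr_path s (X \<omega>)) = distr W paths (\<lambda>x. x)"
    by (rule brownian_law_unique[OF brownian_incr_path[OF X s] brownian_W])
  also have "\<dots> = W" by (intro distr_id2) simp
  finally show ?thesis .
qed

lemma markov_rectangle:
  assumes X: "brownian M \<nu> X" and s: "s \<ge> 0" and A: "A \<in> sets paths" and C: "C \<in> sets paths"
  shows "emeasure M {\<omega> \<in> space M. stop_path s (X \<omega>) \<in> A \<and> incr_path s (X \<omega>) \<in> C}
    = emeasure M {\<omega> \<in> space M. stop_path s (X \<omega>) \<in> A} * emeasure W C"
proof -
  interpret M: prob_space M using brownianD(1)[OF X] .
  note X_meas = brownianD(2)[OF X]
  have V: "(\<lambda>\<omega>. incr_path s (X \<omega>)) \<in> M \<rightarrow>\<^sub>M paths"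
    by (rule measurable_incr_path[OF X_meas]) (use s in auto)
  have "M.prob ((\<lambda>\<omega>. (stop_path s (X \<omega>), incr_path s (X \<omega>))) -` (A \<times> C) \<inter> space M)
      = M.prob ((\<lambda>\<omega>. stop_path s (X \<omega>)) -` A \<inter> space M) * M.prob ((\<lambda>\<omega>. incr_path s (X \<omega>)) -` C \<inter> space M)"
    by (rule M.indep_varD[OF brownian_markov[OF X s] A C])
  moreover have "emeasure W C = emeasure M ((\<lambda>\<omega>. incr_path s (X \<omega>)) -` C \<inter> space M)"
    unfolding distr_incr_path[OF X s, symmetric] using V C by (rule emeasure_distr)
  moreover have "(\<lambda>\<omega>. (stop_path s (X \<omega>), incr_path s (X \<omega>))) -` (A \<times> C) \<inter> space M
      = {\<omega> \<in> space M. stop_path s (X \<omega>) \<in> A \<and> incr_path s (X \<omega>) \<in> C}"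
    "(\<lambda>\<omega>. stop_path s (X \<omega>)) -` A \<inter> space M = {\<omega> \<in> space M. stop_path s (X \<omega>) \<in> A}" by auto
  ultimately show ?thesis
    by (simp add: M.emeasure_eq_measure ennreal_mult'')
qed

text \<open>\<open>\<tau>\<close> is the first point of the dyadic grid strictly after the exit
  time, hence takes countably many values. Where it equals a given grid point, the exit has occurred
  before that deterministic time, so the past until exit is a function of the path stopped there and
  the simple Markov property applies.\<close>

lemma strong_markov_grid:
  fixes n :: nat and \<rho> :: real
  assumes X: "brownian M \<nu> X" and A: "A \<in> sets paths" and C: "C \<in> sets paths"
  defines "\<tau> \<equiv> \<lambda>x. (of_int \<lfloor>2 ^ n * exit_time \<rho> x\<rfloor> + 1) / 2 ^ n :: real"
  shows "emeasure M {\<omega> \<in> space M. stop_path (exit_time \<rho> (X \<omega>)) (X \<omega>) \<in> A \<and> incr_path (\<tau> (X \<omega>)) (X \<omega>) \<in> C}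
    = emeasure M {\<omega> \<in> space M. stop_path (exit_time \<rho> (X \<omega>)) (X \<omega>) \<in> A} * emeasure W C"
    (is "emeasure M ?L = emeasure M ?R * _")
proof -
  interpret M: prob_space M using brownianD(1)[OF X] .
  note X_meas [measurable] = brownianD(2)[OF X]
  have Xp: "X \<omega> \<in> path_set" if "\<omega> \<in> space M" for \<omega>
    using measurable_space[OF X_meas that] by simp
  define K where "K x = nat \<lfloor>2 ^ n * exit_time \<rho> x\<rfloor>" for x
  have K [measurable]: "K \<in> paths \<rightarrow>\<^sub>M count_space UNIV" unfolding K_def by measurable
  have \<tau>K: "\<tau> x = (real (K x) + 1) / 2 ^ n" for x
    using exit_time_nonneg[of \<rho> x] by (simp add: \<tau>_def K_def)
  have lt: "exit_time \<rho> x < \<tau> x" for x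
    unfolding \<tau>_def using floor_correct[of "2 ^ n * exit_time \<rho> x"] by (simp add: field_simps)
  define s where "s k = (real k + 1) / 2 ^ n" for k
  have s: "s k \<ge> 0" for k by (simp add: s_def)
  have stopm [measurable]: "(\<lambda>x. stop_path (exit_time \<rho> x) x) \<in> paths \<rightarrow>\<^sub>M paths"
    by (rule measurable_stop_path) (auto simp: exit_time_nonneg)
  note [measurable] = A C
  have Cm [measurable]: "Measurable.pred M (\<lambda>\<omega>. incr_path (s k) (X \<omega>) \<in> C)" for k
  proof -
    have "(\<lambda>\<omega>. incr_path (s k) (X \<omega>)) \<in> M \<rightarrow>\<^sub>M paths"
      by (rule measurable_incr_path[OF X_meas]) (use s in auto)
    then show ?thesis by measurable
  qed
  \<comment> \<open>\<open>A' k\<close> is the event \<open>E k\<close> as seen by the path stopped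
    at \<open>s k\<close>. The condition \<open>hits\<close> excludes the default exit time 0, which
    the stopped path would show for an exit still to come.\<close>
  define A' where "A' k = {y \<in> space paths. hits \<rho> y \<and> K y = k \<and> stop_path (exit_time \<rho> y) y \<in> A}" for k
  have A' [measurable]: "A' k \<in> sets paths" for k unfolding A'_def by measurable
  define E where "E k = {\<omega> \<in> space M. hits \<rho> (X \<omega>) \<and> K (X \<omega>) = k \<and> stop_path (exit_time \<rho> (X \<omega>)) (X \<omega>) \<in> A}" for k
  have E [measurable]: "E k \<in> sets M" for k unfolding E_def by measurable
  have E_eq: "E k = {\<omega> \<in> space M. stop_path (s k) (X \<omega>) \<in> A' k}" for k
  proof (intro set_eqI iffI)
    fix \<omega> assume "\<omega> \<in> E k"
    then have \<omega>: "\<omega> \<in> space M" "hits \<rho> (X \<omega>)" "K (X \<omega>) = k" "stop_path (exit_time \<rho> (X \<omega>)) (X \<omega>) \<in> A"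
      by (auto simp: E_def)
    then have le: "exit_time \<rho> (X \<omega>) \<le> s k" using lt[of "X \<omega>"] by (simp add: \<tau>K s_def)
    note eq = exit_time_stop[OF Xp[OF \<omega>(1)] \<omega>(2) le]
    have "hits \<rho> (stop_path (s k) (X \<omega>))" using hits_stop_iff[OF Xp s] \<omega> le by blast
    moreover have "K (stop_path (s k) (X \<omega>)) = k" using eq \<omega> by (simp add: K_def)
    ultimately show "\<omega> \<in> {\<omega> \<in> space M. stop_path (s k) (X \<omega>) \<in> A' k}"
      using \<omega> le stop_path_in_path_set[OF Xp s] by (simp add: A'_def eq stop_path_stop_path)
  next
    fix \<omega> assume "\<omega> \<in> {\<omega> \<in> space M. stop_path (s k) (X \<omega>) \<in> A' k}"
    then have \<omega>: "\<omega> \<in> space M" "hits \<rho> (stop_path (s k) (X \<omega>))" "K (stop_path (s k) (X \<omega>)) = k"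
      "stop_path (exit_time \<rho> (stop_path (s k) (X \<omega>))) (stop_path (s k) (X \<omega>)) \<in> A"
      by (auto simp: A'_def)
    then have h: "hits \<rho> (X \<omega>)" "exit_time \<rho> (X \<omega>) \<le> s k" using hits_stop_iff[OF Xp s] by blast+
    note eq = exit_time_stop[OF Xp[OF \<omega>(1)] h]
    show "\<omega> \<in> E k" using \<omega> h by (simp add: E_def eq stop_path_stop_path K_def)
  qed
  have disj: "disjoint_family E" by (auto simp: disjoint_family_on_def E_def)
  have prod: "emeasure M {\<omega> \<in> space M. \<omega> \<in> E k \<and> incr_path (s k) (X \<omega>) \<in> C} = emeasure M (E k) * emeasure W C" for k
  proof -
    have "{\<omega> \<in> space M. \<omega> \<in> E k \<and> incr_path (s k) (X \<omega>) \<in> C}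
        = {\<omega> \<in> space M. stop_path (s k) (X \<omega>) \<in> A' k \<and> incr_path (s k) (X \<omega>) \<in> C}"
      unfolding E_eq by auto
    then show ?thesis
      using markov_rectangle[OF X s A' C, of k k] unfolding E_eq[symmetric] by (simp only:)
  qed
  note AEh = AE_hits[OF X, of \<rho>]
  have Lm: "?L \<in> sets M"
  proof -
    have 1: "(\<lambda>\<omega>. incr_path (\<tau> (X \<omega>)) (X \<omega>)) \<in> M \<rightarrow>\<^sub>M paths"
      by (rule measurable_incr_path[OF X_meas])
         (auto simp: \<tau>_def intro!: divide_nonneg_nonneg add_nonneg_nonneg mult_nonneg_nonneg exit_time_nonneg)
    have 2: "Measurable.pred M (\<lambda>\<omega>. incr_path (\<tau> (X \<omega>)) (X \<omega>) \<in> C)"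
      using 1 C by measurable
    show ?thesis using 2 by measurable
  qed
  have Rm: "?R \<in> sets M" by measurable
  have "emeasure M ?L = emeasure M (\<Union>k. {\<omega> \<in> space M. \<omega> \<in> E k \<and> incr_path (s k) (X \<omega>) \<in> C})"
  proof (rule emeasure_eq_AE)
    show "AE \<omega> in M. \<omega> \<in> ?L \<longleftrightarrow> \<omega> \<in> (\<Union>k. {\<omega> \<in> space M. \<omega> \<in> E k \<and> incr_path (s k) (X \<omega>) \<in> C})"
      using AEh by eventually_elim (auto simp: E_def \<tau>K s_def)
  qed (use Lm in measurable)
  also have "\<dots> = (\<Sum>k. emeasure M {\<omega> \<in> space M. \<omega> \<in> E k \<and> incr_path (s k) (X \<omega>) \<in> C})"
    by (rule suminf_emeasure[symmetric]) (use disj in \<open>auto simp: disjoint_family_on_def\<close>)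
  also have "\<dots> = (\<Sum>k. emeasure M (E k)) * emeasure W C"
    unfolding prod by simp
  also have "(\<Sum>k. emeasure M (E k)) = emeasure M (\<Union>k. E k)"
    by (rule suminf_emeasure) (use disj in auto)
  also have "\<dots> = emeasure M ?R"
  proof (rule emeasure_eq_AE)
    show "AE \<omega> in M. \<omega> \<in> (\<Union>k. E k) \<longleftrightarrow> \<omega> \<in> ?R"
      using AEh by eventually_elim (auto simp: E_def)
  qed (use Rm in measurable)
  finally show ?thesis .
qed

text \<open>The grid times decrease to the exit time; continuity of the paths passes the product
  formula to the limit for products of continuous functions of the increments.\<close>

lemma strong_markov_rectangle:
  assumes X: "brownian M \<nu> X" and A: "A \<in> sets paths" and C: "C \<in> sets paths"
  shows "emeasure M {\<omega> \<in> space M. stop_path (exit_time \<rho> (X \<omega>)) (X \<omega>) \<in> A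
        \<and> incr_path (exit_time \<rho> (X \<omega>)) (X \<omega>) \<in> C}
    = emeasure M {\<omega> \<in> space M. stop_path (exit_time \<rho> (X \<omega>)) (X \<omega>) \<in> A} * emeasure W C"
proof -
  interpret M: prob_space M using brownianD(1)[OF X] .
  note X_meas [measurable] = brownianD(2)[OF X]
  have Xc: "continuous_on {0..} (X \<omega>)" if "\<omega> \<in> space M" for \<omega>
    using paths_measurable_continuous[OF X_meas that] .
  define T where "T \<omega> = exit_time \<rho> (X \<omega>)" for \<omega>
  have T [measurable]: "T \<in> borel_measurable M" unfolding T_def by measurable
  have T0: "T \<omega> \<ge> 0" for \<omega> by (simp add: T_def exit_time_nonneg)
  define \<tau> where "\<tau> n \<omega> = (of_int \<lfloor>2 ^ n * T \<omega>\<rfloor> + 1) / (2 ^ n :: real)" for n :: nat and \<omega>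
  have \<tau> [measurable]: "\<tau> n \<in> borel_measurable M" for n unfolding \<tau>_def by measurable
  have \<tau>0: "\<tau> n \<omega> \<ge> 0" for n \<omega>
    unfolding \<tau>_def using T0[of \<omega>] by (intro divide_nonneg_nonneg add_nonneg_nonneg) auto
  have \<tau>_lim: "(\<lambda>n. \<tau> n \<omega>) \<longlonglongrightarrow> T \<omega>" for \<omega>
  proof (rule tendsto_sandwich[of "\<lambda>n. T \<omega>" _ _ "\<lambda>n. T \<omega> + 1 / 2 ^ n"])
    have "T \<omega> \<le> \<tau> n \<omega>" "\<tau> n \<omega> \<le> T \<omega> + 1 / 2 ^ n" for n
      using floor_correct[of "2 ^ n * T \<omega>"] unfolding \<tau>_def by (auto simp: field_simps)
    then show "eventually (\<lambda>n. T \<omega> \<le> \<tau> n \<omega>) sequentially"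
      "eventually (\<lambda>n. \<tau> n \<omega> \<le> T \<omega> + 1 / 2 ^ n) sequentially" by simp_all
    have "(\<lambda>n. T \<omega> + (1 / 2) ^ n) \<longlonglongrightarrow> T \<omega> + 0"
      by (intro tendsto_intros LIMSEQ_power_zero) simp
    then show "(\<lambda>n. T \<omega> + 1 / 2 ^ n) \<longlonglongrightarrow> T \<omega>" by (simp add: power_divide)
  qed simp
  define V where "V \<omega> = incr_path (T \<omega>) (X \<omega>)" for \<omega>
  define Vn where "Vn n \<omega> = incr_path (\<tau> n \<omega>) (X \<omega>)" for n \<omega>
  have V [measurable]: "V \<in> M \<rightarrow>\<^sub>M paths"
    unfolding V_def by (rule measurable_incr_path[OF X_meas T T0])
  have Vn [measurable]: "Vn n \<in> M \<rightarrow>\<^sub>M paths" for n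
    unfolding Vn_def by (rule measurable_incr_path[OF X_meas \<tau> \<tau>0])
  have V_lim: "(\<lambda>n. Vn n \<omega> u) \<longlonglongrightarrow> V \<omega> u" if \<omega>: "\<omega> \<in> space M" and u: "u \<ge> 0" for \<omega> u
    unfolding Vn_def V_def incr_path_def
    by (intro tendsto_diff continuous_on_tendsto_compose[OF Xc[OF \<omega>]] tendsto_add \<tau>_lim tendsto_const)
       (use T0[of \<omega>] \<tau>0[of _ \<omega>] u in auto)
  define Y where "Y = {\<omega> \<in> space M. stop_path (T \<omega>) (X \<omega>) \<in> A}"
  have Y [measurable]: "Y \<in> sets M"
    unfolding Y_def using measurable_stop_path[OF X_meas T T0] A by measurable
  \<comment> \<open>The grid version says that, restricted to \<open>Y\<close>, the law of
    \<open>Vn n\<close> is \<open>W\<close> times the mass of \<open>Y\<close>, for every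
    \<open>n\<close>. Only the passage from \<open>Vn n\<close> to its limit \<open>V\<close>
    remains.\<close>
  have law: "distr (density M (indicator Y)) paths (Vn n) = density W (\<lambda>_. emeasure M Y)" for n
  proof (rule measure_eqI)
    fix C assume "C \<in> sets (distr (density M (indicator Y)) paths (Vn n))"
    then have C [measurable]: "C \<in> sets paths" by simp
    have "emeasure (distr (density M (indicator Y)) paths (Vn n)) C
        = (\<integral>\<^sup>+\<omega>. indicator Y \<omega> * indicator (Vn n -` C \<inter> space M) \<omega> \<partial>M)"
      by (simp add: emeasure_distr emeasure_density)
    also have "\<dots> = (\<integral>\<^sup>+\<omega>. indicator {\<omega> \<in> space M. stop_path (T \<omega>) (X \<omega>) \<in> A \<and> Vn n \<omega> \<in> C} \<omega> \<partial>M)"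
      by (intro nn_integral_cong) (auto simp: indicator_def Y_def)
    also have "\<dots> = emeasure M {\<omega> \<in> space M. stop_path (T \<omega>) (X \<omega>) \<in> A \<and> Vn n \<omega> \<in> C}"
    proof (rule nn_integral_indicator)
      have "{\<omega> \<in> space M. stop_path (T \<omega>) (X \<omega>) \<in> A \<and> Vn n \<omega> \<in> C} = Y \<inter> (Vn n -` C \<inter> space M)"
        by (auto simp: Y_def)
      then show "{\<omega> \<in> space M. stop_path (T \<omega>) (X \<omega>) \<in> A \<and> Vn n \<omega> \<in> C} \<in> sets M" by simp
    qed
    also have "\<dots> = emeasure M Y * emeasure W C"
      using strong_markov_grid[OF X A C, of \<rho> n] unfolding Y_def Vn_def \<tau>_def T_def by simp
    finally show "emeasure (distr (density M (indicator Y)) paths (Vn n)) C = emeasure (density W (\<lambda>_. emeasure M Y)) C"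
      by (simp add: emeasure_density nn_integral_cmult)
  qed simp
  have int: "(\<integral>\<^sup>+\<omega>. indicator Y \<omega> * F (Vn n \<omega>) \<partial>M) = emeasure M Y * (\<integral>\<^sup>+x. F x \<partial>W)"
    if [measurable]: "F \<in> borel_measurable paths" for F n
  proof -
    have "(\<integral>\<^sup>+\<omega>. indicator Y \<omega> * F (Vn n \<omega>) \<partial>M) = (\<integral>\<^sup>+x. F x \<partial>distr (density M (indicator Y)) paths (Vn n))"
      by (simp add: nn_integral_distr nn_integral_density)
    also have "\<dots> = emeasure M Y * (\<integral>\<^sup>+x. F x \<partial>W)"
      unfolding law by (simp add: nn_integral_density nn_integral_cmult)
    finally show ?thesis .
  qed
  have "distr (density M (indicator Y)) paths V = density W (\<lambda>_. emeasure M Y)"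
  proof (rule paths_measure_eqI)
    show "finite_measure (distr (density M (indicator Y)) paths V)"
      by (intro finite_measure.finite_measure_distr M.finite_measure_restricted) auto
    fix J :: "real set" and U :: "real \<Rightarrow> complex set" assume J: "finite J" "J \<subseteq> {0..}" and U: "\<And>t. open (U t)"
    define F where "F m x = (\<Prod>t\<in>J. soft_indicator m (U t) (x t))" for m x
    have F_meas [measurable]: "F m \<in> borel_measurable paths" for m
      unfolding F_def
      by (intro borel_measurable_prod measurable_compose[OF measurable_eval_path soft_indicator_measurable]) (use J in auto)
    have F_bounds: "0 \<le> F m x" "F m x \<le> 1" for m x
      unfolding F_def by (auto intro!: prod_nonneg prod_le_1 soft_indicator_bounds)
    have F_lim: "(\<lambda>m. F m x) \<longlonglongrightarrow> indicator {x \<in> path_set. \<forall>t\<in>J. x t \<in> U t} x" if "x \<in> path_set" for x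
    proof -
      have "(\<lambda>m. F m x) \<longlonglongrightarrow> (\<Prod>t\<in>J. indicator (U t) (x t))"
        unfolding F_def by (intro tendsto_prod soft_indicator_tendsto U)
      also have "(\<Prod>t\<in>J. indicator (U t) (x t)) = (indicator {x \<in> path_set. \<forall>t\<in>J. x t \<in> U t} x :: real)"
        using that J by (auto simp: indicator_def prod_zero_iff)
      finally show ?thesis .
    qed
    have one: "(\<integral>\<^sup>+\<omega>. 1 \<partial>M) < \<infinity>" "(\<integral>\<^sup>+\<omega>. 1 \<partial>W) < \<infinity>"
      by (simp_all add: M.emeasure_space_1 W.emeasure_space_1 del: space_W)
    \<comment> \<open>For fixed \<open>m\<close> the functional \<open>F m\<close> is continuous in
      finitely many positions, so \<open>n\<close> can be sent to infinity; the limit in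
      \<open>m\<close> is taken afterwards.\<close>
    have eq: "(\<integral>\<^sup>+\<omega>. indicator Y \<omega> * ennreal (F m (V \<omega>)) \<partial>M) = emeasure M Y * (\<integral>\<^sup>+x. ennreal (F m x) \<partial>W)" for m
    proof (rule LIMSEQ_unique)
      show "(\<lambda>n. (\<integral>\<^sup>+\<omega>. indicator Y \<omega> * ennreal (F m (Vn n \<omega>)) \<partial>M))
          \<longlonglongrightarrow> (\<integral>\<^sup>+\<omega>. indicator Y \<omega> * ennreal (F m (V \<omega>)) \<partial>M)"
      proof (rule nn_integral_dominated_convergence[where w="\<lambda>_. 1"])
        show "AE \<omega> in M. indicator Y \<omega> * ennreal (F m (Vn n \<omega>)) \<le> 1" for n
          using F_bounds by (auto simp: indicator_def)
        show "AE \<omega> in M. (\<lambda>n. indicator Y \<omega> * ennreal (F m (Vn n \<omega>))) \<longlonglongrightarrow> indicator Y \<omega> * ennreal (F m (V \<omega>))"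
        proof (rule AE_I2)
          fix \<omega> assume \<omega>: "\<omega> \<in> space M"
          have "(\<lambda>n. F m (Vn n \<omega>)) \<longlonglongrightarrow> F m (V \<omega>)"
            unfolding F_def
            by (intro tendsto_prod continuous_on_tendsto_compose[OF continuous_soft_indicator] V_lim \<omega>) (use J in auto)
          then show "(\<lambda>n. indicator Y \<omega> * ennreal (F m (Vn n \<omega>))) \<longlonglongrightarrow> indicator Y \<omega> * ennreal (F m (V \<omega>))"
            by (cases "\<omega> \<in> Y") (auto intro: tendsto_ennrealI)
        qed
      qed (use one in measurable)
      show "(\<lambda>n. (\<integral>\<^sup>+\<omega>. indicator Y \<omega> * ennreal (F m (Vn n \<omega>)) \<partial>M))
          \<longlonglongrightarrow> emeasure M Y * (\<integral>\<^sup>+x. ennreal (F m x) \<partial>W)"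
        by (subst int) auto
    qed
    let ?C = "{x \<in> path_set. \<forall>t\<in>J. x t \<in> U t}"
    note C [measurable] = cylinder_sets[OF J U]
    have "(\<integral>\<^sup>+\<omega>. indicator Y \<omega> * indicator ?C (V \<omega>) \<partial>M) = emeasure M Y * (\<integral>\<^sup>+x. indicator ?C x \<partial>W)"
    proof (rule LIMSEQ_unique)
      show "(\<lambda>m. (\<integral>\<^sup>+\<omega>. indicator Y \<omega> * ennreal (F m (V \<omega>)) \<partial>M))
          \<longlonglongrightarrow> (\<integral>\<^sup>+\<omega>. indicator Y \<omega> * indicator ?C (V \<omega>) \<partial>M)"
      proof (rule nn_integral_dominated_convergence[where w="\<lambda>_. 1"])
        show "AE \<omega> in M. indicator Y \<omega> * ennreal (F m (V \<omega>)) \<le> 1" for m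
          using F_bounds by (auto simp: indicator_def)
        show "AE \<omega> in M. (\<lambda>m. indicator Y \<omega> * ennreal (F m (V \<omega>))) \<longlonglongrightarrow> indicator Y \<omega> * indicator ?C (V \<omega>)"
        proof (rule AE_I2)
          fix \<omega> assume \<omega>: "\<omega> \<in> space M"
          then have "V \<omega> \<in> path_set" using measurable_space[OF V \<omega>] by simp
          from tendsto_ennrealI[OF F_lim[OF this]]
          show "(\<lambda>m. indicator Y \<omega> * ennreal (F m (V \<omega>))) \<longlonglongrightarrow> indicator Y \<omega> * indicator ?C (V \<omega>)"
            by (cases "\<omega> \<in> Y") (auto simp: ennreal_indicator)
        qed
      qed (use one in measurable)
      have "(\<lambda>m. (\<integral>\<^sup>+x. ennreal (F m x) \<partial>W)) \<longlonglongrightarrow> (\<integral>\<^sup>+x. indicator ?C x \<partial>W)"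
      proof (rule nn_integral_dominated_convergence[where w="\<lambda>_. 1"])
        show "AE x in W. ennreal (F m x) \<le> 1" for m using F_bounds by auto
        show "AE x in W. (\<lambda>m. ennreal (F m x)) \<longlonglongrightarrow> indicator ?C x"
          using tendsto_ennrealI[OF F_lim] by (intro AE_I2) (simp add: ennreal_indicator)
      qed (use one in measurable)
      then show "(\<lambda>m. (\<integral>\<^sup>+\<omega>. indicator Y \<omega> * ennreal (F m (V \<omega>)) \<partial>M)) \<longlonglongrightarrow> emeasure M Y * (\<integral>\<^sup>+x. indicator ?C x \<partial>W)"
        unfolding eq by (intro ennreal_tendsto_cmult) (auto simp: less_top[symmetric])
    qed
    moreover have "emeasure (distr (density M (indicator Y)) paths V) ?C = (\<integral>\<^sup>+\<omega>. indicator Y \<omega> * indicator ?C (V \<omega>) \<partial>M)"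
      by (subst nn_integral_indicator[symmetric], simp, subst nn_integral_distr, simp_all)
         (subst nn_integral_density, auto)
    ultimately show "emeasure (distr (density M (indicator Y)) paths V) ?C = emeasure (density W (\<lambda>_. emeasure M Y)) ?C"
      by (simp add: emeasure_density nn_integral_cmult)
  qed simp_all
  then have "emeasure (distr (density M (indicator Y)) paths V) C = emeasure (density W (\<lambda>_. emeasure M Y)) C"
    by simp
  moreover have "emeasure (distr (density M (indicator Y)) paths V) C = emeasure M (Y \<inter> (V -` C \<inter> space M))"
  proof -
    have "emeasure (distr (density M (indicator Y)) paths V) C = (\<integral>\<^sup>+\<omega>. indicator Y \<omega> * indicator (V -` C \<inter> space M) \<omega> \<partial>M)"
      using C by (simp add: emeasure_distr emeasure_density)
    also have "\<dots> = (\<integral>\<^sup>+\<omega>. indicator (Y \<inter> (V -` C \<inter> space M)) \<omega> \<partial>M)"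
      by (intro nn_integral_cong) (auto simp: indicator_def)
    finally show ?thesis using C by simp
  qed
  moreover have "Y \<inter> (V -` C \<inter> space M) = {\<omega> \<in> space M. stop_path (exit_time \<rho> (X \<omega>)) (X \<omega>) \<in> A
        \<and> incr_path (exit_time \<rho> (X \<omega>)) (X \<omega>) \<in> C}"
    by (auto simp: Y_def V_def T_def)
  ultimately show ?thesis
    using C by (simp add: emeasure_density nn_integral_cmult) (simp add: Y_def T_def)
qed

lemma strong_markov:
  assumes X: "brownian M \<nu> X"
  shows "distr M (paths \<Otimes>\<^sub>M paths) (\<lambda>\<omega>. (stop_path (exit_time \<rho> (X \<omega>)) (X \<omega>), incr_path (exit_time \<rho> (X \<omega>)) (X \<omega>)))
    = distr M paths (\<lambda>\<omega>. stop_path (exit_time \<rho> (X \<omega>)) (X \<omega>)) \<Otimes>\<^sub>M W"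
proof -
  interpret M: prob_space M using brownianD(1)[OF X] .
  note X_meas [measurable] = brownianD(2)[OF X]
  let ?Y = "\<lambda>\<omega>. stop_path (exit_time \<rho> (X \<omega>)) (X \<omega>)" and ?V = "\<lambda>\<omega>. incr_path (exit_time \<rho> (X \<omega>)) (X \<omega>)"
  have Y [measurable]: "?Y \<in> M \<rightarrow>\<^sub>M paths" by (rule measurable_stop_path[OF X_meas]) (auto simp: exit_time_nonneg)
  have V [measurable]: "?V \<in> M \<rightarrow>\<^sub>M paths" by (rule measurable_incr_path[OF X_meas]) (auto simp: exit_time_nonneg)
  interpret Y: prob_space "distr M paths ?Y" by (rule M.prob_space_distr) measurable
  show ?thesis
  proof (rule pair_measure_eqI[symmetric])
    fix A C assume "A \<in> sets (distr M paths ?Y)" "C \<in> sets W"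
    then have A: "A \<in> sets paths" and C: "C \<in> sets paths" by simp_all
    have "emeasure (distr M (paths \<Otimes>\<^sub>M paths) (\<lambda>\<omega>. (?Y \<omega>, ?V \<omega>))) (A \<times> C)
        = emeasure M {\<omega> \<in> space M. ?Y \<omega> \<in> A \<and> ?V \<omega> \<in> C}"
      using A C by (subst emeasure_distr) (auto intro!: arg_cong[where f="emeasure M"])
    also have "\<dots> = emeasure M {\<omega> \<in> space M. ?Y \<omega> \<in> A} * emeasure W C"
      by (rule strong_markov_rectangle[OF X A C])
    also have "emeasure M {\<omega> \<in> space M. ?Y \<omega> \<in> A} = emeasure (distr M paths ?Y) A"
      using A by (subst emeasure_distr) (auto intro!: arg_cong[where f="emeasure M"])
    finally show "emeasure (distr M paths ?Y) A * emeasure W C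
        = emeasure (distr M (paths \<Otimes>\<^sub>M paths) (\<lambda>\<omega>. (?Y \<omega>, ?V \<omega>))) (A \<times> C)" ..
  qed (auto simp: Y.sigma_finite_measure_axioms W.sigma_finite_measure_axioms intro!: sets_pair_measure_cong)
qed

end

section \<open>Averaging over rotations and the Harnack inequality\<close>

lemma circ_0: "circ 0 = return borel 0"
  unfolding circ_def by (simp add: prob_space.distr_const[OF prob_space_angle])

definition post_path :: "real \<Rightarrow> (real \<Rightarrow> complex) \<Rightarrow> real \<Rightarrow> complex" where
  "post_path \<rho> x = (\<lambda>u. x (exit_time \<rho> x + u))"

lemma measurable_post_path:
  "X \<in> M \<rightarrow>\<^sub>M paths \<Longrightarrow> (\<lambda>\<omega>. post_path \<rho> (X \<omega>)) \<in> M \<rightarrow>\<^sub>M paths"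
  unfolding post_path_def by (rule measurable_shift_path) (auto simp: exit_time_nonneg)

lemma post_path_measurable [measurable]: "post_path \<rho> \<in> paths \<rightarrow>\<^sub>M paths"
  by (rule measurable_post_path) simp

lemma measurable_stop_exit:
  "X \<in> M \<rightarrow>\<^sub>M paths \<Longrightarrow> (\<lambda>\<omega>. stop_path (exit_time \<rho> (X \<omega>)) (X \<omega>)) \<in> M \<rightarrow>\<^sub>M paths"
  by (rule measurable_stop_path) (auto simp: exit_time_nonneg)

lemma measurable_incr_exit:
  "X \<in> M \<rightarrow>\<^sub>M paths \<Longrightarrow> (\<lambda>\<omega>. incr_path (exit_time \<rho> (X \<omega>)) (X \<omega>)) \<in> M \<rightarrow>\<^sub>M paths"
  by (rule measurable_incr_path) (auto simp: exit_time_nonneg)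

lemma measurable_exit_position:
  "X \<in> M \<rightarrow>\<^sub>M paths \<Longrightarrow> (\<lambda>\<omega>. X \<omega> (exit_time \<rho> (X \<omega>))) \<in> borel_measurable M"
  by (rule measurable_eval_random_time) (auto simp: exit_time_nonneg)

lemma hits_shift:
  assumes "0 \<le> a" "\<And>t. 0 \<le> t \<Longrightarrow> t < a \<Longrightarrow> cmod (x t) < \<rho>"
  shows "hits \<rho> (\<lambda>u. x (a + u)) \<longleftrightarrow> hits \<rho> x"
proof
  assume "hits \<rho> x"
  then obtain t where t: "t \<ge> 0" "cmod (x t) \<ge> \<rho>" by (auto simp: hits_def)
  then have "t \<ge> a" using assms(2)[of t] by force
  then show "hits \<rho> (\<lambda>u. x (a + u))" using t by (auto simp: hits_def intro!: exI[of _ "t - a"])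
next
  assume "hits \<rho> (\<lambda>u. x (a + u))"
  then obtain t where "t \<ge> 0" "cmod (x (a + t)) \<ge> \<rho>" by (auto simp: hits_def)
  then show "hits \<rho> x" using assms(1) unfolding hits_def by (intro exI[of _ "a + t"]) auto
qed

lemma exit_time_shift:
  assumes x: "x \<in> path_set" "hits \<rho> x" and a: "0 \<le> a" "\<And>t. 0 \<le> t \<Longrightarrow> t < a \<Longrightarrow> cmod (x t) < \<rho>"
  shows "exit_time \<rho> (\<lambda>u. x (a + u)) = exit_time \<rho> x - a"
proof (rule antisym)
  have ge: "exit_time \<rho> x \<ge> a"
    using a(2)[of "exit_time \<rho> x"] at_exit_time[OF x] exit_time_nonneg[of \<rho> x] by force
  show "exit_time \<rho> (\<lambda>u. x (a + u)) \<le> exit_time \<rho> x - a"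
    using ge at_exit_time[OF x] by (intro exit_time_le) auto
  have y: "(\<lambda>u. x (a + u)) \<in> path_set"
    using x(1) a(1) unfolding path_set_def
    by (auto intro!: continuous_on_compose2[of "{0..}" x] continuous_intros)
  have "hits \<rho> (\<lambda>u. x (a + u))" using hits_shift[of a x \<rho>, OF a] x(2) by simp
  from at_exit_time[OF y this] have "exit_time \<rho> x \<le> a + exit_time \<rho> (\<lambda>u. x (a + u))"
    using a(1) exit_time_nonneg[of \<rho> "\<lambda>u. x (a + u)"] by (intro exit_time_le) auto
  then show "exit_time \<rho> x - a \<le> exit_time \<rho> (\<lambda>u. x (a + u))" by simp
qed

text \<open>An initial piece below modulus \<open>\<rho>\<close> does not change what follows the
  first passage to \<open>\<rho>\<close>. This allows a restart at an intermediate time.\<close>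

lemma post_path_shift:
  assumes "x \<in> path_set" "hits \<rho> x" "0 \<le> a" "\<And>t. 0 \<le> t \<Longrightarrow> t < a \<Longrightarrow> cmod (x t) < \<rho>"
  shows "post_path \<rho> (\<lambda>u. x (a + u)) = post_path \<rho> x"
proof -
  have "a + (exit_time \<rho> x - a + u) = exit_time \<rho> x + u" for u by simp
  then show ?thesis by (simp only: post_path_def exit_time_shift[OF assms])
qed

lemma exit_time_unit_mult: "cmod c = 1 \<Longrightarrow> exit_time \<rho> (\<lambda>t. c * x t) = exit_time \<rho> x"
  by (simp only: exit_time_def hits_def norm_mult mult_1)

section \<open>Lebesgue measure on discs\<close>

definition disc_measure :: "real \<Rightarrow> complex measure" where
  "disc_measure r = density lborel (indicator (ball 0 r))"

lemma indicator_ball_measurable [measurable]: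
  "(indicator (ball (z::complex) r) :: complex \<Rightarrow> ennreal) \<in> borel_measurable borel"
  by (intro borel_measurable_indicator) simp

lemma sets_disc_measure [simp, measurable_cong]: "sets (disc_measure r) = sets borel"
  and space_disc_measure [simp]: "space (disc_measure r) = UNIV"
  by (auto simp: disc_measure_def)

lemma nn_integral_disc_measure:
  "f \<in> borel_measurable borel \<Longrightarrow> (\<integral>\<^sup>+z. f z \<partial>disc_measure r) = (\<integral>\<^sup>+z. indicator (ball 0 r) z * f z \<partial>lborel)"
  unfolding disc_measure_def by (subst nn_integral_density) auto

lemma emeasure_disc_measure: "emeasure (disc_measure r) UNIV = emeasure lborel (ball (0::complex) r)"
  unfolding disc_measure_def by (subst emeasure_density) auto

lemma finite_disc_measure: "finite_measure (disc_measure r)"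
  by (rule finite_measureI)
     (metis emeasure_disc_measure emeasure_lborel_ball_finite infinity_ennreal_def less_irrefl space_disc_measure)

lemma disc_measure_rotation:
  assumes c: "cmod c = 1"
  shows "distr (disc_measure r) borel ((*) c) = disc_measure r"
proof (rule measure_eqI)
  fix A assume "A \<in> sets (distr (disc_measure r) borel ((*) c))"
  then have A [measurable]: "A \<in> sets borel" by simp
  have c0: "c \<noteq> 0" using c by auto
  have "emeasure (disc_measure r) A = (\<integral>\<^sup>+z. indicator (ball 0 r) z * indicator A z \<partial>lborel)"
    by (simp add: disc_measure_def emeasure_density)
  also have "\<dots> = (\<integral>\<^sup>+z. indicator (ball 0 r) (c * z) * indicator A (c * z) \<partial>lborel)"
    by (subst nn_integral_lborel_complex_mult[OF c0]) (auto simp: c)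
  also have "\<dots> = (\<integral>\<^sup>+z. indicator A (c * z) \<partial>disc_measure r)"
    by (subst nn_integral_disc_measure) (auto intro!: nn_integral_cong simp: indicator_def norm_mult c)
  also have "\<dots> = emeasure (distr (disc_measure r) borel ((*) c)) A"
  proof -
    have "(\<integral>\<^sup>+z. indicator A z \<partial>distr (disc_measure r) borel ((*) c)) = (\<integral>\<^sup>+z. indicator A (c * z) \<partial>disc_measure r)"
    proof (rule nn_integral_distr)
      have "(\<lambda>z. z) \<in> borel_measurable (disc_measure r)" by (simp add: measurable_ident_sets)
      from borel_measurable_times[OF borel_measurable_const this]
      show "(*) c \<in> borel_measurable (disc_measure r)" .
    qed simp
    then show ?thesis by simp
  qed
  finally show "emeasure (distr (disc_measure r) borel ((*) c)) A = emeasure (disc_measure r) A" ..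
qed simp

text \<open>This ratio of areas is the constant 4 of the Harnack inequality below.\<close>

lemma emeasure_disc_measure_double:
  "emeasure (disc_measure (2 * r)) UNIV = 4 * emeasure (disc_measure r) UNIV"
proof -
  have "emeasure lborel (ball (0::complex) (2 * r)) = (\<integral>\<^sup>+z. indicator (ball (0::complex) (2 * r)) z \<partial>lborel)"
    by simp
  also have "\<dots> = ennreal ((cmod 2)\<^sup>2) * (\<integral>\<^sup>+z. indicator (ball (0::complex) (2 * r)) (2 * z) \<partial>lborel)"
    by (rule nn_integral_lborel_complex_mult) auto
  also have "(\<lambda>z. indicator (ball (0::complex) (2 * r)) (2 * z) :: ennreal) = indicator (ball 0 r)"
    by (auto simp: indicator_def norm_mult fun_eq_iff)
  finally show ?thesis by (simp add: emeasure_disc_measure)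
qed

lemma emeasure_disc_measure_pos: "r > 0 \<Longrightarrow> emeasure (disc_measure r) UNIV \<noteq> 0"
  using open_not_negligible[of "ball (0::complex) r"]
  by (auto simp: emeasure_disc_measure negligible_iff_null_sets null_sets_def)

context wiener
begin

section \<open>Uniform starts on circles, exit laws and harmonic functions\<close>

lemma measurable_borel_W: "borel \<Otimes>\<^sub>M W \<rightarrow>\<^sub>M N = borel \<Otimes>\<^sub>M paths \<rightarrow>\<^sub>M N"
  by (intro measurable_cong_sets sets_pair_measure_cong) simp_all

definition Px :: "real \<Rightarrow> (real \<Rightarrow> complex) measure" where
  "Px r = start_law (circ r) W"

lemma sets_Px [simp, measurable_cong]: "sets (Px r) = sets paths"
  and space_Px [simp]: "space (Px r) = path_set"
  by (simp_all add: Px_def start_law_def)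

lemma brownian_circ_law: "brownian M (circ r) X \<Longrightarrow> distr M paths X = Px r"
  unfolding Px_def by (rule brownian_law[OF _ brownian_W sets_W])

definition scale_path :: "real \<Rightarrow> (real \<Rightarrow> complex) \<Rightarrow> real \<Rightarrow> complex" where
  "scale_path c x = (\<lambda>t. of_real c * x (t / c\<^sup>2))"

lemma brownian_scale:
  assumes "brownian M (circ r) X" "c > 0"
  shows "brownian M (circ (c * r)) (\<lambda>\<omega>. scale_path c (X \<omega>))"
  using brownian_mult[OF assms(1), of "of_real c"] assms(2)
  by (simp add: scale_path_def distr_circ_mult)

lemma brownian_Px: "r \<ge> 0 \<Longrightarrow> brownian (Px r) (circ r) (\<lambda>x. x)"
proof (cases "r = 0")
  case True
  have "brownian W (circ 0) (\<lambda>x. x)" using brownian_W by (simp add: circ_0)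
  from brownian_distr[OF this] show ?thesis
    using brownian_circ_law[OF \<open>brownian W (circ 0) (\<lambda>x. x)\<close>] True by simp
next
  case False
  assume "r \<ge> 0"
  with False have "brownian (start_law (circ 1) W) (circ r) (\<lambda>\<omega>. scale_path r \<omega>)"
    using brownian_scale[OF brownian_circ_1, of r] by simp
  from brownian_distr[OF this] brownian_circ_law[OF this] show ?thesis by simp
qed

lemma Px_0: "Px 0 = W"
proof -
  have "brownian W (circ 0) (\<lambda>x. x)" using brownian_W by (simp add: circ_0)
  from brownian_circ_law[OF this] show ?thesis by (simp add: distr_id2)
qed

lemma prob_space_Px: "r \<ge> 0 \<Longrightarrow> prob_space (Px r)"
  using brownianD(1)[OF brownian_Px] .

lemma distr_Px_scale: "r \<ge> 0 \<Longrightarrow> c > 0 \<Longrightarrow> distr (Px r) paths (scale_path c) = Px (c * r)"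
  by (rule brownian_circ_law[OF brownian_scale[OF brownian_Px]])

text \<open>Rotating the motion changes neither its law nor its exit time, so the exit point has a
  rotation invariant law; the start inside the disc places it on the circle.\<close>

lemma exit_position_law:
  assumes X: "brownian M (circ s) X" and s: "0 \<le> s" "s \<le> \<rho>"
  shows "distr M borel (\<lambda>\<omega>. X \<omega> (exit_time \<rho> (X \<omega>))) = circ \<rho>"
proof (rule rotation_invariant_eq_circ)
  interpret M: prob_space M using brownianD(1)[OF X] .
  note X_meas [measurable] = brownianD(2)[OF X]
  have \<phi> [measurable]: "(\<lambda>x. x (exit_time \<rho> x)) \<in> borel_measurable paths"
    by (rule measurable_exit_position) simp
  have Z [measurable]: "(\<lambda>\<omega>. X \<omega> (exit_time \<rho> (X \<omega>))) \<in> borel_measurable M"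
    by (rule measurable_exit_position[OF X_meas])
  show "prob_space (distr M borel (\<lambda>\<omega>. X \<omega> (exit_time \<rho> (X \<omega>))))"
    by (rule M.prob_space_distr) measurable
  show "distr (distr M borel (\<lambda>\<omega>. X \<omega> (exit_time \<rho> (X \<omega>)))) borel ((*) c) = distr M borel (\<lambda>\<omega>. X \<omega> (exit_time \<rho> (X \<omega>)))"
    if c: "cmod c = 1" for c
  proof -
    have c0: "c \<noteq> 0" using c by auto
    have X': "brownian M (circ s) (\<lambda>\<omega> t. c * X \<omega> t)"
      using brownian_mult[OF X c0] c by (simp add: distr_circ_rotation)
    note [measurable] = brownianD(2)[OF X']
    have "distr (distr M borel (\<lambda>\<omega>. X \<omega> (exit_time \<rho> (X \<omega>)))) borel ((*) c)
        = distr (distr M paths (\<lambda>\<omega> t. c * X \<omega> t)) borel (\<lambda>x. x (exit_time \<rho> x))"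
      by (subst (1 2) distr_distr) (auto simp: comp_def exit_time_unit_mult[OF c])
    also have "\<dots> = distr (distr M paths X) borel (\<lambda>x. x (exit_time \<rho> x))"
      by (simp add: brownian_law_unique[OF X' X])
    also have "\<dots> = distr M borel (\<lambda>\<omega>. X \<omega> (exit_time \<rho> (X \<omega>)))"
      by (subst distr_distr) (auto simp: comp_def)
    finally show ?thesis .
  qed
  have X0 [measurable]: "(\<lambda>\<omega>. X \<omega> 0) \<in> borel_measurable M" by (rule measurable_path_at[OF X_meas]) simp
  have "AE z in distr M borel (\<lambda>\<omega>. X \<omega> 0). cmod z = s"
    unfolding brownianD(3)[OF X] by (rule AE_circ[OF s(1)])
  then have "AE \<omega> in M. cmod (X \<omega> 0) = s" by (subst (asm) AE_distr_iff) auto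
  moreover have "AE \<omega> in M. hits \<rho> (X \<omega>)" by (rule AE_hits[OF X])
  ultimately have "AE \<omega> in M. cmod (X \<omega> (exit_time \<rho> (X \<omega>))) = \<rho>"
    using AE_space
  proof eventually_elim
    case (elim \<omega>)
    then show ?case using norm_at_exit_time[of "X \<omega>" \<rho>] s measurable_space[OF X_meas, of \<omega>] by simp
  qed
  then show "AE z in distr M borel (\<lambda>\<omega>. X \<omega> (exit_time \<rho> (X \<omega>))). cmod z = \<rho>"
    by (subst AE_distr_iff) auto
qed simp

lemma exit_position_stop:
  assumes "x \<in> path_set" "hits \<rho> x"
  shows "stop_path (exit_time \<rho> x) x (exit_time \<rho> (stop_path (exit_time \<rho> x) x)) = x (exit_time \<rho> x)"
  using exit_time_stop[OF assms, of "exit_time \<rho> x"] by (simp add: stop_path_def)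

lemma nn_integral_strong_markov:
  assumes X: "brownian M \<nu> X" and F [measurable]: "F \<in> borel_measurable (paths \<Otimes>\<^sub>M paths)"
  shows "(\<integral>\<^sup>+\<omega>. F (stop_path (exit_time \<rho> (X \<omega>)) (X \<omega>), incr_path (exit_time \<rho> (X \<omega>)) (X \<omega>)) \<partial>M)
    = (\<integral>\<^sup>+\<omega>. (\<integral>\<^sup>+v. F (stop_path (exit_time \<rho> (X \<omega>)) (X \<omega>), v) \<partial>W) \<partial>M)"
proof -
  note X_meas [measurable] = brownianD(2)[OF X]
  note [measurable] = measurable_stop_exit[OF X_meas, of \<rho>] measurable_incr_exit[OF X_meas, of \<rho>]
  let ?Y = "\<lambda>\<omega>. stop_path (exit_time \<rho> (X \<omega>)) (X \<omega>)"
  have "(\<integral>\<^sup>+\<omega>. F (stop_path (exit_time \<rho> (X \<omega>)) (X \<omega>), incr_path (exit_time \<rho> (X \<omega>)) (X \<omega>)) \<partial>M)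
      = (\<integral>\<^sup>+p. F p \<partial>distr M (paths \<Otimes>\<^sub>M paths) (\<lambda>\<omega>. (?Y \<omega>, incr_path (exit_time \<rho> (X \<omega>)) (X \<omega>))))"
    by (subst nn_integral_distr) auto
  also have "\<dots> = (\<integral>\<^sup>+p. F p \<partial>(distr M paths ?Y \<Otimes>\<^sub>M W))"
    unfolding strong_markov[OF X] ..
  also have "\<dots> = (\<integral>\<^sup>+y. (\<integral>\<^sup>+v. F (y, v) \<partial>W) \<partial>distr M paths ?Y)"
    by (rule W.nn_integral_fst[symmetric]) measurable
  also have "\<dots> = (\<integral>\<^sup>+\<omega>. (\<integral>\<^sup>+v. F (?Y \<omega>, v) \<partial>W) \<partial>M)"
    by (subst nn_integral_distr) auto
  finally show ?thesis .
qed

lemma nn_integral_Px: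
  assumes [measurable]: "F \<in> borel_measurable paths"
  shows "(\<integral>\<^sup>+x. F x \<partial>Px r) = (\<integral>\<^sup>+z. (\<integral>\<^sup>+v. F (\<lambda>u. z + v u) \<partial>W) \<partial>circ r)"
proof -
  have [measurable]: "(\<lambda>(z, v) u. z + v u) \<in> borel \<Otimes>\<^sub>M paths \<rightarrow>\<^sub>M paths"
    unfolding split_beta' by (rule measurable_translate_path) measurable
  have "(\<integral>\<^sup>+x. F x \<partial>Px r) = (\<integral>\<^sup>+p. F (case p of (z, v) \<Rightarrow> \<lambda>u. z + v u) \<partial>(circ r \<Otimes>\<^sub>M W))"
    unfolding Px_def start_law_def by (subst nn_integral_distr) auto
  also have "\<dots> = (\<integral>\<^sup>+z. (\<integral>\<^sup>+v. F (\<lambda>u. z + v u) \<partial>W) \<partial>circ r)"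
    by (subst W.nn_integral_fst[symmetric]) auto
  finally show ?thesis .
qed

text \<open>The path after the exit is the exit point plus an independent path of law
  \<open>W\<close>. As the exit point is uniform whatever the starting radius, the result does not
  depend on \<open>s\<close>.\<close>

lemma post_path_law:
  assumes X: "brownian M (circ s) X" and s: "0 \<le> s" "s \<le> \<rho>"
  shows "distr M paths (\<lambda>\<omega>. post_path \<rho> (X \<omega>)) = Px \<rho>"
proof (rule measure_eqI)
  interpret M: prob_space M using brownianD(1)[OF X] .
  note X_meas [measurable] = brownianD(2)[OF X]
  note [measurable] = measurable_post_path[OF X_meas, of \<rho>] measurable_exit_position[OF X_meas, of \<rho>]
  fix C assume "C \<in> sets (distr M paths (\<lambda>\<omega>. post_path \<rho> (X \<omega>)))"
  then have C [measurable]: "C \<in> sets paths" by simp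
  \<comment> \<open>The strong Markov property hands over only the stopped path and the increments,
    so the exit point is recomputed from the stopped path; \<open>exit_position_stop\<close> shows
    that it is the same point.\<close>
  let ?F = "\<lambda>p. indicator C (\<lambda>u. fst p (exit_time \<rho> (fst p)) + snd p u) :: ennreal"
  have tm: "(\<lambda>p u. fst p (exit_time \<rho> (fst p)) + snd p u) \<in> paths \<Otimes>\<^sub>M paths \<rightarrow>\<^sub>M paths"
    by (intro measurable_translate_path measurable_exit_position) auto
  have tm2: "(\<lambda>p u. fst p + snd p u) \<in> borel \<Otimes>\<^sub>M paths \<rightarrow>\<^sub>M paths"
    by (rule measurable_translate_path) measurable
  have F [measurable]: "?F \<in> borel_measurable (paths \<Otimes>\<^sub>M paths)"
    using measurable_compose[OF tm borel_measurable_indicator[OF C]] .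
  have AEx: "AE \<omega> in M. hits \<rho> (X \<omega>) \<and> X \<omega> \<in> path_set"
    using AE_hits[OF X, of \<rho>] AE_space by eventually_elim (use measurable_space[OF X_meas] in auto)
  have G [measurable]: "(\<lambda>z. \<integral>\<^sup>+v. indicator C (\<lambda>u. z + v u) \<partial>W) \<in> borel_measurable borel"
    using measurable_compose[OF tm2 borel_measurable_indicator[OF C]]
    by (intro W.borel_measurable_nn_integral) (auto simp: split_beta' measurable_borel_W)
  have "emeasure (distr M paths (\<lambda>\<omega>. post_path \<rho> (X \<omega>))) C = (\<integral>\<^sup>+\<omega>. indicator C (post_path \<rho> (X \<omega>)) \<partial>M)"
    by (subst nn_integral_indicator[symmetric], simp) (subst nn_integral_distr, auto)
  also have "\<dots> = (\<integral>\<^sup>+\<omega>. ?F (stop_path (exit_time \<rho> (X \<omega>)) (X \<omega>), incr_path (exit_time \<rho> (X \<omega>)) (X \<omega>)) \<partial>M)"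
  proof (rule nn_integral_cong_AE)
    show "AE \<omega> in M. indicator C (post_path \<rho> (X \<omega>)) = ?F (stop_path (exit_time \<rho> (X \<omega>)) (X \<omega>), incr_path (exit_time \<rho> (X \<omega>)) (X \<omega>))"
      using AEx by eventually_elim (simp add: exit_position_stop post_path_def incr_path_def)
  qed
  also have "\<dots> = (\<integral>\<^sup>+\<omega>. (\<integral>\<^sup>+v. ?F (stop_path (exit_time \<rho> (X \<omega>)) (X \<omega>), v) \<partial>W) \<partial>M)"
    by (rule nn_integral_strong_markov[OF X F])
  also have "\<dots> = (\<integral>\<^sup>+\<omega>. (\<integral>\<^sup>+v. indicator C (\<lambda>u. X \<omega> (exit_time \<rho> (X \<omega>)) + v u) \<partial>W) \<partial>M)"
  proof (rule nn_integral_cong_AE)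
    show "AE \<omega> in M. (\<integral>\<^sup>+v. ?F (stop_path (exit_time \<rho> (X \<omega>)) (X \<omega>), v) \<partial>W)
        = (\<integral>\<^sup>+v. indicator C (\<lambda>u. X \<omega> (exit_time \<rho> (X \<omega>)) + v u) \<partial>W)"
      using AEx by eventually_elim (simp add: exit_position_stop)
  qed
  also have "\<dots> = (\<integral>\<^sup>+z. (\<integral>\<^sup>+v. indicator C (\<lambda>u. z + v u) \<partial>W) \<partial>distr M borel (\<lambda>\<omega>. X \<omega> (exit_time \<rho> (X \<omega>))))"
    by (subst nn_integral_distr) auto
  also have "\<dots> = emeasure (Px \<rho>) C"
    unfolding exit_position_law[OF X s] by (subst nn_integral_Px[symmetric]) auto
  finally show "emeasure (distr M paths (\<lambda>\<omega>. post_path \<rho> (X \<omega>))) C = emeasure (Px \<rho>) C" .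
qed simp

text \<open>As a function of \<open>z\<close> in the disc of radius \<open>\<rho>\<close> this is a
  harmonic function, accessible here through its mean values.\<close>

definition post_prob :: "real \<Rightarrow> (real \<Rightarrow> complex) set \<Rightarrow> complex \<Rightarrow> ennreal" where
  "post_prob \<rho> C z = (\<integral>\<^sup>+v. indicator C (post_path \<rho> (\<lambda>u. z + v u)) \<partial>W)"

lemma post_prob_measurable [measurable]:
  assumes C: "C \<in> sets paths"
  shows "post_prob \<rho> C \<in> borel_measurable borel"
proof -
  have "(\<lambda>p u. fst p + snd p u) \<in> borel \<Otimes>\<^sub>M paths \<rightarrow>\<^sub>M paths"
    by (rule measurable_translate_path) measurable
  from measurable_compose[OF measurable_post_path[OF this] borel_measurable_indicator[OF C]]
  show ?thesis
    unfolding post_prob_def[abs_def]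
    by (intro W.borel_measurable_nn_integral) (auto simp: split_beta' measurable_borel_W)
qed

lemma post_prob_circ_average:
  assumes C [measurable]: "C \<in> sets paths" and s: "0 \<le> s" "s \<le> \<rho>"
  shows "(\<integral>\<^sup>+z. post_prob \<rho> C z \<partial>circ s) = emeasure (Px \<rho>) C"
proof -
  have "(\<integral>\<^sup>+z. post_prob \<rho> C z \<partial>circ s) = (\<integral>\<^sup>+x. indicator C (post_path \<rho> x) \<partial>Px s)"
    unfolding post_prob_def by (subst nn_integral_Px) auto
  also have "\<dots> = emeasure (distr (Px s) paths (post_path \<rho>)) C"
    by (subst nn_integral_indicator[of C "distr (Px s) paths (post_path \<rho>)", symmetric], simp)
       (subst nn_integral_distr, auto)
  also have "\<dots> = emeasure (Px \<rho>) C"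
    unfolding post_path_law[OF brownian_Px[OF s(1)] s] ..
  finally show ?thesis .
qed

lemma AE_hits_translate: "AE v in W. hits \<rho> (\<lambda>u. z + v u)"
  using AE_hits[OF brownian_W, of "\<rho> + cmod z"]
proof eventually_elim
  case (elim v)
  then obtain t where t: "t \<ge> 0" "cmod (v t) \<ge> \<rho> + cmod z" by (auto simp: hits_def)
  then have "cmod (z + v t) \<ge> \<rho>" using norm_triangle_ineq4[of "z + v t" z] by simp
  then show ?case using t unfolding hits_def by blast
qed

lemma path_set_translate: "v \<in> path_set \<Longrightarrow> (\<lambda>u. z + v u) \<in> path_set"
  by (auto simp: path_set_def intro!: continuous_intros)

text \<open>The exit point of a disc centred at the starting point is uniform on its boundary.\<close>

lemma post_prob_mean_value:
  assumes C [measurable]: "C \<in> sets paths" and r: "0 \<le> r" "cmod z + r \<le> \<rho>"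
  shows "post_prob \<rho> C z = (\<integral>\<^sup>+w. post_prob \<rho> C (z + w) \<partial>circ r)"
proof -
  have tr [measurable]: "(\<lambda>x u. z + x u) \<in> paths \<rightarrow>\<^sub>M paths" by (rule measurable_translate_path) auto
  have B: "brownian W (circ 0) (\<lambda>x. x)" using brownian_W by (simp add: circ_0)
  have "post_prob \<rho> C z = (\<integral>\<^sup>+v. indicator C (post_path \<rho> (\<lambda>u. z + post_path r v u)) \<partial>W)"
    unfolding post_prob_def
  proof (rule nn_integral_cong_AE)
    show "AE v in W. indicator C (post_path \<rho> (\<lambda>u. z + v u)) = (indicator C (post_path \<rho> (\<lambda>u. z + post_path r v u)) :: ennreal)"
      using AE_hits_translate[of \<rho> z] AE_space
    proof eventually_elim
      case (elim v)
      have "cmod (z + v t) < \<rho>" if "0 \<le> t" "t < exit_time r v" for t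
        using before_exit_time[OF that] norm_triangle_ineq[of z "v t"] r(2) by linarith
      from post_path_shift[of "\<lambda>u. z + v u" \<rho> "exit_time r v", OF path_set_translate elim(1) exit_time_nonneg this]
      show ?case using elim(2) by (simp add: post_path_def[of r])
    qed
  qed
  also have "\<dots> = (\<integral>\<^sup>+x. indicator C (post_path \<rho> (\<lambda>u. z + x u)) \<partial>distr W paths (post_path r))"
    by (subst nn_integral_distr) auto
  also have "distr W paths (post_path r) = Px r"
    by (rule post_path_law[OF B]) (use r in auto)
  also have "(\<integral>\<^sup>+x. indicator C (post_path \<rho> (\<lambda>u. z + x u)) \<partial>Px r) = (\<integral>\<^sup>+w. post_prob \<rho> C (z + w) \<partial>circ r)"
    unfolding post_prob_def by (subst nn_integral_Px) (auto simp: add.assoc)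
  finally show ?thesis .
qed

text \<open>The mean value property on the disc of radius \<open>R\<close> about \<open>z\<close>
  expresses the left-hand side. By non-negativity the integral over that disc is at most the one
  over the disc of radius \<open>2 * R\<close> about 0, which contains it. The mean over the larger
  disc is the probability on the right, and the areas have ratio 4.\<close>

lemma post_prob_Harnack:
  assumes C [measurable]: "C \<in> sets paths" and R: "R > 0" and z: "cmod z = R"
  shows "post_prob (2 * R) C z \<le> 4 * emeasure (Px (2 * R)) C"
proof -
  let ?g = "post_prob (2 * R) C" and ?v = "emeasure (disc_measure R) UNIV"
  have sf: "sigma_finite_measure (disc_measure r)" for r
    using finite_disc_measure[of r] finite_measure.sigma_finite_measure by blast
  have trans: "(\<integral>\<^sup>+x. f x \<partial>lborel) = (\<integral>\<^sup>+x. f (a + x) \<partial>lborel)"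
    if [measurable]: "f \<in> borel_measurable borel" for f :: "complex \<Rightarrow> ennreal" and a
    by (subst lborel_distr_plus[of a, symmetric]) (simp add: nn_integral_distr)
  have "?v * ?g z = (\<integral>\<^sup>+u. ?g z \<partial>disc_measure R)" by (simp add: mult.commute)
  also have "\<dots> = (\<integral>\<^sup>+u. (\<integral>\<^sup>+w. ?g (z + w) \<partial>circ (cmod u)) \<partial>disc_measure R)"
  proof (rule nn_integral_cong_AE)
    have "AE u in disc_measure R. u \<in> ball 0 R"
      unfolding disc_measure_def by (subst AE_density) (auto simp: indicator_def)
    then show "AE u in disc_measure R. ?g z = (\<integral>\<^sup>+w. ?g (z + w) \<partial>circ (cmod u))"
      by eventually_elim (use z in \<open>auto intro!: post_prob_mean_value[OF C]\<close>)
  qed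
  also have "\<dots> = (\<integral>\<^sup>+u. ?g (z + u) \<partial>disc_measure R)"
    by (rule nn_integral_rotation_average[symmetric]) (auto simp: sf disc_measure_rotation)
  also have "\<dots> = (\<integral>\<^sup>+u. indicator (ball 0 R) u * ?g (z + u) \<partial>lborel)"
    by (rule nn_integral_disc_measure) measurable
  also have "\<dots> \<le> (\<integral>\<^sup>+u. indicator (ball 0 (2 * R)) (z + u) * ?g (z + u) \<partial>lborel)"
  proof (intro nn_integral_mono mult_right_mono)
    fix u :: complex
    show "indicator (ball 0 R) u \<le> (indicator (ball 0 (2 * R)) (z + u) :: ennreal)"
      using norm_triangle_ineq[of z u] z by (auto simp: indicator_def)
  qed simp
  also have "\<dots> = (\<integral>\<^sup>+u. indicator (ball 0 (2 * R)) u * ?g u \<partial>lborel)"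
    by (rule trans[symmetric]) measurable
  also have "\<dots> = (\<integral>\<^sup>+u. ?g u \<partial>disc_measure (2 * R))"
    by (rule nn_integral_disc_measure[symmetric]) measurable
  also have "\<dots> = (\<integral>\<^sup>+u. (\<integral>\<^sup>+w. ?g w \<partial>circ (cmod u)) \<partial>disc_measure (2 * R))"
    by (rule nn_integral_rotation_average) (auto simp: sf disc_measure_rotation)
  also have "\<dots> = (\<integral>\<^sup>+u. emeasure (Px (2 * R)) C \<partial>disc_measure (2 * R))"
  proof (rule nn_integral_cong_AE)
    have "AE u in disc_measure (2 * R). u \<in> ball 0 (2 * R)"
      unfolding disc_measure_def by (subst AE_density) (auto simp: indicator_def)
    then show "AE u in disc_measure (2 * R). (\<integral>\<^sup>+w. ?g w \<partial>circ (cmod u)) = emeasure (Px (2 * R)) C"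
      by eventually_elim (auto intro!: post_prob_circ_average[OF C])
  qed
  also have "\<dots> = ?v * (4 * emeasure (Px (2 * R)) C)"
    unfolding nn_integral_const space_disc_measure emeasure_disc_measure_double by (simp only: mult_ac)
  finally have "?v * ?g z \<le> ?v * (4 * emeasure (Px (2 * R)) C)" .
  moreover have "?v \<noteq> 0" "?v \<noteq> \<infinity>"
    using emeasure_disc_measure_pos[OF R] finite_measure.emeasure_finite[OF finite_disc_measure, of R UNIV] by auto
  ultimately show ?thesis
    by (subst (asm) ennreal_mult_le_mult_iff) auto
qed

text \<open>The exit point at radius \<open>R\<close> is the only link between the past and what
  follows radius \<open>2 * R\<close>. The Harnack inequality removes the dependence on that point;
  the annulus between the two radii is the room it requires.\<close>

lemma past_post_domination:
  assumes A [measurable]: "A \<in> sets paths" and C [measurable]: "C \<in> sets paths" and R: "R \<ge> 1"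
  shows "emeasure (Px 1) {x \<in> path_set. stop_path (exit_time R x) x \<in> A \<and> post_path (2 * R) x \<in> C}
    \<le> 4 * emeasure (Px 1) {x \<in> path_set. stop_path (exit_time R x) x \<in> A} * emeasure (Px (2 * R)) C"
proof -
  note X = brownian_Px[of 1, simplified]
  interpret P: prob_space "Px 1" by (rule prob_space_Px) simp
  let ?Y = "\<lambda>x. stop_path (exit_time R x) x" and ?f = "\<lambda>y. y (exit_time R y)"
  have Y [measurable]: "?Y \<in> paths \<rightarrow>\<^sub>M paths" by (rule measurable_stop_exit) simp
  have f [measurable]: "?f \<in> borel_measurable paths" by (rule measurable_exit_position) simp
  let ?F = "\<lambda>p. indicator A (fst p) * indicator C (post_path (2 * R) (\<lambda>u. ?f (fst p) + snd p u)) :: ennreal"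
  have tm: "(\<lambda>p u. ?f (fst p) + snd p u) \<in> paths \<Otimes>\<^sub>M paths \<rightarrow>\<^sub>M paths"
    by (intro measurable_translate_path) auto
  have [measurable]: "(\<lambda>p. post_path (2 * R) (\<lambda>u. ?f (fst p) + snd p u)) \<in> paths \<Otimes>\<^sub>M paths \<rightarrow>\<^sub>M paths"
    by (rule measurable_post_path[OF tm])
  have F [measurable]: "?F \<in> borel_measurable (paths \<Otimes>\<^sub>M paths)" by measurable
  have law: "distr (Px 1) borel ?f = circ R"
    using exit_position_law[OF X, of R] R by simp
  have "AE z in distr (Px 1) borel ?f. cmod z = R"
    unfolding law using R by (intro AE_circ) simp
  then have norm: "AE x in Px 1. cmod (?f x) = R" by (subst (asm) AE_distr_iff) auto
  have good: "AE x in Px 1. hits R x \<and> hits (2 * R) x \<and> x \<in> path_set"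
    using AE_hits[OF X, of R] AE_hits[OF X, of "2 * R"] AE_space by eventually_elim auto
  have "emeasure (Px 1) {x \<in> path_set. ?Y x \<in> A \<and> post_path (2 * R) x \<in> C}
      = (\<integral>\<^sup>+x. indicator {x \<in> path_set. ?Y x \<in> A \<and> post_path (2 * R) x \<in> C} x \<partial>Px 1)"
  proof (rule nn_integral_indicator[symmetric])
    have "{x \<in> space paths. ?Y x \<in> A \<and> post_path (2 * R) x \<in> C} \<in> sets paths" by measurable
    then show "{x \<in> path_set. ?Y x \<in> A \<and> post_path (2 * R) x \<in> C} \<in> sets (Px 1)" by simp
  qed
  also have "\<dots> = (\<integral>\<^sup>+x. ?F (?Y x, incr_path (exit_time R x) x) \<partial>Px 1)"
  proof (rule nn_integral_cong_AE)
    show "AE x in Px 1. indicator {x \<in> path_set. ?Y x \<in> A \<and> post_path (2 * R) x \<in> C} x = ?F (?Y x, incr_path (exit_time R x) x)"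
      using good
    proof eventually_elim
      case (elim x)
      have "cmod (x t) < 2 * R" if "0 \<le> t" "t < exit_time R x" for t
        using before_exit_time[OF that] R by simp
      from post_path_shift[of x "2 * R" "exit_time R x", OF _ _ exit_time_nonneg this] elim
      have "post_path (2 * R) (\<lambda>u. x (exit_time R x + u)) = post_path (2 * R) x" by simp
      then show ?case using elim exit_position_stop[of x R]
        by (simp add: incr_path_def indicator_def)
    qed
  qed
  also have "\<dots> = (\<integral>\<^sup>+x. (\<integral>\<^sup>+v. ?F (?Y x, v) \<partial>W) \<partial>Px 1)"
    by (rule nn_integral_strong_markov[OF X F])
  also have "\<dots> \<le> (\<integral>\<^sup>+x. indicator {x \<in> path_set. ?Y x \<in> A} x * (4 * emeasure (Px (2 * R)) C) \<partial>Px 1)"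
  proof (rule nn_integral_mono_AE)
    show "AE x in Px 1. (\<integral>\<^sup>+v. ?F (?Y x, v) \<partial>W) \<le> indicator {x \<in> path_set. ?Y x \<in> A} x * (4 * emeasure (Px (2 * R)) C)"
      using good norm
    proof eventually_elim
      case (elim x)
      have "(\<integral>\<^sup>+v. ?F (?Y x, v) \<partial>W) = indicator A (?Y x) * post_prob (2 * R) C (?f x)"
        using elim exit_position_stop[of x R]
        by (cases "?Y x \<in> A") (auto simp: post_prob_def)
      also have "\<dots> \<le> indicator A (?Y x) * (4 * emeasure (Px (2 * R)) C)"
        using R elim by (intro mult_left_mono post_prob_Harnack C) auto
      finally show ?case using elim by (auto simp: indicator_def)
    qed
  qed
  also have "\<dots> = emeasure (Px 1) {x \<in> path_set. ?Y x \<in> A} * (4 * emeasure (Px (2 * R)) C)"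
  proof -
    have "{x \<in> space paths. ?Y x \<in> A} \<in> sets paths" by measurable
    then have "{x \<in> path_set. ?Y x \<in> A} \<in> sets (Px 1)" by simp
    then show ?thesis by (subst nn_integral_multc) auto
  qed
  finally show ?thesis by (simp add: mult_ac)
qed

end

section \<open>Submultiplicativity of the non-intersection probability\<close>

definition nonint :: "complex set \<Rightarrow> real \<Rightarrow> (real \<Rightarrow> complex) \<Rightarrow> (real \<Rightarrow> complex) \<Rightarrow> bool" where
  "nonint A R x y \<longleftrightarrow> (\<forall>s\<in>{0..exit_time R x}. \<forall>t\<in>{0..exit_time R y}. \<forall>d\<in>A. x s \<noteq> d * y t)"

lemma unit_interval_mult_image:
  fixes T :: real
  shows "T \<ge> 0 \<Longrightarrow> {0..T} = (\<lambda>u. u * T) ` {0..1}"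
proof (intro set_eqI iffI)
  fix s assume T: "T \<ge> 0" and s: "s \<in> {0..T}"
  then show "s \<in> (\<lambda>u. u * T) ` {0..1}"
    by (cases "T = 0") (auto intro!: image_eqI[of _ _ "s / T"] simp: divide_simps)
qed (auto simp: mult_left_le_one_le)

text \<open>Rescaling the random time intervals to \<open>{0..1}\<close> makes the domain
  deterministic and compact, as the countable reformulation of existence demands.\<close>

lemma nonint_iff_unit_square:
  "nonint A R x y \<longleftrightarrow> (\<forall>d\<in>A. \<not> (\<exists>q\<in>{0..1} \<times> {0..1}.
     cmod (x (fst q * exit_time R x) - d * y (snd q * exit_time R y)) \<le> 0))"
  unfolding nonint_def unit_interval_mult_image[OF exit_time_nonneg] by auto

lemma pred_nonint:
  assumes D: "countable D"
  shows "Measurable.pred (paths \<Otimes>\<^sub>M paths) (\<lambda>p. nonint D R (fst p) (snd p))"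
proof -
  let ?Q = "\<rat> \<inter> {0..1::real}"
  have Q: "?Q \<times> ?Q \<subseteq> {0..1} \<times> {0..1}" "{0..1} \<times> {0..1} \<subseteq> closure (?Q \<times> ?Q)" "countable (?Q \<times> ?Q)"
    using closure_rat_interval countable_rat_interval by (auto simp: closure_Times)
  have ev: "(\<lambda>p. X p (u * exit_time R (X p))) \<in> borel_measurable (paths \<Otimes>\<^sub>M paths)"
    if "X \<in> paths \<Otimes>\<^sub>M paths \<rightarrow>\<^sub>M paths" "u \<in> {0..1}" for X u
  proof -
    note [measurable] = that(1)
    show ?thesis
      by (rule measurable_eval_random_time[OF that(1)]) (use that in \<open>auto simp: exit_time_nonneg\<close>)
  qed
  have cont: "continuous_on ({0..1} \<times> {0..1}) (\<lambda>q. cmod (x (fst q * exit_time R x) - d * y (snd q * exit_time R y)))"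
    if "x \<in> path_set" "y \<in> path_set" for x y d
  proof -
    have c: "continuous_on {0..} x" "continuous_on {0..} y" using that by (auto simp: path_set_def)
    have "continuous_on ({0..1} \<times> {0..1}) (\<lambda>q. x (fst q * exit_time R x))"
      by (rule continuous_on_compose2[OF c(1)]) (auto intro!: continuous_intros mult_nonneg_nonneg exit_time_nonneg)
    moreover have "continuous_on ({0..1} \<times> {0..1}) (\<lambda>q. y (snd q * exit_time R y))"
      by (rule continuous_on_compose2[OF c(2)]) (auto intro!: continuous_intros mult_nonneg_nonneg exit_time_nonneg)
    ultimately show ?thesis by (intro continuous_intros)
  qed
  have "Measurable.pred (paths \<Otimes>\<^sub>M paths) (\<lambda>p. \<exists>q\<in>{0..1} \<times> {0..1}.
     cmod (fst p (fst q * exit_time R (fst p)) - d * snd p (snd q * exit_time R (snd p))) \<le> 0)" for d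
  proof (rule pred_ex_nonpos[OF _ _ Q])
    show "continuous_on ({0..1} \<times> {0..1}) (\<lambda>q. cmod (fst p (fst q * exit_time R (fst p)) - d * snd p (snd q * exit_time R (snd p))))"
      if "p \<in> space (paths \<Otimes>\<^sub>M paths)" for p
      using that by (intro cont) (auto simp: space_pair_measure)
    show "(\<lambda>p. cmod (fst p (fst q * exit_time R (fst p)) - d * snd p (snd q * exit_time R (snd p))))
        \<in> borel_measurable (paths \<Otimes>\<^sub>M paths)" if "q \<in> {0..1} \<times> {0..1}" for q
    proof -
      have [measurable]: "(\<lambda>p. fst p (fst q * exit_time R (fst p))) \<in> borel_measurable (paths \<Otimes>\<^sub>M paths)"
        "(\<lambda>p. snd p (snd q * exit_time R (snd p))) \<in> borel_measurable (paths \<Otimes>\<^sub>M paths)"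
        using that by (auto intro!: ev)
      show ?thesis by measurable
    qed
  qed (intro compact_Times compact_Icc)
  then have "Measurable.pred (paths \<Otimes>\<^sub>M paths) (\<lambda>p. \<not> (\<exists>q\<in>{0..1} \<times> {0..1}.
     cmod (fst p (fst q * exit_time R (fst p)) - d * snd p (snd q * exit_time R (snd p))) \<le> 0))" for d
    by (rule pred_intros_logic)
  then show ?thesis
    unfolding nonint_iff_unit_square pred_def
    by (intro sets.sets_Collect_countable_All'[OF _ D]) auto
qed

lemma exit_time_mono:
  assumes "x \<in> path_set" "hits R' x" "R \<le> R'"
  shows "exit_time R x \<le> exit_time R' x"
  using at_exit_time[OF assms(1,2)] assms(3) by (intro exit_time_le exit_time_nonneg) auto

lemma hits_mono: "hits R' x \<Longrightarrow> R \<le> R' \<Longrightarrow> hits R x"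
  by (auto simp: hits_def intro: order_trans)

lemma nonint_mono:
  assumes "x \<in> path_set" "y \<in> path_set" "hits R' x" "hits R' y" "R \<le> R'" "nonint A' R' x y" "A \<subseteq> A'"
  shows "nonint A R x y"
  using exit_time_mono[of x R' R] exit_time_mono[of y R' R] assms unfolding nonint_def by force

text \<open>The event up to radius \<open>R\<close> is decided by the two stopped paths, hence
  belongs to the past in the domination.\<close>

lemma nonint_stop:
  assumes "x \<in> path_set" "y \<in> path_set" "hits R x" "hits R y"
  shows "nonint A R (stop_path (exit_time R x) x) (stop_path (exit_time R y) y) \<longleftrightarrow> nonint A R x y"
  unfolding nonint_def exit_time_stop[OF assms(1,3) order_refl] exit_time_stop[OF assms(2,4) order_refl]
  by (simp add: stop_path_def)

lemma exit_time_post: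
  assumes "x \<in> path_set" "hits R' x" "R \<le> R'"
  shows "exit_time R' (post_path R x) = exit_time R' x - exit_time R x"
  unfolding post_path_def
  by (rule exit_time_shift[OF assms(1,2) exit_time_nonneg])
     (use before_exit_time[of _ R x] assms(3) in fastforce)

lemma nonint_post:
  assumes x: "x \<in> path_set" "hits R' x" and y: "y \<in> path_set" "hits R' y" and "R \<le> R'" "nonint A R' x y"
  shows "nonint A R' (post_path R x) (post_path R y)"
  using assms(6) exit_time_post[OF x assms(5)] exit_time_post[OF y assms(5)]
    exit_time_nonneg[of R x] exit_time_nonneg[of R y]
  unfolding nonint_def by (auto simp: post_path_def)

section \<open>Scaling of the non-intersection event\<close>

context wiener
begin

lemma scale_path_path_set: "x \<in> path_set \<Longrightarrow> c > 0 \<Longrightarrow> scale_path c x \<in> path_set"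
  unfolding path_set_def scale_path_def
  by (auto intro!: continuous_intros continuous_on_compose2[of "{0..}" x])

lemma scale_path_measurable:
  assumes c: "c > 0"
  shows "scale_path c \<in> paths \<rightarrow>\<^sub>M paths"
proof (rule measurable_pathsI)
  show "continuous_on {0..} (scale_path c x)" if "x \<in> space paths" for x
    using scale_path_path_set[OF _ c] that by (simp add: path_set_def)
  show "(\<lambda>x. scale_path c x t) \<in> borel_measurable paths" if "t \<ge> 0" for t
  proof -
    have [measurable]: "(\<lambda>x. x (t / c\<^sup>2)) \<in> borel_measurable paths"
      by (rule measurable_eval_path) (use that in simp)
    show ?thesis unfolding scale_path_def by measurable
  qed
qed

lemma norm_scale_path: "c > 0 \<Longrightarrow> cmod (scale_path c x t) = c * cmod (x (t / c\<^sup>2))"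
  by (simp add: scale_path_def norm_mult)

lemma hits_scale:
  assumes c: "c > 0"
  shows "hits (c * r) (scale_path c x) \<longleftrightarrow> hits r x"
proof
  assume "hits (c * r) (scale_path c x)"
  then obtain t where "t \<ge> 0" "c * r \<le> c * cmod (x (t / c\<^sup>2))" by (auto simp: hits_def norm_scale_path[OF c])
  then show "hits r x" using c unfolding hits_def by (intro exI[of _ "t / c\<^sup>2"]) auto
next
  assume "hits r x"
  then obtain t where "t \<ge> 0" "r \<le> cmod (x t)" by (auto simp: hits_def)
  then show "hits (c * r) (scale_path c x)"
    using c unfolding hits_def norm_scale_path[OF c] by (intro exI[of _ "c\<^sup>2 * t"]) auto
qed

lemma exit_time_scale:
  assumes c: "c > 0" and x: "x \<in> path_set" "hits r x"
  shows "exit_time (c * r) (scale_path c x) = c\<^sup>2 * exit_time r x"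
proof (rule antisym)
  show "exit_time (c * r) (scale_path c x) \<le> c\<^sup>2 * exit_time r x"
    using at_exit_time[OF x] c exit_time_nonneg[of r x]
    by (intro exit_time_le) (auto simp: norm_scale_path[OF c])
  have "hits (c * r) (scale_path c x)" using hits_scale[OF c] x(2) by simp
  from at_exit_time[OF scale_path_path_set[OF x(1) c] this]
  have "exit_time r x \<le> exit_time (c * r) (scale_path c x) / c\<^sup>2"
    using c by (intro exit_time_le) (auto simp: norm_scale_path[OF c] exit_time_nonneg)
  then show "c\<^sup>2 * exit_time r x \<le> exit_time (c * r) (scale_path c x)"
    using c by (simp add: field_simps)
qed

text \<open>Both paths are dilated by the same factor, which cancels in the equation between a point
  of the first path and a dilated point of the second.\<close>

lemma nonint_scale:
  assumes c: "c > 0" and x: "x \<in> path_set" "hits r x" and y: "y \<in> path_set" "hits r y"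
  shows "nonint A (c * r) (scale_path c x) (scale_path c y) \<longleftrightarrow> nonint A r x y"
proof -
  have img: "{0..c\<^sup>2 * T} = (\<lambda>s. c\<^sup>2 * s) ` {0..T}" for T :: real
    using c by (simp add: image_mult_atLeastAtMost)
  have ball: "(\<forall>s\<in>{0..c\<^sup>2 * T}. P s) \<longleftrightarrow> (\<forall>s\<in>{0..T}. P (c\<^sup>2 * s))" for T P
    unfolding img by blast
  show ?thesis
    unfolding nonint_def exit_time_scale[OF c x] exit_time_scale[OF c y] ball
    using c by (simp add: scale_path_def mult.left_commute[of _ "of_real c"])
qed

end

text \<open>The hypothesis bounds rectangles of a single path, while \<open>S\<close> and
  \<open>S'\<close> couple two paths. It is applied to sections: first in \<open>x\<close> with
  \<open>y\<close> fixed, which trades \<open>h x\<close> for an independent \<open>b\<close>, then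
  in \<open>y\<close> with \<open>x\<close> and \<open>b\<close> fixed. Each use costs a factor
  \<open>K\<close>.\<close>

lemma two_sided_domination:
  fixes K :: ennreal
  assumes P: "prob_space P" "sets P = sets paths" and Q: "prob_space Q" "sets Q = sets paths"
    and f: "f \<in> paths \<rightarrow>\<^sub>M paths" and h: "h \<in> paths \<rightarrow>\<^sub>M paths"
    and S: "S \<in> sets (paths \<Otimes>\<^sub>M paths)" and S': "S' \<in> sets (paths \<Otimes>\<^sub>M paths)"
    and dom: "\<And>A C. A \<in> sets paths \<Longrightarrow> C \<in> sets paths \<Longrightarrow>
      emeasure P {x \<in> path_set. f x \<in> A \<and> h x \<in> C} \<le> K * emeasure P {x \<in> path_set. f x \<in> A} * emeasure Q C"
  shows "(\<integral>\<^sup>+p. indicator S (f (fst p), f (snd p)) * indicator S' (h (fst p), h (snd p)) \<partial>(P \<Otimes>\<^sub>M P))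
    \<le> K * K * (\<integral>\<^sup>+p. indicator S (f (fst p), f (snd p)) \<partial>(P \<Otimes>\<^sub>M P)) * emeasure (Q \<Otimes>\<^sub>M Q) S'"
proof -
  interpret P: prob_space P by fact
  interpret Q: prob_space Q by fact
  interpret PP: pair_sigma_finite P P ..
  interpret PQ: pair_sigma_finite P Q ..
  interpret QP: pair_sigma_finite Q P ..
  interpret QQ: pair_sigma_finite Q Q ..
  note [measurable_cong] = P(2) Q(2)
  note [measurable] = f h S S'
  have spP: "space P = path_set"
    using sets_eq_imp_space_eq[OF P(2)] by simp
  have dom': "(\<integral>\<^sup>+x. indicator A (f x) * indicator C (h x) \<partial>P)
      \<le> K * (\<integral>\<^sup>+x. indicator A (f x) \<partial>P) * (\<integral>\<^sup>+b. indicator C b \<partial>Q)"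
    if A [measurable]: "A \<in> sets paths" and C [measurable]: "C \<in> sets paths" for A C
  proof -
    have "{x \<in> space P. f x \<in> A \<and> h x \<in> C} \<in> sets P" "{x \<in> space P. f x \<in> A} \<in> sets P"
      by measurable
    note m = this[unfolded spP]
    have "(\<integral>\<^sup>+x. indicator A (f x) * indicator C (h x) \<partial>P) = (\<integral>\<^sup>+x. indicator {x \<in> path_set. f x \<in> A \<and> h x \<in> C} x \<partial>P)"
      by (intro nn_integral_cong) (auto simp: indicator_def spP)
    also have "\<dots> = emeasure P {x \<in> path_set. f x \<in> A \<and> h x \<in> C}" using m by simp
    also have "\<dots> \<le> K * emeasure P {x \<in> path_set. f x \<in> A} * emeasure Q C" by (rule dom[OF A C])
    also have "emeasure P {x \<in> path_set. f x \<in> A} = (\<integral>\<^sup>+x. indicator {x \<in> path_set. f x \<in> A} x \<partial>P)" using m by simp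
    also have "\<dots> = (\<integral>\<^sup>+x. indicator A (f x) \<partial>P)"
      by (intro nn_integral_cong) (auto simp: indicator_def spP)
    finally show ?thesis using C Q(2) by simp
  qed
  have sec1: "Pair a -` X \<in> sets paths" if "X \<in> sets (paths \<Otimes>\<^sub>M paths)" for a X
    using that by (rule sets_Pair1)
  have sec2: "(\<lambda>x. (x, b)) -` X \<in> sets paths" if "X \<in> sets (paths \<Otimes>\<^sub>M paths)" for b X
    using that by (rule sets_Pair2)
  define i where "i x y = (indicator S (f x, f y) :: ennreal)" for x y
  define k where "k b y = (indicator S' (b, h y) :: ennreal)" for b y
  define I where "I x = (\<integral>\<^sup>+y. i x y \<partial>P)" for x
  define J where "J b = (\<integral>\<^sup>+b'. indicator S' (b, b') \<partial>Q)" for b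
  have i [measurable]: "(\<lambda>(x, y). i x y) \<in> borel_measurable (paths \<Otimes>\<^sub>M paths)" unfolding i_def by measurable
  have k [measurable]: "(\<lambda>(x, y). k x y) \<in> borel_measurable (paths \<Otimes>\<^sub>M paths)" unfolding k_def by measurable
  have I [measurable]: "I \<in> borel_measurable paths"
    unfolding I_def[abs_def] by measurable
  have J [measurable]: "J \<in> borel_measurable paths"
    unfolding J_def[abs_def] by measurable
  have "(\<integral>\<^sup>+p. indicator S (f (fst p), f (snd p)) * indicator S' (h (fst p), h (snd p)) \<partial>(P \<Otimes>\<^sub>M P))
      = (\<integral>\<^sup>+y. (\<integral>\<^sup>+x. indicator S (f x, f y) * indicator S' (h x, h y) \<partial>P) \<partial>P)"
    by (subst PP.nn_integral_snd[symmetric]) auto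
  also have "\<dots> \<le> (\<integral>\<^sup>+y. K * (\<integral>\<^sup>+x. i x y \<partial>P) * (\<integral>\<^sup>+b. k b y \<partial>Q) \<partial>P)"
  proof (rule nn_integral_mono)
    fix y
    show "(\<integral>\<^sup>+x. indicator S (f x, f y) * indicator S' (h x, h y) \<partial>P) \<le> K * (\<integral>\<^sup>+x. i x y \<partial>P) * (\<integral>\<^sup>+b. k b y \<partial>Q)"
      using dom'[OF sec2[OF S, of "f y"] sec2[OF S', of "h y"]]
      unfolding i_def k_def by (simp add: indicator_def vimage_def)
  qed
  \<comment> \<open>The product is unfolded again so that, after Fubini, the integral over
    \<open>y\<close> becomes the innermost one and the hypothesis can be used a second time.\<close>
  also have "\<dots> = (\<integral>\<^sup>+y. (\<integral>\<^sup>+x. K * (\<integral>\<^sup>+b. i x y * k b y \<partial>Q) \<partial>P) \<partial>P)"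
  proof (rule nn_integral_cong)
    fix y assume "y \<in> space P"
    then have [measurable]: "y \<in> space paths" by (simp add: spP)
    have "(\<integral>\<^sup>+x. K * (\<integral>\<^sup>+b. i x y * k b y \<partial>Q) \<partial>P) = (\<integral>\<^sup>+x. K * (\<integral>\<^sup>+b. k b y \<partial>Q) * i x y \<partial>P)"
      by (intro nn_integral_cong) (subst nn_integral_cmult, measurable, simp add: mult_ac)
    also have "\<dots> = K * (\<integral>\<^sup>+b. k b y \<partial>Q) * (\<integral>\<^sup>+x. i x y \<partial>P)"
      by (rule nn_integral_cmult) measurable
    finally show "K * (\<integral>\<^sup>+x. i x y \<partial>P) * (\<integral>\<^sup>+b. k b y \<partial>Q) = (\<integral>\<^sup>+x. K * (\<integral>\<^sup>+b. i x y * k b y \<partial>Q) \<partial>P)"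
      by (simp add: mult_ac)
  qed
  also have "\<dots> = (\<integral>\<^sup>+x. (\<integral>\<^sup>+y. K * (\<integral>\<^sup>+b. i x y * k b y \<partial>Q) \<partial>P) \<partial>P)"
    by (rule PP.Fubini') measurable
  also have "\<dots> = (\<integral>\<^sup>+x. K * (\<integral>\<^sup>+b. (\<integral>\<^sup>+y. i x y * k b y \<partial>P) \<partial>Q) \<partial>P)"
  proof (rule nn_integral_cong)
    fix x assume "x \<in> space P"
    then have [measurable]: "x \<in> space paths" by (simp add: spP)
    have "(\<integral>\<^sup>+y. K * (\<integral>\<^sup>+b. i x y * k b y \<partial>Q) \<partial>P) = K * (\<integral>\<^sup>+y. (\<integral>\<^sup>+b. i x y * k b y \<partial>Q) \<partial>P)"
      by (rule nn_integral_cmult) measurable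
    also have "(\<integral>\<^sup>+y. (\<integral>\<^sup>+b. i x y * k b y \<partial>Q) \<partial>P) = (\<integral>\<^sup>+b. (\<integral>\<^sup>+y. i x y * k b y \<partial>P) \<partial>Q)"
      by (rule QP.Fubini') measurable
    finally show "(\<integral>\<^sup>+y. K * (\<integral>\<^sup>+b. i x y * k b y \<partial>Q) \<partial>P) = K * (\<integral>\<^sup>+b. (\<integral>\<^sup>+y. i x y * k b y \<partial>P) \<partial>Q)" .
  qed
  \<comment> \<open>Second use of the hypothesis, for the sections at \<open>f x\<close> and at
    \<open>b\<close>.\<close>
  also have "\<dots> \<le> (\<integral>\<^sup>+x. K * (\<integral>\<^sup>+b. K * I x * J b \<partial>Q) \<partial>P)"
  proof (intro nn_integral_mono mult_left_mono)
    fix x b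
    show "(\<integral>\<^sup>+y. i x y * k b y \<partial>P) \<le> K * I x * J b"
      using dom'[OF sec1[OF S, of "f x"] sec1[OF S', of b]]
      unfolding i_def k_def I_def J_def by (simp add: indicator_def vimage_def)
  qed simp
  also have "\<dots> = K * K * (\<integral>\<^sup>+x. I x \<partial>P) * (\<integral>\<^sup>+b. J b \<partial>Q)"
    by (simp add: nn_integral_cmult nn_integral_multc mult_ac)
  also have "(\<integral>\<^sup>+x. I x \<partial>P) = (\<integral>\<^sup>+p. indicator S (f (fst p), f (snd p)) \<partial>(P \<Otimes>\<^sub>M P))"
    unfolding I_def i_def by (subst P.nn_integral_fst[symmetric]) auto
  also have "(\<integral>\<^sup>+b. J b \<partial>Q) = emeasure (Q \<Otimes>\<^sub>M Q) S'"
  proof -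
    have "S' \<in> sets (Q \<Otimes>\<^sub>M Q)" by measurable
    then have "emeasure (Q \<Otimes>\<^sub>M Q) S' = (\<integral>\<^sup>+p. indicator S' p \<partial>(Q \<Otimes>\<^sub>M Q))" by simp
    also have "\<dots> = (\<integral>\<^sup>+b. J b \<partial>Q)"
      unfolding J_def by (subst Q.nn_integral_fst[symmetric]) auto
    finally show ?thesis ..
  qed
  finally show ?thesis .
qed

section \<open>Two independent paths and submultiplicativity\<close>

context wiener
begin

abbreviation Px2 :: "((real \<Rightarrow> complex) \<times> (real \<Rightarrow> complex)) measure" where
  "Px2 \<equiv> Px 1 \<Otimes>\<^sub>M Px 1"

lemma sets_Px2: "sets (Px r \<Otimes>\<^sub>M Px r) = sets (paths \<Otimes>\<^sub>M paths)"
  by (intro sets_pair_measure_cong) simp_all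

lemma space_Px2 [simp]: "space (Px r \<Otimes>\<^sub>M Px r) = path_set \<times> path_set"
  by (simp add: space_pair_measure)

lemma pair_prob_space_Px: "r \<ge> 0 \<Longrightarrow> pair_prob_space (Px r) (Px r)"
  using prob_space_Px[of r]
  by (simp add: pair_prob_space_def pair_sigma_finite_def prob_space_imp_sigma_finite)

lemma prob_space_Px2: "r \<ge> 0 \<Longrightarrow> prob_space (Px r \<Otimes>\<^sub>M Px r)"
  by (intro prob_space_pair prob_space_Px)

lemma AE_hits_pair:
  assumes "r \<ge> 0"
  shows "AE p in Px r \<Otimes>\<^sub>M Px r. fst p \<in> path_set \<and> snd p \<in> path_set \<and> hits \<rho> (fst p) \<and> hits \<rho> (snd p)"
proof -
  interpret pair_prob_space "Px r" "Px r" by (rule pair_prob_space_Px[OF assms])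
  have h: "AE x in Px r. hits \<rho> x" by (rule AE_hits[OF brownian_Px[OF assms]])
  have "AE p in Px r \<Otimes>\<^sub>M Px r. hits \<rho> (fst p)" "AE p in Px r \<Otimes>\<^sub>M Px r. hits \<rho> (snd p)"
  proof -
    have "Measurable.pred (paths \<Otimes>\<^sub>M paths) (\<lambda>p. hits \<rho> (fst p))"
      "Measurable.pred (paths \<Otimes>\<^sub>M paths) (\<lambda>p. hits \<rho> (snd p))" by measurable
    then have m: "{p \<in> space (Px r \<Otimes>\<^sub>M Px r). hits \<rho> (fst p)} \<in> sets (Px r \<Otimes>\<^sub>M Px r)"
      "{p \<in> space (Px r \<Otimes>\<^sub>M Px r). hits \<rho> (snd p)} \<in> sets (Px r \<Otimes>\<^sub>M Px r)"
      unfolding sets_Px2 pred_def by (simp_all add: space_pair_measure)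
    have "AE x in Px r. AE y in Px r. hits \<rho> (fst (x, y))"
      using h by eventually_elim simp
    then show "AE p in Px r \<Otimes>\<^sub>M Px r. hits \<rho> (fst p)" by (rule AE_pair_measure[OF m(1)])
    have "AE x in Px r. AE y in Px r. hits \<rho> (snd (x, y))" using h by simp
    then show "AE p in Px r \<Otimes>\<^sub>M Px r. hits \<rho> (snd p)" by (rule AE_pair_measure[OF m(2)])
  qed
  then show ?thesis using AE_space by eventually_elim auto
qed

definition nonint_event :: "complex set \<Rightarrow> real \<Rightarrow> ((real \<Rightarrow> complex) \<times> (real \<Rightarrow> complex)) set" where
  "nonint_event D R = {p \<in> path_set \<times> path_set. nonint D R (fst p) (snd p)}"

lemma nonint_event_sets:
  assumes "countable D"
  shows "nonint_event D R \<in> sets (paths \<Otimes>\<^sub>M paths)"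
  using pred_nonint[OF assms, of R] unfolding nonint_event_def pred_def by (simp add: space_pair_measure)

lemma nonint_event_scale:
  assumes D: "countable D" and c: "c > 0"
  shows "emeasure (Px c \<Otimes>\<^sub>M Px c) (nonint_event D (c * R)) = emeasure Px2 (nonint_event D R)"
proof -
  note sm [measurable] = scale_path_measurable[OF c]
  note [measurable] = nonint_event_sets[OF D]
  interpret C: prob_space "Px c" by (rule prob_space_Px) (use c in simp)
  have law: "distr (Px 1) paths (scale_path c) = Px c"
    using distr_Px_scale[of 1 c] c by simp
  have "Px c \<Otimes>\<^sub>M Px c = distr (Px 1 \<Otimes>\<^sub>M Px 1) (paths \<Otimes>\<^sub>M paths) (\<lambda>(x, y). (scale_path c x, scale_path c y))"
    using pair_measure_distr[of "scale_path c" "Px 1" paths "scale_path c" "Px 1" paths] C.sigma_finite_measure_axioms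
    by (simp add: law)
  then have "emeasure (Px c \<Otimes>\<^sub>M Px c) (nonint_event D (c * R))
      = emeasure Px2 ((\<lambda>(x, y). (scale_path c x, scale_path c y)) -` nonint_event D (c * R) \<inter> space Px2)"
    by (simp only:) (rule emeasure_distr, auto)
  also have "\<dots> = emeasure Px2 (nonint_event D R)"
  proof (rule emeasure_eq_AE)
    show "AE p in Px2. p \<in> (\<lambda>(x, y). (scale_path c x, scale_path c y)) -` nonint_event D (c * R) \<inter> space Px2
        \<longleftrightarrow> p \<in> nonint_event D R"
      using AE_hits_pair[OF zero_le_one, of R]
      by eventually_elim (auto simp: nonint_event_def nonint_scale[OF c] scale_path_path_set c)
    show "(\<lambda>(x, y). (scale_path c x, scale_path c y)) -` nonint_event D (c * R) \<inter> space Px2 \<in> sets Px2"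
      by (rule measurable_sets[where A="paths \<Otimes>\<^sub>M paths"]) auto
    show "nonint_event D R \<in> sets Px2" unfolding sets_Px2 by measurable
  qed
  finally show ?thesis .
qed

lemma nonint_submultiplicative:
  assumes D: "countable D" and R: "R \<ge> 1" and R': "R' \<ge> 1"
  shows "emeasure Px2 (nonint_event D (2 * R * R'))
    \<le> 16 * emeasure Px2 (nonint_event D R) * emeasure Px2 (nonint_event D R')"
proof -
  note m [measurable] = nonint_event_sets[OF D]
  let ?f = "\<lambda>x. stop_path (exit_time R x) x" and ?h = "post_path (2 * R)"
  have f [measurable]: "?f \<in> paths \<rightarrow>\<^sub>M paths" by (rule measurable_stop_exit) simp
  let ?S = "nonint_event D R" and ?S' = "nonint_event D (2 * R * R')"
  have R2: "2 * R \<le> 2 * R * R'" "R \<le> 2 * R * R'" using R R' by (auto simp: mult_le_cancel_left1 intro: order_trans[of R "R * R'"])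
  have "emeasure Px2 ?S' = (\<integral>\<^sup>+p. indicator ?S' p \<partial>Px2)"
    by (rule nn_integral_indicator[symmetric]) (simp only: sets_Px2 m)
  also have "\<dots> \<le> (\<integral>\<^sup>+p. indicator ?S (?f (fst p), ?f (snd p)) * indicator ?S' (?h (fst p), ?h (snd p)) \<partial>Px2)"
  proof (rule nn_integral_mono_AE)
    show "AE p in Px2. indicator ?S' p
        \<le> (indicator ?S (?f (fst p), ?f (snd p)) * indicator ?S' (?h (fst p), ?h (snd p)) :: ennreal)"
      using AE_hits_pair[OF zero_le_one, of "2 * R * R'"]
    proof eventually_elim
      case (elim p)
      show ?case
      proof (cases "p \<in> ?S'")
        case True
        then have n: "nonint D (2 * R * R') (fst p) (snd p)" by (simp add: nonint_event_def)
        have hR: "hits R (fst p)" "hits R (snd p)" using elim hits_mono R2(2) by blast+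
        have "nonint D R (fst p) (snd p)"
          using nonint_mono[of "fst p" "snd p" "2 * R * R'" R D D] n elim R2(2) by simp
        then have "(?f (fst p), ?f (snd p)) \<in> ?S"
          using elim hR by (simp add: nonint_event_def nonint_stop stop_path_in_path_set exit_time_nonneg)
        moreover have "(?h (fst p), ?h (snd p)) \<in> ?S'"
          using nonint_post[of "fst p" "2 * R * R'" "snd p" "2 * R" D] n elim R2(1)
            measurable_space[OF post_path_measurable, of _ "2 * R"]
          by (simp add: nonint_event_def)
        ultimately show ?thesis by (simp add: indicator_def)
      qed simp
    qed
  qed
  also have "\<dots> \<le> 4 * 4 * (\<integral>\<^sup>+p. indicator ?S (?f (fst p), ?f (snd p)) \<partial>Px2)
      * emeasure (Px (2 * R) \<Otimes>\<^sub>M Px (2 * R)) ?S'"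
    by (rule two_sided_domination)
       (use R in \<open>auto intro!: prob_space_Px past_post_domination\<close>)
  also have "(\<integral>\<^sup>+p. indicator ?S (?f (fst p), ?f (snd p)) \<partial>Px2) = (\<integral>\<^sup>+p. indicator ?S p \<partial>Px2)"
  proof (rule nn_integral_cong_AE)
    show "AE p in Px2. indicator ?S (?f (fst p), ?f (snd p)) = (indicator ?S p :: ennreal)"
      using AE_hits_pair[OF zero_le_one, of R]
      by eventually_elim
         (auto simp: nonint_event_def nonint_stop stop_path_in_path_set exit_time_nonneg indicator_def)
  qed
  also have "(\<integral>\<^sup>+p. indicator ?S p \<partial>Px2) = emeasure Px2 ?S"
    by (rule nn_integral_indicator) (simp only: sets_Px2 m)
  \<comment> \<open>Dividing by \<open>2 * R\<close> moves the start to the unit circle and the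
    final radius to \<open>R'\<close>.\<close>
  also have "emeasure (Px (2 * R) \<Otimes>\<^sub>M Px (2 * R)) ?S' = emeasure Px2 (nonint_event D R')"
    using nonint_event_scale[OF D, of "2 * R" R'] R by simp
  finally show ?thesis by simp
qed

end

section \<open>Hitting a curve from a nearby point\<close>

text \<open>The curve is parametrised by modulus, through the first passage to radius
  \<open>\<rho>\<close>. This may jump and omit parts of the curve, but it is measurable because
  exit times are monotone in the radius; clamping makes that monotonicity global.\<close>

definition curve_point :: "(real \<Rightarrow> complex) \<Rightarrow> real \<Rightarrow> complex" where
  "curve_point g \<rho> = g (exit_time (min 1 (max 0 \<rho>)) g)"

definition curve_until :: "real \<Rightarrow> (real \<Rightarrow> complex) \<Rightarrow> complex set" where
  "curve_until r g = g ` {0..exit_time r g}"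

lemma compact_curve_until: "g \<in> path_set \<Longrightarrow> compact (curve_until r g)"
  unfolding curve_until_def path_set_def
  by (intro compact_continuous_image compact_Icc) (auto intro: continuous_on_subset)

lemma curve_until_nonempty: "curve_until r g \<noteq> {}"
  using exit_time_nonneg[of r g] by (auto simp: curve_until_def)

text \<open>As \<open>curve_point g \<rho>\<close> has modulus \<open>\<rho>\<close>, the radii counted here lie in an interval of length
  \<open>2 * \<delta>\<close>: the occupation is bounded like that of a straight segment, whatever the curve.\<close>

definition curve_occupation :: "(real \<Rightarrow> complex) \<Rightarrow> real \<Rightarrow> complex \<Rightarrow> ennreal" where
  "curve_occupation g \<delta> w =
     (\<integral>\<^sup>+\<rho>. indicator {0..1} \<rho> * indicator (ball 0 \<delta>) (w - curve_point g \<rho>) \<partial>lborel)"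

locale unit_curve =
  fixes g :: "real \<Rightarrow> complex"
  assumes g: "g \<in> path_set" and g0: "g 0 = 0" and g1: "hits 1 g"
begin

lemma curve_point_measurable [measurable]: "curve_point g \<in> borel_measurable borel"
proof -
  have "mono (\<lambda>\<rho>. exit_time (min 1 (max 0 \<rho>)) g)"
    using g g1 by (intro monoI exit_time_mono) (auto intro: hits_mono)
  then have "(\<lambda>\<rho>. exit_time (min 1 (max 0 \<rho>)) g) \<in> borel_measurable borel"
    by (rule borel_measurable_mono)
  then have [measurable]: "(\<lambda>\<rho>. max 0 (exit_time (min 1 (max 0 \<rho>)) g)) \<in> borel_measurable borel"
    by measurable
  have "continuous_on UNIV (\<lambda>t. g (max 0 t))"
    using g unfolding path_set_def by (auto intro!: continuous_on_compose2[of "{0..}" g] continuous_intros)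
  then have "(\<lambda>t. g (max 0 t)) \<in> borel_measurable borel" by (rule borel_measurable_continuous_onI)
  from measurable_compose[OF _ this, of "\<lambda>\<rho>. max 0 (exit_time (min 1 (max 0 \<rho>)) g)" borel]
  have "(\<lambda>\<rho>. g (max 0 (max 0 (exit_time (min 1 (max 0 \<rho>)) g)))) \<in> borel_measurable borel" by measurable
  then show ?thesis
    unfolding curve_point_def[abs_def] by (simp add: exit_time_nonneg max_absorb2)
qed

lemma norm_curve_point: "0 \<le> \<rho> \<Longrightarrow> \<rho> \<le> 1 \<Longrightarrow> cmod (curve_point g \<rho>) = \<rho>"
  unfolding curve_point_def using norm_at_exit_time[OF g, of \<rho>] hits_mono[OF g1] g0
  by (simp add: min_def max_def)

lemma curve_point_in: "curve_point g \<rho> \<in> curve_until 1 g"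
  unfolding curve_point_def curve_until_def
  using exit_time_mono[OF g g1, of "min 1 (max 0 \<rho>)"] exit_time_nonneg by auto

lemma curve_occupation_measurable [measurable]: "curve_occupation g \<delta> \<in> borel_measurable borel"
  unfolding curve_occupation_def[abs_def] by measurable

lemma curve_occupation_le: "\<delta> > 0 \<Longrightarrow> curve_occupation g \<delta> w \<le> ennreal (2 * \<delta>)"
proof -
  assume \<delta>: "\<delta> > 0"
  have "curve_occupation g \<delta> w \<le> (\<integral>\<^sup>+\<rho>. indicator {cmod w - \<delta>..cmod w + \<delta>} \<rho> \<partial>lborel)"
    unfolding curve_occupation_def
  proof (rule nn_integral_mono)
    fix \<rho> :: real
    show "indicator {0..1} \<rho> * indicator (ball 0 \<delta>) (w - curve_point g \<rho>)
        \<le> (indicator {cmod w - \<delta>..cmod w + \<delta>} \<rho> :: ennreal)"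
    proof (cases "\<rho> \<in> {0..1} \<and> cmod (w - curve_point g \<rho>) < \<delta>")
      case True
      then have "\<bar>cmod w - \<rho>\<bar> < \<delta>"
        using norm_triangle_ineq3[of w "curve_point g \<rho>"] norm_curve_point[of \<rho>] by simp
      then have "\<rho> \<in> {cmod w - \<delta>..cmod w + \<delta>}" by auto
      then show ?thesis by (simp add: indicator_def)
    qed (auto simp: indicator_def)
  qed
  also have "\<dots> = ennreal (2 * \<delta>)" using \<delta> by simp
  finally show ?thesis .
qed

text \<open>Fubini and the substitution \<open>u = curve_point g \<rho> - w + q\<close> reduce the
  occupation of a neighbourhood to integrals of the Gaussian density along the curve, one for each
  displacement \<open>q\<close> in the ball.\<close>

lemma nn_integral_gauss_occupation:
  "(\<integral>\<^sup>+u. curve_occupation g \<delta> (w + u) \<partial>gauss \<tau>)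
    = (\<integral>\<^sup>+q. indicator (ball 0 \<delta>) q * (\<integral>\<^sup>+\<rho>. indicator {0..1} \<rho> * gauss_density \<tau> (curve_point g \<rho> - w + q) \<partial>lborel) \<partial>lborel)"
proof -
  have trans: "(\<integral>\<^sup>+x. f x \<partial>lborel) = (\<integral>\<^sup>+x. f (a + x) \<partial>lborel)"
    if [measurable]: "f \<in> borel_measurable borel" for f :: "complex \<Rightarrow> ennreal" and a
    by (subst lborel_distr_plus[of a, symmetric]) (simp add: nn_integral_distr)
  have "(\<integral>\<^sup>+u. curve_occupation g \<delta> (w + u) \<partial>gauss \<tau>)
      = (\<integral>\<^sup>+u. gauss_density \<tau> u * curve_occupation g \<delta> (w + u) \<partial>lborel)"
    unfolding gauss_def by (subst nn_integral_density) auto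
  also have "\<dots> = (\<integral>\<^sup>+u. (\<integral>\<^sup>+\<rho>. gauss_density \<tau> u * (indicator {0..1} \<rho> * indicator (ball 0 \<delta>) (w + u - curve_point g \<rho>)) \<partial>lborel) \<partial>lborel)"
    unfolding curve_occupation_def by (intro nn_integral_cong nn_integral_cmult[symmetric]) measurable
  also have "\<dots> = (\<integral>\<^sup>+\<rho>. (\<integral>\<^sup>+u. gauss_density \<tau> u * (indicator {0..1} \<rho> * indicator (ball 0 \<delta>) (w + u - curve_point g \<rho>)) \<partial>lborel) \<partial>lborel)"
    by (rule lborel_pair.Fubini') measurable
  also have "\<dots> = (\<integral>\<^sup>+\<rho>. (\<integral>\<^sup>+q. indicator (ball 0 \<delta>) q * (indicator {0..1} \<rho> * gauss_density \<tau> (curve_point g \<rho> - w + q)) \<partial>lborel) \<partial>lborel)"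
  proof (rule nn_integral_cong)
    fix \<rho> :: real
    have "(\<integral>\<^sup>+u. gauss_density \<tau> u * (indicator {0..1} \<rho> * indicator (ball 0 \<delta>) (w + u - curve_point g \<rho>)) \<partial>lborel)
        = (\<integral>\<^sup>+q. gauss_density \<tau> (curve_point g \<rho> - w + q) * (indicator {0..1} \<rho> * indicator (ball 0 \<delta>) (w + (curve_point g \<rho> - w + q) - curve_point g \<rho>)) \<partial>lborel)"
      by (rule trans) measurable
    also have "\<dots> = (\<integral>\<^sup>+q. indicator (ball 0 \<delta>) q * (indicator {0..1} \<rho> * gauss_density \<tau> (curve_point g \<rho> - w + q)) \<partial>lborel)"
      by (intro nn_integral_cong) (simp add: mult_ac)
    finally show "(\<integral>\<^sup>+u. gauss_density \<tau> u * (indicator {0..1} \<rho> * indicator (ball 0 \<delta>) (w + u - curve_point g \<rho>)) \<partial>lborel)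
        = (\<integral>\<^sup>+q. indicator (ball 0 \<delta>) q * (indicator {0..1} \<rho> * gauss_density \<tau> (curve_point g \<rho> - w + q)) \<partial>lborel)" .
  qed
  also have "\<dots> = (\<integral>\<^sup>+q. (\<integral>\<^sup>+\<rho>. indicator (ball 0 \<delta>) q * (indicator {0..1} \<rho> * gauss_density \<tau> (curve_point g \<rho> - w + q)) \<partial>lborel) \<partial>lborel)"
    by (rule lborel_pair.Fubini') measurable
  also have "\<dots> = (\<integral>\<^sup>+q. indicator (ball 0 \<delta>) q * (\<integral>\<^sup>+\<rho>. indicator {0..1} \<rho> * gauss_density \<tau> (curve_point g \<rho> - w + q) \<partial>lborel) \<partial>lborel)"
    by (intro nn_integral_cong nn_integral_cmult) measurable
  finally show ?thesis .
qed

text \<open>Differences of moduli bound distances from below, so along the curve the planar density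
  is at most \<open>1 / sqrt (2 * pi * \<tau>)\<close> times a one-dimensional normal density in
  \<open>\<rho>\<close>, of total mass 1.\<close>

lemma gauss_occupation_upper:
  assumes \<tau>: "\<tau> > 0"
  shows "(\<integral>\<^sup>+u. curve_occupation g \<delta> (w + u) \<partial>gauss \<tau>)
    \<le> ennreal (1 / sqrt (2 * pi * \<tau>)) * emeasure lborel (ball (0::complex) \<delta>)"
proof -
  have inner: "(\<integral>\<^sup>+\<rho>. indicator {0..1} \<rho> * gauss_density \<tau> (curve_point g \<rho> - w + q) \<partial>lborel)
      \<le> ennreal (1 / sqrt (2 * pi * \<tau>))" for q
  proof -
    let ?b = "cmod (w - q)" and ?c = "1 / sqrt (2 * pi * \<tau>)"
    have sq: "sqrt (2 * pi * \<tau>) * sqrt (2 * pi * \<tau>) = 2 * pi * \<tau>" using \<tau> by simp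
    have "(\<integral>\<^sup>+\<rho>. indicator {0..1} \<rho> * gauss_density \<tau> (curve_point g \<rho> - w + q) \<partial>lborel)
        \<le> (\<integral>\<^sup>+\<rho>. ennreal ?c * ennreal (normal_density ?b (sqrt \<tau>) \<rho>) \<partial>lborel)"
    proof (rule nn_integral_mono)
      fix \<rho> :: real
      show "indicator {0..1} \<rho> * gauss_density \<tau> (curve_point g \<rho> - w + q) \<le> ennreal ?c * ennreal (normal_density ?b (sqrt \<tau>) \<rho>)"
      proof (cases "\<rho> \<in> {0..1}")
        case True
        have "\<bar>\<rho> - ?b\<bar> \<le> cmod (curve_point g \<rho> - w + q)"
          using norm_triangle_ineq3[of "curve_point g \<rho>" "w - q"] norm_curve_point[of \<rho>] True
          by (simp add: algebra_simps)
        then have "(\<rho> - ?b)\<^sup>2 \<le> (cmod (curve_point g \<rho> - w + q))\<^sup>2"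
          by (metis abs_ge_zero power2_abs power_mono)
        then have "- (cmod (curve_point g \<rho> - w + q))\<^sup>2 / (2 * \<tau>) \<le> - (\<rho> - ?b)\<^sup>2 / (2 * \<tau>)"
          using \<tau> by (intro divide_right_mono) auto
        then have "exp (- (cmod (curve_point g \<rho> - w + q))\<^sup>2 / (2 * \<tau>)) / (2 * pi * \<tau>)
            \<le> exp (- (\<rho> - ?b)\<^sup>2 / (2 * \<tau>)) / (2 * pi * \<tau>)"
          using \<tau> by (intro divide_right_mono) auto
        also have "\<dots> = ?c * normal_density ?b (sqrt \<tau>) \<rho>"
          using \<tau> sq unfolding normal_density_def by simp
        finally show ?thesis
          using True unfolding gauss_density_def by (simp add: ennreal_mult''[symmetric] normal_density_nonneg ennreal_leI)
      qed simp
    qed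
    also have "\<dots> = ennreal ?c * (\<integral>\<^sup>+\<rho>. ennreal (normal_density ?b (sqrt \<tau>) \<rho>) \<partial>lborel)"
      by (rule nn_integral_cmult) measurable
    also have "(\<integral>\<^sup>+\<rho>. ennreal (normal_density ?b (sqrt \<tau>) \<rho>) \<partial>lborel) = 1"
      using \<tau> by (subst nn_integral_eq_integral) (auto simp: normal_density_nonneg)
    finally show ?thesis by simp
  qed
  have "(\<integral>\<^sup>+u. curve_occupation g \<delta> (w + u) \<partial>gauss \<tau>)
      \<le> (\<integral>\<^sup>+q. indicator (ball (0::complex) \<delta>) q * ennreal (1 / sqrt (2 * pi * \<tau>)) \<partial>lborel)"
    unfolding nn_integral_gauss_occupation by (intro nn_integral_mono mult_left_mono inner) auto
  also have "\<dots> = emeasure lborel (ball (0::complex) \<delta>) * ennreal (1 / sqrt (2 * pi * \<tau>))"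
    by (subst nn_integral_multc) auto
  finally show ?thesis by (simp add: mult.commute)
qed

text \<open>Curve point, position and displacement have modulus at most 1 each, so the squared
  distance is at most 9. With \<open>\<tau> \<ge> 1 / 2\<close> the exponent is at least -9, and
  \<open>\<tau> \<le> 1\<close> bounds the prefactor.\<close>

lemma gauss_occupation_lower:
  assumes \<tau>: "1 / 2 \<le> \<tau>" "\<tau> \<le> 1" and w: "cmod w \<le> 1" and \<delta>: "\<delta> \<le> 1"
  shows "ennreal (exp (-9) / (2 * pi)) * emeasure lborel (ball (0::complex) \<delta>)
    \<le> (\<integral>\<^sup>+u. curve_occupation g \<delta> (w + u) \<partial>gauss \<tau>)"
proof -
  let ?c = "ennreal (exp (-9) / (2 * pi))"
  have inner: "?c \<le> (\<integral>\<^sup>+\<rho>. indicator {0..1} \<rho> * gauss_density \<tau> (curve_point g \<rho> - w + q) \<partial>lborel)"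
    if q: "q \<in> ball 0 \<delta>" for q
  proof -
    have "?c = (\<integral>\<^sup>+\<rho>. indicator {0..1::real} \<rho> * ?c \<partial>lborel)"
      by (subst nn_integral_multc) auto
    also have "\<dots> \<le> (\<integral>\<^sup>+\<rho>. indicator {0..1} \<rho> * gauss_density \<tau> (curve_point g \<rho> - w + q) \<partial>lborel)"
    proof (rule nn_integral_mono)
      fix \<rho> :: real
      show "indicator {0..1} \<rho> * ?c \<le> indicator {0..1} \<rho> * gauss_density \<tau> (curve_point g \<rho> - w + q)"
      proof (cases "\<rho> \<in> {0..1}")
        case True
        have "cmod (curve_point g \<rho> - w + q) \<le> cmod (curve_point g \<rho>) + cmod w + cmod q"
          using norm_triangle_ineq[of "curve_point g \<rho> - w" q] norm_triangle_ineq4[of "curve_point g \<rho>" w] by linarith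
        also have "\<dots> \<le> 3" using norm_curve_point[of \<rho>] True w q \<delta> by simp
        finally have "(cmod (curve_point g \<rho> - w + q))\<^sup>2 \<le> 3\<^sup>2" by (rule power_mono) simp
        moreover have "9 / (2 * \<tau>) \<le> 9" using \<tau> by (simp add: field_simps)
        ultimately have "(cmod (curve_point g \<rho> - w + q))\<^sup>2 / (2 * \<tau>) \<le> 9"
          using \<tau> divide_right_mono[of "(cmod (curve_point g \<rho> - w + q))\<^sup>2" 9 "2 * \<tau>"] by simp
        then have "exp (-9) \<le> exp (- (cmod (curve_point g \<rho> - w + q))\<^sup>2 / (2 * \<tau>))" by simp
        then have "exp (-9) / (2 * pi) \<le> exp (- (cmod (curve_point g \<rho> - w + q))\<^sup>2 / (2 * \<tau>)) / (2 * pi * \<tau>)"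
          using \<tau> by (intro frac_le) auto
        then show ?thesis using True unfolding gauss_density_def by (simp add: ennreal_leI)
      qed simp
    qed
    finally show ?thesis .
  qed
  have "?c * emeasure lborel (ball (0::complex) \<delta>) = (\<integral>\<^sup>+q. indicator (ball (0::complex) \<delta>) q * ?c \<partial>lborel)"
    by (subst nn_integral_multc) (auto simp: mult.commute)
  also have "\<dots> \<le> (\<integral>\<^sup>+u. curve_occupation g \<delta> (w + u) \<partial>gauss \<tau>)"
    unfolding nn_integral_gauss_occupation
  proof (rule nn_integral_mono)
    fix q :: complex
    show "indicator (ball 0 \<delta>) q * ?c \<le> indicator (ball 0 \<delta>) q
        * (\<integral>\<^sup>+\<rho>. indicator {0..1} \<rho> * gauss_density \<tau> (curve_point g \<rho> - w + q) \<partial>lborel)"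
      using inner[of q] by (cases "q \<in> ball 0 \<delta>") auto
  qed
  finally show ?thesis .
qed

end

lemma emeasure_ball_scale:
  "\<delta> > 0 \<Longrightarrow> emeasure lborel (ball (0::complex) \<delta>) = ennreal (\<delta>\<^sup>2) * emeasure lborel (ball (0::complex) 1)"
proof -
  assume \<delta>: "\<delta> > 0"
  have "emeasure lborel (ball (0::complex) \<delta>) = (\<integral>\<^sup>+z. indicator (ball (0::complex) \<delta>) z \<partial>lborel)" by simp
  also have "\<dots> = ennreal ((cmod (of_real \<delta>))\<^sup>2) * (\<integral>\<^sup>+z. indicator (ball (0::complex) \<delta>) (of_real \<delta> * z) \<partial>lborel)"
    by (rule nn_integral_lborel_complex_mult) (use \<delta> in auto)
  also have "(\<lambda>z. indicator (ball (0::complex) \<delta>) (of_real \<delta> * z) :: ennreal) = indicator (ball 0 1)"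
    using \<delta> by (auto simp: indicator_def norm_mult fun_eq_iff)
  finally show ?thesis using \<delta> by simp
qed

text \<open>Each term \<open>1 / sqrt (n + 1)\<close> is at most
  \<open>2 * (sqrt (n + 1) - sqrt n)\<close>, and these differences telescope.\<close>

lemma sum_inverse_sqrt_le: "(\<Sum>i\<in>{1..n}. 1 / sqrt (real i)) \<le> 2 * sqrt (real n)"
proof (induction n)
  case (Suc n)
  have pos: "sqrt (real (Suc n)) + sqrt (real n) > 0" by (simp add: add_pos_nonneg)
  have "(sqrt (real (Suc n)) - sqrt (real n)) * (sqrt (real (Suc n)) + sqrt (real n)) = 1"
    by (simp add: algebra_simps)
  then have "sqrt (real (Suc n)) - sqrt (real n) = 1 / (sqrt (real (Suc n)) + sqrt (real n))"
    using pos by (simp add: eq_divide_eq)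
  moreover have "1 / (2 * sqrt (real (Suc n))) \<le> 1 / (sqrt (real (Suc n)) + sqrt (real n))"
    using pos by (intro divide_left_mono) (auto intro!: mult_pos_pos)
  ultimately have "1 / sqrt (real (Suc n)) \<le> 2 * (sqrt (real (Suc n)) - sqrt (real n))" by simp
  then show ?case using Suc by simp
qed simp

section \<open>Second moment estimate for hitting a curve\<close>

context wiener
begin

lemma AE_start_0: "AE v in W. v 0 = 0"
proof -
  have "AE z in distr W borel (\<lambda>v. v 0). z = 0"
    unfolding brownianD(3)[OF brownian_W] by (subst AE_return) auto
  then show ?thesis by (subst (asm) AE_distr_iff) auto
qed

lemma distr_at_time:
  assumes "t > 0"
  shows "distr W borel (\<lambda>v. v t) = gauss t"
proof -
  have "distr W borel (\<lambda>v. v t) = distr W borel (\<lambda>v. v t - v 0)"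
    by (rule distr_cong_AE) (use AE_start_0 assms in auto)
  also have "\<dots> = gauss t" using brownianD(5)[OF brownian_W, of 0 t] assms by simp
  finally show ?thesis .
qed

lemma nn_integral_markov:
  assumes X: "brownian M \<nu> X" and s: "s \<ge> 0" and F [measurable]: "F \<in> borel_measurable (paths \<Otimes>\<^sub>M paths)"
  shows "(\<integral>\<^sup>+\<omega>. F (stop_path s (X \<omega>), incr_path s (X \<omega>)) \<partial>M) = (\<integral>\<^sup>+\<omega>. (\<integral>\<^sup>+v. F (stop_path s (X \<omega>), v) \<partial>W) \<partial>M)"
proof -
  interpret M: prob_space M using brownianD(1)[OF X] .
  note X_meas [measurable] = brownianD(2)[OF X]
  have Y [measurable]: "(\<lambda>\<omega>. stop_path s (X \<omega>)) \<in> M \<rightarrow>\<^sub>M paths"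
    and V [measurable]: "(\<lambda>\<omega>. incr_path s (X \<omega>)) \<in> M \<rightarrow>\<^sub>M paths"
    using s by (auto intro!: measurable_stop_path[OF X_meas] measurable_incr_path[OF X_meas])
  have "(\<integral>\<^sup>+\<omega>. F (stop_path s (X \<omega>), incr_path s (X \<omega>)) \<partial>M)
      = (\<integral>\<^sup>+p. F p \<partial>distr M (paths \<Otimes>\<^sub>M paths) (\<lambda>\<omega>. (stop_path s (X \<omega>), incr_path s (X \<omega>))))"
    by (subst nn_integral_distr) auto
  also have "distr M (paths \<Otimes>\<^sub>M paths) (\<lambda>\<omega>. (stop_path s (X \<omega>), incr_path s (X \<omega>))) = distr M paths (\<lambda>\<omega>. stop_path s (X \<omega>)) \<Otimes>\<^sub>M W"
    using brownian_markov[OF X s] by (simp add: M.indep_var_distribution_eq distr_incr_path[OF X s])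
  also have "(\<integral>\<^sup>+p. F p \<partial>(distr M paths (\<lambda>\<omega>. stop_path s (X \<omega>)) \<Otimes>\<^sub>M W))
      = (\<integral>\<^sup>+y. (\<integral>\<^sup>+v. F (y, v) \<partial>W) \<partial>distr M paths (\<lambda>\<omega>. stop_path s (X \<omega>)))"
    by (rule W.nn_integral_fst[symmetric]) measurable
  also have "\<dots> = (\<integral>\<^sup>+\<omega>. (\<integral>\<^sup>+v. F (stop_path s (X \<omega>), v) \<partial>W) \<partial>M)"
    by (subst nn_integral_distr) auto
  finally show ?thesis .
qed

definition reaches :: "complex set \<Rightarrow> real \<Rightarrow> complex \<Rightarrow> (real \<Rightarrow> complex) \<Rightarrow> bool" where
  "reaches K h z v \<longleftrightarrow> (\<exists>t\<in>{0..h}. z + v t \<in> K)"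

lemma reaches_iff_infdist:
  assumes "closed K" "K \<noteq> {}" "h \<ge> 0"
  shows "reaches K h z v \<longleftrightarrow> (\<exists>u\<in>{0..1}. infdist (z + v (u * h)) K \<le> 0)"
proof -
  have "infdist w K \<le> 0 \<longleftrightarrow> w \<in> K" for w
    using in_closed_iff_infdist_zero[OF assms(1,2), of w] infdist_nonneg[of w K] by auto
  then show ?thesis
    unfolding reaches_def unit_interval_mult_image[OF assms(3)] by auto
qed

lemma pred_near_reach:
  assumes K: "K \<noteq> {}" and h: "h \<ge> 0"
  shows "Measurable.pred (borel \<Otimes>\<^sub>M paths) (\<lambda>p. \<exists>u\<in>{0..1}. infdist (fst p + snd p (u * h)) K - \<delta> \<le> 0)"
proof (rule pred_ex_closed_time)
  show "continuous_on {0..1} (\<lambda>u. infdist (fst p + snd p (u * h)) K - \<delta>)"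
    if "p \<in> space (borel \<Otimes>\<^sub>M paths)" for p
  proof -
    have "continuous_on {0..} (snd p)" using that by (auto simp: space_pair_measure path_set_def)
    then have "continuous_on {0..1} (\<lambda>u. snd p (u * h))"
      by (rule continuous_on_compose2) (use h in \<open>auto intro!: continuous_intros\<close>)
    then show ?thesis by (intro continuous_intros)
  qed
  show "(\<lambda>p. infdist (fst p + snd p (u * h)) K - \<delta>) \<in> borel_measurable (borel \<Otimes>\<^sub>M paths)"
    if "u \<in> {0..1}" for u
  proof -
    have [measurable]: "(\<lambda>p. snd p (u * h)) \<in> borel_measurable (borel \<Otimes>\<^sub>M paths)"
      by (rule measurable_path_at[OF measurable_snd]) (use that h in auto)
    have [measurable]: "(\<lambda>w. infdist w K) \<in> borel_measurable borel"
      by (intro borel_measurable_continuous_onI continuous_intros)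
    show ?thesis by measurable
  qed
qed

lemma pred_reaches:
  assumes "closed K" "K \<noteq> {}" "h \<ge> 0"
  shows "Measurable.pred (borel \<Otimes>\<^sub>M paths) (\<lambda>p. reaches K h (fst p) (snd p))"
  using pred_near_reach[OF assms(2,3), of 0] by (simp add: reaches_iff_infdist[OF assms])

lemma pred_reaches_compose:
  assumes K: "closed K" "K \<noteq> {}" "h \<ge> 0" and [measurable]: "Z \<in> borel_measurable M" "X \<in> M \<rightarrow>\<^sub>M paths"
  shows "Measurable.pred M (\<lambda>\<omega>. reaches K h (Z \<omega>) (X \<omega>))"
  using measurable_compose[OF _ pred_reaches[OF K], of "\<lambda>\<omega>. (Z \<omega>, X \<omega>)" M] by simp

text \<open>With \<open>V\<close> the area of the unit disc, this is the lower bound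
  \<open>\<delta> * V * exp (-9) / (4 * pi)\<close> of the first moment divided by the factor
  \<open>\<delta> * (2 + 2 * V)\<close> by which the second moment exceeds the first at most; the
  scale \<open>\<delta>\<close> cancels.\<close>

definition reach_const :: real where
  "reach_const = (let V = measure lborel (ball (0::complex) 1) in V * exp (-9) / (4 * pi * (2 + 2 * V)))"

lemma reach_const_pos: "reach_const > 0"
proof -
  have "measure lborel (ball (0::complex) 1) \<noteq> 0"
    using emeasure_disc_measure_pos[of 1] emeasure_lborel_ball_finite[of "0::complex" 1]
    by (simp add: emeasure_disc_measure measure_def enn2real_eq_0_iff)
  then have "measure lborel (ball (0::complex) 1) > 0"
    using measure_nonneg[of lborel "ball (0::complex) 1"] by linarith
  then show ?thesis
    unfolding reach_const_def Let_def by (intro divide_pos_pos mult_pos_pos add_pos_pos) auto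
qed

text \<open>Second moment method for the occupation of the \<open>1/n\<close>-neighbourhood of the curve at the
  times \<open>k/n\<close>.\<close>

lemma reach_curve_neighbourhood:
  assumes "unit_curve g" and z: "cmod z \<le> 1" and n: "n \<ge> (1::nat)"
  shows "ennreal reach_const
    \<le> emeasure W {v \<in> path_set. \<exists>u\<in>{0..1}. infdist (z + v (u * 1)) (curve_until 1 g) - 1 / real n \<le> 0}"
    (is "_ \<le> emeasure W ?H")
proof -
  interpret unit_curve g by fact
  define \<delta> where "\<delta> = 1 / real n"
  have \<delta>: "\<delta> > 0" "\<delta> \<le> 1" "real n * \<delta> = 1" using n by (auto simp: \<delta>_def)
  define V where "V = measure lborel (ball (0::complex) 1)"
  have V: "emeasure lborel (ball (0::complex) 1) = ennreal V" "V \<ge> 0"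
    unfolding V_def using emeasure_lborel_ball_finite[of "0::complex" 1]
    by (auto simp: emeasure_eq_ennreal_measure)
  have V\<delta>: "emeasure lborel (ball (0::complex) \<delta>) = ennreal (\<delta>\<^sup>2 * V)"
    using emeasure_ball_scale[OF \<delta>(1)] V by (simp add: ennreal_mult'')
  let ?\<phi> = "curve_occupation g \<delta>"
  define t where "t k = real k / real n" for k
  have t: "t k > 0" if "k \<ge> 1" for k using that n by (simp add: t_def)
  have t0: "t k \<ge> 0" for k by (simp add: t_def)
  have [measurable]: "(\<lambda>v. v (t k)) \<in> borel_measurable paths" for k
    by (rule measurable_eval_path[OF t0])
  define Z where "Z v = (\<Sum>k\<in>{1..n}. ?\<phi> (z + v (t k)))" for v
  have Z [measurable]: "Z \<in> borel_measurable paths" unfolding Z_def by measurable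
  define e where "e k = (\<integral>\<^sup>+v. ?\<phi> (z + v (t k)) \<partial>W)" for k
  have e_gauss: "e k = (\<integral>\<^sup>+u. ?\<phi> (z + u) \<partial>gauss (t k))" if "k \<ge> 1" for k
    unfolding e_def distr_at_time[OF t[OF that], symmetric] by (subst nn_integral_distr) auto
  have EZ: "(\<integral>\<^sup>+v. Z v \<partial>W) = (\<Sum>k\<in>{1..n}. e k)"
    unfolding Z_def e_def by (rule nn_integral_sum) measurable
  have EZ_lower: "ennreal (\<delta> * V * exp (-9) / (4 * pi)) \<le> (\<integral>\<^sup>+v. Z v \<partial>W)"
  proof -
    \<comment> \<open>At least half of the times \<open>k / n\<close> lie in
      \<open>{1/2..1}\<close>, where the Gaussian lower bound applies.\<close>
    define I where "I = {k \<in> {1..n}. n \<le> 2 * k}"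
    have "card I * 2 \<ge> n"
    proof -
      have "{n - n div 2..n} \<subseteq> I" using n by (auto simp: I_def)
      then have "card {n - n div 2..n} \<le> card I" by (intro card_mono) (auto simp: I_def)
      then show ?thesis by simp
    qed
    then have card: "real n / 2 \<le> real (card I)" by linarith
    have "ennreal (\<delta> * V * exp (-9) / (4 * pi)) \<le> ennreal (real (card I) * (exp (-9) / (2 * pi) * (\<delta>\<^sup>2 * V)))"
    proof (rule ennreal_leI)
      have "\<delta> * V * exp (-9) / (4 * pi) = (real n / 2) * (exp (-9) / (2 * pi) * (\<delta>\<^sup>2 * V))"
        using \<delta>(3) by (simp add: power2_eq_square field_simps)
      also have "\<dots> \<le> real (card I) * (exp (-9) / (2 * pi) * (\<delta>\<^sup>2 * V))"
        using V(2) by (intro mult_right_mono card) auto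
      finally show "\<delta> * V * exp (-9) / (4 * pi) \<le> real (card I) * (exp (-9) / (2 * pi) * (\<delta>\<^sup>2 * V))" .
    qed
    also have "\<dots> = (\<Sum>k\<in>I. ennreal (exp (-9) / (2 * pi)) * emeasure lborel (ball (0::complex) \<delta>))"
    proof -
      have "ennreal (exp (-9) / (2 * pi)) * ennreal (\<delta>\<^sup>2 * V) = ennreal (exp (-9) / (2 * pi) * (\<delta>\<^sup>2 * V))"
        by (rule ennreal_mult[symmetric]) (use V(2) in auto)
      then show ?thesis
        unfolding V\<delta> sum_constant ennreal_of_nat_eq_real_of_nat
        by (simp only:) (rule ennreal_mult, use V(2) in auto)
    qed
    also have "\<dots> \<le> (\<Sum>k\<in>I. e k)"
    proof (rule sum_mono)
      fix k assume k: "k \<in> I"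
      then have "1 / 2 \<le> t k" "t k \<le> 1" using n by (auto simp: I_def t_def field_simps)
      then show "ennreal (exp (-9) / (2 * pi)) * emeasure lborel (ball (0::complex) \<delta>) \<le> e k"
        using gauss_occupation_lower[OF _ _ z \<delta>(2)] k by (simp add: e_gauss I_def)
    qed
    also have "\<dots> \<le> (\<Sum>k\<in>{1..n}. e k)" by (rule sum_mono2) (auto simp: I_def)
    finally show ?thesis by (simp add: EZ)
  qed
  \<comment> \<open>\<open>a i\<close> bounds the expected occupation after a time step of length
    \<open>t i\<close>, from every starting position.\<close>
  define a where "a i = ennreal (1 / sqrt (2 * pi * t i) * (\<delta>\<^sup>2 * V))" for i
  have cross: "(\<integral>\<^sup>+v. ?\<phi> (z + v (t j)) * ?\<phi> (z + v (t k)) \<partial>W) \<le> e j * a (k - j)"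
    if jk: "1 \<le> j" "j < k" for j k
  proof -
    have tkj: "t k = t j + t (k - j)" using jk by (simp add: t_def add_divide_distrib[symmetric])
    have pos: "t (k - j) > 0" using jk by (intro t) simp
    \<comment> \<open>By the Markov property at \<open>t j\<close>, the occupation at the later time
      is averaged over an independent increment of duration \<open>t (k - j)\<close>.\<close>
    let ?F = "\<lambda>p. ?\<phi> (z + fst p (t j)) * ?\<phi> (z + fst p (t j) + snd p (t (k - j)))"
    have [measurable]: "(\<lambda>p. fst p (t j)) \<in> borel_measurable (paths \<Otimes>\<^sub>M paths)"
      "(\<lambda>p. snd p (t (k - j))) \<in> borel_measurable (paths \<Otimes>\<^sub>M paths)"
      by (auto intro!: measurable_path_at t0)
    have "(\<integral>\<^sup>+v. ?\<phi> (z + v (t j)) * ?\<phi> (z + v (t k)) \<partial>W) = (\<integral>\<^sup>+v. ?F (stop_path (t j) v, incr_path (t j) v) \<partial>W)"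
      by (simp add: stop_path_def incr_path_def tkj)
    also have "\<dots> = (\<integral>\<^sup>+v. (\<integral>\<^sup>+b. ?F (stop_path (t j) v, b) \<partial>W) \<partial>W)"
      by (rule nn_integral_markov[OF brownian_W t0]) measurable
    also have "\<dots> \<le> (\<integral>\<^sup>+v. ?\<phi> (z + v (t j)) * a (k - j) \<partial>W)"
    proof (rule nn_integral_mono)
      fix v
      have "(\<integral>\<^sup>+b. ?F (stop_path (t j) v, b) \<partial>W) = ?\<phi> (z + v (t j)) * (\<integral>\<^sup>+b. ?\<phi> (z + v (t j) + b (t (k - j))) \<partial>W)"
        by (simp add: stop_path_def nn_integral_cmult)
      also have "(\<integral>\<^sup>+b. ?\<phi> (z + v (t j) + b (t (k - j))) \<partial>W) = (\<integral>\<^sup>+u. ?\<phi> (z + v (t j) + u) \<partial>gauss (t (k - j)))"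
        unfolding distr_at_time[OF pos, symmetric] by (subst nn_integral_distr) auto
      also have "\<dots> \<le> a (k - j)"
      proof -
        have "ennreal (1 / sqrt (2 * pi * t (k - j))) * ennreal (\<delta>\<^sup>2 * V) = a (k - j)"
          unfolding a_def by (rule ennreal_mult[symmetric]) (use V(2) pos in auto)
        then show ?thesis
          using gauss_occupation_upper[OF pos, of \<delta> "z + v (t j)"] unfolding V\<delta> by (simp only:)
      qed
      finally show "(\<integral>\<^sup>+b. ?F (stop_path (t j) v, b) \<partial>W) \<le> ?\<phi> (z + v (t j)) * a (k - j)"
        by (simp add: mult_left_mono)
    qed
    also have "\<dots> = e j * a (k - j)" unfolding e_def by (rule nn_integral_multc) measurable
    finally show ?thesis .
  qed
  define S where "S = (\<Sum>i\<in>{1..n}. a i)"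
  have S_le: "S \<le> ennreal (\<delta> * V)"
  proof -
    have "S = ennreal (\<Sum>i\<in>{1..n}. 1 / sqrt (2 * pi * t i) * (\<delta>\<^sup>2 * V))"
      unfolding S_def a_def using V(2) t0 by (intro sum_ennreal) auto
    also have "\<dots> \<le> ennreal (\<delta> * V)"
    proof (rule ennreal_leI)
      \<comment> \<open>The inequality \<open>2 \<le> sqrt (2 * pi)\<close> cancels the 2 in
        \<open>sum_inverse_sqrt_le\<close>, so that these terms sum to at most
        \<open>n\<close>.\<close>
      have "1 / sqrt (2 * pi * t i) \<le> sqrt (real n) * (1 / sqrt (real i)) / 2" if "i \<in> {1..n}" for i
      proof -
        have "sqrt (2 * pi * t i) = sqrt (2 * pi) * (sqrt (real i) / sqrt (real n))"
          by (simp add: t_def real_sqrt_mult real_sqrt_divide)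
        moreover have "2 \<le> sqrt (2 * pi)" using pi_gt3 by (intro real_le_rsqrt) auto
        moreover have p: "sqrt (real i) / sqrt (real n) > 0" using that n by simp
        ultimately have "2 * (sqrt (real i) / sqrt (real n)) \<le> sqrt (2 * pi * t i)"
          by (simp only:) (rule mult_right_mono, auto)
        then have "1 / sqrt (2 * pi * t i) \<le> 1 / (2 * (sqrt (real i) / sqrt (real n)))"
          using p by (intro divide_left_mono mult_pos_pos) linarith+
        then show ?thesis by simp
      qed
      then have "(\<Sum>i\<in>{1..n}. 1 / sqrt (2 * pi * t i)) \<le> (\<Sum>i\<in>{1..n}. sqrt (real n) / 2 * (1 / sqrt (real i)))"
        by (intro sum_mono) (simp add: mult.commute)
      also have "\<dots> = sqrt (real n) / 2 * (\<Sum>i\<in>{1..n}. 1 / sqrt (real i))" by (rule sum_distrib_left[symmetric])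
      also have "\<dots> \<le> sqrt (real n) / 2 * (2 * sqrt (real n))"
        by (intro mult_left_mono sum_inverse_sqrt_le) simp
      also have "\<dots> = real n" by simp
      finally have "(\<Sum>i\<in>{1..n}. 1 / sqrt (2 * pi * t i)) * (\<delta>\<^sup>2 * V) \<le> real n * (\<delta>\<^sup>2 * V)"
        using V(2) by (intro mult_right_mono) auto
      also have "\<dots> = \<delta> * V" using \<delta>(3) by (simp add: power2_eq_square mult.assoc[symmetric])
      finally show "(\<Sum>i\<in>{1..n}. 1 / sqrt (2 * pi * t i) * (\<delta>\<^sup>2 * V)) \<le> \<delta> * V"
        by (simp add: sum_distrib_right)
    qed
    finally show ?thesis .
  qed
  \<comment> \<open>Relative to the first moment, the diagonal contributes
    \<open>2 * \<delta>\<close>, and the pairs \<open>j < k\<close> and \<open>k < j\<close> at most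
    \<open>\<delta> * V\<close> each.\<close>
  define m where "m = \<delta> * (2 + 2 * V)"
  have Z_square: "(\<integral>\<^sup>+v. Z v ^ 2 \<partial>W) \<le> (\<integral>\<^sup>+v. Z v \<partial>W) * ennreal m"
  proof -
    have diag: "(\<integral>\<^sup>+v. ?\<phi> (z + v (t j)) * ?\<phi> (z + v (t j)) \<partial>W) \<le> e j * ennreal (2 * \<delta>)" for j
    proof -
      have "(\<integral>\<^sup>+v. ?\<phi> (z + v (t j)) * ?\<phi> (z + v (t j)) \<partial>W) \<le> (\<integral>\<^sup>+v. ?\<phi> (z + v (t j)) * ennreal (2 * \<delta>) \<partial>W)"
        by (intro nn_integral_mono mult_left_mono curve_occupation_le \<delta>) simp
      also have "\<dots> = e j * ennreal (2 * \<delta>)" unfolding e_def by (rule nn_integral_multc) measurable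
      finally show ?thesis .
    qed
    let ?x = "\<lambda>j k. (\<integral>\<^sup>+v. ?\<phi> (z + v (t j)) * ?\<phi> (z + v (t k)) \<partial>W)"
    have sym: "?x j k = ?x k j" for j k by (simp add: mult.commute)
    have row: "(\<Sum>k\<in>{j<..n}. ?x j k) \<le> e j * S" if j: "j \<in> {1..n}" for j
    proof -
      have "(\<Sum>k\<in>{j<..n}. ?x j k) \<le> (\<Sum>k\<in>{j<..n}. e j * a (k - j))"
        using j by (intro sum_mono cross) auto
      also have "\<dots> = e j * (\<Sum>k\<in>{j<..n}. a (k - j))" by (rule sum_distrib_left[symmetric])
      also have "(\<Sum>k\<in>{j<..n}. a (k - j)) = (\<Sum>i\<in>{1..n - j}. a i)"
        by (rule sum.reindex_bij_witness[of _ "\<lambda>i. i + j" "\<lambda>k. k - j"]) auto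
      also have "\<dots> \<le> S" unfolding S_def by (rule sum_mono2) auto
      finally show ?thesis by (simp add: mult_left_mono)
    qed
    have "(\<integral>\<^sup>+v. Z v ^ 2 \<partial>W) = (\<Sum>j\<in>{1..n}. \<Sum>k\<in>{1..n}. ?x j k)"
      unfolding Z_def power2_eq_square sum_product
      by (subst nn_integral_sum, measurable, intro sum.cong refl, rule nn_integral_sum, measurable)
    also have "\<dots> = (\<Sum>j\<in>{1..n}. ?x j j) + (\<Sum>j\<in>{1..n}. \<Sum>k\<in>{j<..n}. ?x j k) + (\<Sum>j\<in>{1..n}. \<Sum>k\<in>{1..<j}. ?x j k)"
    proof -
      have "(\<Sum>k\<in>{1..n}. ?x j k) = ?x j j + (\<Sum>k\<in>{j<..n}. ?x j k) + (\<Sum>k\<in>{1..<j}. ?x j k)" if "j \<in> {1..n}" for j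
      proof -
        have "{1..n} = insert j ({j<..n} \<union> {1..<j})" using that by auto
        then have "(\<Sum>k\<in>{1..n}. ?x j k) = ?x j j + (\<Sum>k\<in>{j<..n} \<union> {1..<j}. ?x j k)"
          by (simp only:) (subst sum.insert, auto)
        also have "(\<Sum>k\<in>{j<..n} \<union> {1..<j}. ?x j k) = (\<Sum>k\<in>{j<..n}. ?x j k) + (\<Sum>k\<in>{1..<j}. ?x j k)"
          by (rule sum.union_disjoint) auto
        finally show ?thesis by (simp add: add.assoc)
      qed
      then show ?thesis by (simp add: sum.distrib)
    qed
    also have "(\<Sum>j\<in>{1..n}. \<Sum>k\<in>{1..<j}. ?x j k) = (\<Sum>k\<in>{1..n}. \<Sum>j\<in>{k<..n}. ?x j k)"
    proof -
      have "(\<Sum>j\<in>{1..n}. \<Sum>k\<in>{1..<j}. ?x j k) = (\<Sum>j\<in>{1..n}. \<Sum>k\<in>{k \<in> {1..n}. k < j}. ?x j k)"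
        by (intro sum.cong refl) auto
      also have "\<dots> = (\<Sum>k\<in>{1..n}. \<Sum>j\<in>{j \<in> {1..n}. k < j}. ?x j k)"
        by (rule sum.swap_restrict) auto
      also have "\<dots> = (\<Sum>k\<in>{1..n}. \<Sum>j\<in>{k<..n}. ?x j k)"
        by (intro sum.cong refl) auto
      finally show ?thesis .
    qed
    also have "\<dots> = (\<Sum>j\<in>{1..n}. \<Sum>k\<in>{j<..n}. ?x j k)" by (simp only: sym)
    also have "(\<Sum>j\<in>{1..n}. ?x j j) + (\<Sum>j\<in>{1..n}. \<Sum>k\<in>{j<..n}. ?x j k) + (\<Sum>j\<in>{1..n}. \<Sum>k\<in>{j<..n}. ?x j k)
        \<le> (\<Sum>j\<in>{1..n}. e j * ennreal (2 * \<delta>)) + (\<Sum>j\<in>{1..n}. e j * S) + (\<Sum>j\<in>{1..n}. e j * S)"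
      by (intro add_mono sum_mono diag row)
    also have "\<dots> = (\<integral>\<^sup>+v. Z v \<partial>W) * (ennreal (2 * \<delta>) + S + S)"
      unfolding EZ by (simp add: sum_distrib_right[symmetric] distrib_left)
    also have "\<dots> \<le> (\<integral>\<^sup>+v. Z v \<partial>W) * ennreal m"
    proof (rule mult_left_mono)
      have "ennreal (2 * \<delta>) + S + S \<le> ennreal (2 * \<delta>) + ennreal (\<delta> * V) + ennreal (\<delta> * V)"
        by (intro add_mono S_le order_refl)
      also have "\<dots> = ennreal m" unfolding m_def using \<delta> V(2) by (simp add: ennreal_plus[symmetric] distrib_left del: ennreal_plus)
      finally show "ennreal (2 * \<delta>) + S + S \<le> ennreal m" .
    qed simp
    finally show ?thesis .
  qed
  \<comment> \<open>Cauchy-Schwarz for \<open>Z\<close> and the indicator of this event: the squared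
    mean is at most the second moment times the probability that \<open>Z\<close> does not
    vanish.\<close>
  let ?P = "{v \<in> path_set. Z v \<noteq> 0}"
  have P [measurable]: "?P \<in> sets paths"
  proof -
    have "{v \<in> space paths. Z v \<noteq> 0} \<in> sets paths" by measurable
    then show ?thesis by simp
  qed
  have "(\<integral>\<^sup>+v. Z v \<partial>W)\<^sup>2 = (\<integral>\<^sup>+v. Z v * indicator ?P v \<partial>W)\<^sup>2"
    by (intro arg_cong[where f="\<lambda>x. x\<^sup>2"] nn_integral_cong) (auto simp: indicator_def)
  also have "\<dots> \<le> (\<integral>\<^sup>+v. Z v ^ 2 \<partial>W) * (\<integral>\<^sup>+v. indicator ?P v ^ 2 \<partial>W)"
    by (rule Cauchy_Schwarz_nn_integral) measurable
  also have "(\<integral>\<^sup>+v. indicator ?P v ^ 2 \<partial>W) = (\<integral>\<^sup>+v. indicator ?P v \<partial>W)"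
    by (intro nn_integral_cong) (auto simp: indicator_def)
  also have "\<dots> = emeasure W ?P" by (rule nn_integral_indicator) simp
  also have "(\<integral>\<^sup>+v. Z v ^ 2 \<partial>W) * emeasure W ?P \<le> (\<integral>\<^sup>+v. Z v \<partial>W) * ennreal m * emeasure W ?P"
    by (intro mult_right_mono Z_square) simp
  finally have cs: "(\<integral>\<^sup>+v. Z v \<partial>W) * (\<integral>\<^sup>+v. Z v \<partial>W) \<le> (\<integral>\<^sup>+v. Z v \<partial>W) * (ennreal m * emeasure W ?P)"
    by (simp add: power2_eq_square mult.assoc)
  have V0: "V > 0"
    using reach_const_pos V(2) unfolding reach_const_def Let_def V_def[symmetric] by (cases "V = 0") auto
  \<comment> \<open>Cancelling one factor of the first moment in \<open>cs\<close> requires that it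
    be neither 0 nor infinite.\<close>
  have EZ0: "(\<integral>\<^sup>+v. Z v \<partial>W) \<noteq> 0"
  proof -
    have "0 < ennreal (\<delta> * V * exp (-9) / (4 * pi))" using \<delta> V0 by simp
    then show ?thesis using EZ_lower by (metis leD)
  qed
  have EZ_fin: "(\<integral>\<^sup>+v. Z v \<partial>W) \<noteq> \<infinity>"
  proof -
    have "(\<integral>\<^sup>+v. Z v \<partial>W) \<le> (\<integral>\<^sup>+v. (\<Sum>k\<in>{1..n}. ennreal (2 * \<delta>)) \<partial>W)"
      unfolding Z_def by (intro nn_integral_mono sum_mono curve_occupation_le \<delta>)
    also have "\<dots> = of_nat n * ennreal (2 * \<delta>)" using W.emeasure_space_1 by simp
    also have "\<dots> < \<infinity>" by (simp add: ennreal_mult_less_top of_nat_less_top)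
    finally show ?thesis by simp
  qed
  have "(\<integral>\<^sup>+v. Z v \<partial>W) \<le> ennreal m * emeasure W ?P"
    using cs EZ0 EZ_fin by (subst (asm) ennreal_mult_le_mult_iff) auto
  with EZ_lower have "ennreal (\<delta> * V * exp (-9) / (4 * pi)) \<le> ennreal m * emeasure W ?P" by (rule order_trans)
  also have "\<dots> = ennreal (m * measure W ?P)"
    using \<delta> V(2) by (simp add: W.emeasure_eq_measure ennreal_mult m_def)
  finally have "\<delta> * V * exp (-9) / (4 * pi) \<le> m * measure W ?P"
    using \<delta> V(2) by (subst (asm) ennreal_le_iff) (auto simp: m_def)
  then have "\<delta> * (V * exp (-9) / (4 * pi)) \<le> \<delta> * ((2 + 2 * V) * measure W ?P)"
    unfolding m_def by (simp only: mult.assoc times_divide_eq_right)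
  then have "V * exp (-9) / (4 * pi) \<le> (2 + 2 * V) * measure W ?P"
    using \<delta>(1) by (rule mult_left_le_imp_le)
  then have "V * exp (-9) / (4 * pi) / (2 + 2 * V) \<le> measure W ?P"
    using V(2) by (subst pos_divide_le_eq) (auto simp: mult.commute)
  then have "reach_const \<le> measure W ?P"
    unfolding reach_const_def Let_def V_def[symmetric] by simp
  then have "ennreal reach_const \<le> emeasure W ?P"
    unfolding W.emeasure_eq_measure by (rule ennreal_leI)
  also have "\<dots> \<le> emeasure W ?H"
  proof (rule emeasure_mono)
    show "?P \<subseteq> ?H"
    proof
      fix v assume v: "v \<in> ?P"
      then obtain k where k: "k \<in> {1..n}" "?\<phi> (z + v (t k)) \<noteq> 0" unfolding Z_def by (auto dest: sum.neutral[rotated])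
      have "\<exists>\<rho>. cmod (z + v (t k) - curve_point g \<rho>) < \<delta>"
      proof (rule ccontr)
        assume "\<not> ?thesis"
        then have "?\<phi> (z + v (t k)) = (\<integral>\<^sup>+\<rho>. 0 \<partial>(lborel :: real measure))"
          unfolding curve_occupation_def by (intro nn_integral_cong) (auto simp: indicator_def)
        then show False using k by simp
      qed
      then obtain \<rho> where "cmod (z + v (t k) - curve_point g \<rho>) < \<delta>" by auto
      then have "infdist (z + v (t k)) (curve_until 1 g) \<le> \<delta>"
        using infdist_le[OF curve_point_in[of \<rho>], of "z + v (t k)"] by (simp add: dist_norm)
      moreover have "t k \<in> {0..1}" using k n by (auto simp: t_def)
      ultimately show "v \<in> ?H" using v by (auto simp: \<delta>_def intro!: bexI[of _ "t k"])
    qed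
    have "Measurable.pred paths (\<lambda>v. \<exists>u\<in>{0..1}. infdist (z + v (u * 1)) (curve_until 1 g) - 1 / real n \<le> 0)"
      using measurable_compose[OF _ pred_near_reach[OF curve_until_nonempty, of 1], of "\<lambda>v. (z, v)" paths] by simp
    then show "?H \<in> sets W" by (simp add: pred_def)
  qed
  finally show ?thesis .
qed

end

section \<open>From a positive chance to hitting with high probability\<close>

context wiener
begin

lemma sets_not_reaches [measurable]:
  assumes "closed K" "K \<noteq> {}" "h \<ge> 0"
  shows "{v \<in> path_set. \<not> reaches K h z v} \<in> sets paths" "{v \<in> path_set. reaches K h z v} \<in> sets paths"
proof -
  have "Measurable.pred paths (\<lambda>v. reaches K h z v)"
    by (rule pred_reaches_compose[OF assms]) auto
  then show r: "{v \<in> path_set. reaches K h z v} \<in> sets paths" by (simp add: pred_def)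
  have "{v \<in> path_set. \<not> reaches K h z v} = space paths - {v \<in> path_set. reaches K h z v}" by auto
  then show "{v \<in> path_set. \<not> reaches K h z v} \<in> sets paths" using sets.Diff[OF sets.top r] by (simp only:)
qed

text \<open>The bound for the neighbourhoods does not depend on \<open>n\<close>. The events
  decrease, and by continuity of the path and closedness of the curve their intersection is actual
  contact.\<close>

lemma reach_unit_curve:
  assumes g: "unit_curve g" and z: "cmod z \<le> 1"
  shows "reach_const \<le> measure W {v \<in> path_set. reaches (curve_until 1 g) 1 z v}"
proof -
  interpret unit_curve g by fact
  let ?K = "curve_until 1 g"
  have K: "closed ?K" "?K \<noteq> {}" using compact_curve_until[OF g] curve_until_nonempty by (auto intro: compact_imp_closed)
  define H where "H n = {v \<in> path_set. \<exists>u\<in>{0..1}. infdist (z + v (u * 1)) ?K - 1 / real (Suc n) \<le> 0}" for n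
  have H: "H n \<in> sets W" for n
  proof -
    have "Measurable.pred paths (\<lambda>v. \<exists>u\<in>{0..1}. infdist (z + v (u * 1)) ?K - 1 / real (Suc n) \<le> 0)"
      using measurable_compose[OF _ pred_near_reach[OF K(2), of 1], of "\<lambda>v. (z, v)" paths] by simp
    then show ?thesis by (simp add: pred_def H_def)
  qed
  have dec: "decseq H"
  proof (rule decseq_SucI)
    fix n
    have "1 / real (Suc (Suc n)) \<le> 1 / real (Suc n)" by (simp add: field_simps)
    then have "x - 1 / real (Suc (Suc n)) \<le> 0 \<Longrightarrow> x - 1 / real (Suc n) \<le> 0" for x by linarith
    then show "H (Suc n) \<subseteq> H n" unfolding H_def by blast
  qed
  have "(\<Inter>n. H n) = {v \<in> path_set. reaches ?K 1 z v}"
  proof (intro set_eqI iffI)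
    fix v assume v: "v \<in> (\<Inter>n. H n)"
    then have vp: "v \<in> path_set" by (auto simp: H_def)
    then have "continuous_on {0..1} v" by (auto simp: path_set_def intro: continuous_on_subset)
    then have "continuous_on {0..1} (\<lambda>u. infdist (z + v (u * 1)) ?K)" by (intro continuous_intros) simp
    then obtain u where u: "u \<in> {0..1}" "\<And>w. w \<in> {0..1} \<Longrightarrow> infdist (z + v (u * 1)) ?K \<le> infdist (z + v (w * 1)) ?K"
      using continuous_attains_inf[of "{0..1::real}" "\<lambda>u. infdist (z + v (u * 1)) ?K"] by auto
    have "infdist (z + v (u * 1)) ?K \<le> 1 / real (Suc n)" for n
    proof -
      obtain w where "w \<in> {0..1}" "infdist (z + v (w * 1)) ?K - 1 / real (Suc n) \<le> 0"
      proof -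
        have "v \<in> H n" using v by blast
        then show ?thesis using that unfolding H_def by blast
      qed
      then show ?thesis using u(2)[of w] by simp
    qed
    then have "infdist (z + v (u * 1)) ?K \<le> 0"
      by (intro LIMSEQ_le_const[OF LIMSEQ_inverse_real_of_nat]) (auto simp: inverse_eq_divide)
    then show "v \<in> {v \<in> path_set. reaches ?K 1 z v}"
      using vp u(1) reaches_iff_infdist[OF K, of 1 z v] by auto
  next
    fix v assume "v \<in> {v \<in> path_set. reaches ?K 1 z v}"
    then have v: "v \<in> path_set" "\<exists>u\<in>{0..1}. infdist (z + v (u * 1)) ?K \<le> 0"
      using reaches_iff_infdist[OF K, of 1 z v] by auto
    then obtain u where "u \<in> {0..1}" "infdist (z + v (u * 1)) ?K \<le> 0" by blast
    then have "infdist (z + v (u * 1)) ?K - 1 / real (Suc n) \<le> 0" for n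
      by (smt (verit) of_nat_0_le_iff zero_le_divide_1_iff)
    then show "v \<in> (\<Inter>n. H n)" using v(1) \<open>u \<in> {0..1}\<close> unfolding H_def by blast
  qed
  moreover have "(\<lambda>n. measure W (H n)) \<longlonglongrightarrow> measure W (\<Inter>n. H n)"
    by (rule W.finite_Lim_measure_decseq[OF _ dec]) (use H in auto)
  moreover have "reach_const \<le> measure W (H n)" for n
    using reach_curve_neighbourhood[OF assms(1) z, of "Suc n"] reach_const_pos
    unfolding H_def W.emeasure_eq_measure by (simp add: measure_nonneg)
  ultimately show ?thesis
    by (metis LIMSEQ_le_const)
qed

lemma W_scale: "r > 0 \<Longrightarrow> distr W paths (scale_path r) = W"
  using distr_Px_scale[of 0 r] by (simp add: Px_0)

text \<open>Scaling by \<open>r\<close> preserves \<open>W\<close>, so the piece of the curve up to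
  radius \<open>r\<close>, seen from distance at most \<open>r\<close> during time
  \<open>r\<^sup>2\<close>, is hit with the same constant at every scale.\<close>

lemma reach_curve_scaled:
  assumes gp: "g \<in> path_set" "g 0 = 0" "hits r0 g" and r: "0 < r" "r \<le> r0" "r\<^sup>2 \<le> h" and z: "cmod z \<le> r"
  shows "reach_const \<le> measure W {v \<in> path_set. reaches (curve_until r0 g) h z v}"
proof -
  define g' where "g' u = g u / of_real r" for u
  have hr: "hits r g" using hits_mono[OF gp(3) r(2)] .
  have iff: "cmod (g' u) \<ge> 1 \<longleftrightarrow> cmod (g u) \<ge> r" for u
    using r by (simp add: g'_def norm_divide)
  have T: "exit_time 1 g' = exit_time r g" unfolding exit_time_def hits_def iff ..
  interpret unit_curve g'
  proof
    show "g' \<in> path_set" using gp(1) r(1) unfolding path_set_def g'_def by (auto intro!: continuous_intros)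
    show "hits 1 g'" using hr unfolding hits_def iff .
  qed (simp add: g'_def gp)
  have K: "closed (curve_until \<rho> g)" "curve_until \<rho> g \<noteq> {}" for \<rho>
    using compact_curve_until[OF gp(1)] curve_until_nonempty by (auto intro: compact_imp_closed)
  have h: "h \<ge> 0" using r(3) order_trans[OF zero_le_power2] by blast
  have reach_iff: "reaches (curve_until r g) (r\<^sup>2) z (scale_path r v) \<longleftrightarrow> reaches (curve_until 1 g') 1 (z / of_real r) v" for v
  proof -
    have img: "{0..r\<^sup>2} = (\<lambda>s. s * r\<^sup>2) ` {0..1}" by (rule unit_interval_mult_image) simp
    have "z + of_real r * v s \<in> curve_until r g \<longleftrightarrow> z / of_real r + v s \<in> curve_until 1 g'" for s
    proof -
      have "curve_until 1 g' = (\<lambda>w. w / of_real r) ` curve_until r g"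
        unfolding curve_until_def T g'_def by (simp add: image_image)
      moreover have "z / of_real r + v s = (z + of_real r * v s) / of_real r" using r(1) by (simp add: add_divide_distrib)
      moreover have "inj (\<lambda>w::complex. w / of_real r)" using r(1) by (auto intro: injI)
      then have "w / of_real r \<in> (\<lambda>w. w / of_real r) ` S \<longleftrightarrow> w \<in> S" for w :: complex and S
        by (rule inj_image_mem_iff)
      ultimately show ?thesis by (simp only:)
    qed
    then show ?thesis unfolding reaches_def img using r(1) by (simp add: scale_path_def)
  qed
  have "reach_const \<le> measure W {v \<in> path_set. reaches (curve_until 1 g') 1 (z / of_real r) v}"
    by (rule reach_unit_curve[OF unit_curve_axioms]) (use z r in \<open>simp add: norm_divide\<close>)
  also have "\<dots> = measure W (scale_path r -` {v \<in> path_set. reaches (curve_until r g) (r\<^sup>2) z v} \<inter> space W)"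
    using scale_path_path_set[OF _ r(1)] by (intro arg_cong[where f="measure W"]) (auto simp: reach_iff)
  also have "\<dots> = measure (distr W paths (scale_path r)) {v \<in> path_set. reaches (curve_until r g) (r\<^sup>2) z v}"
    by (rule measure_distr[symmetric]) (use scale_path_measurable[OF r(1)] sets_not_reaches(2)[OF K] in auto)
  also have "\<dots> = measure W {v \<in> path_set. reaches (curve_until r g) (r\<^sup>2) z v}"
    unfolding W_scale[OF r(1)] ..
  also have "\<dots> \<le> measure W {v \<in> path_set. reaches (curve_until r0 g) h z v}"
  proof (rule W.finite_measure_mono)
    have "curve_until r g \<subseteq> curve_until r0 g"
      unfolding curve_until_def using exit_time_mono[OF gp(1,3) r(2)] by (intro image_mono) auto
    then show "{v \<in> path_set. reaches (curve_until r g) (r\<^sup>2) z v} \<subseteq> {v \<in> path_set. reaches (curve_until r0 g) h z v}"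
      using r(3) unfolding reaches_def by fastforce
  qed (use sets_not_reaches(2)[OF K h] in auto)
  finally show ?thesis .
qed

lemma reach_const_le_1: "reach_const \<le> 1"
proof -
  define V where "V = measure lborel (ball (0::complex) 1)"
  have V: "V \<ge> 0" by (simp add: V_def)
  have "V * exp (-9) \<le> V * 1" using V by (intro mult_left_mono) auto
  also have "\<dots> \<le> 1 * (2 + 2 * V)" using V by simp
  also have "\<dots> \<le> 4 * pi * (2 + 2 * V)" using V pi_gt3 by (intro mult_right_mono) auto
  finally show ?thesis
    using V pi_gt_zero unfolding reach_const_def Let_def V_def[symmetric] by (subst divide_le_eq_1_pos) (auto intro!: mult_pos_pos)
qed

lemma small_displacement:
  assumes a: "a > 0" and \<epsilon>: "\<epsilon> > 0" and b: "b > 0"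
  obtains s where "0 < s" "s \<le> b" "measure W {v \<in> path_set. cmod (v s) > a} < \<epsilon>"
proof -
  define s where "s n = b / real (Suc n)" for n
  have s: "0 < s n" "s n \<le> b" for n using b by (auto simp: s_def field_simps)
  have s_lim: "s \<longlonglongrightarrow> 0" unfolding s_def by (rule LIMSEQ_Suc) (rule lim_const_over_n)
  have m: "{v \<in> path_set. cmod (v (s n)) > a} \<in> sets W" for n
  proof -
    have [measurable]: "(\<lambda>v. v (s n)) \<in> borel_measurable paths" using s(1)[of n] by (intro measurable_eval_path) simp
    have "{v \<in> space paths. cmod (v (s n)) > a} \<in> sets paths" by measurable
    then show ?thesis by simp
  qed
  have "(\<lambda>n. \<integral>\<^sup>+v. indicator {v \<in> path_set. cmod (v (s n)) > a} v \<partial>W) \<longlonglongrightarrow> (\<integral>\<^sup>+v. 0 \<partial>W)"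
  proof (rule nn_integral_dominated_convergence[where w="\<lambda>_. 1"])
    show "AE v in W. (\<lambda>n. indicator {v \<in> path_set. cmod (v (s n)) > a} v :: ennreal) \<longlonglongrightarrow> 0"
      using AE_start_0 AE_space
    proof eventually_elim
      case (elim v)
      then have "continuous_on {0..} v" by (simp add: path_set_def)
      from continuous_on_tendsto_compose[OF this s_lim]
      have "(\<lambda>n. v (s n)) \<longlonglongrightarrow> v 0" using s(1) by (simp add: less_imp_le)
      then have "(\<lambda>n. cmod (v (s n))) \<longlonglongrightarrow> 0" using elim(1) tendsto_norm_zero by simp
      then have "eventually (\<lambda>n. cmod (v (s n)) < a) sequentially" using a by (rule order_tendstoD)
      then have "eventually (\<lambda>n. indicator {v \<in> path_set. cmod (v (s n)) > a} v = (0::ennreal)) sequentially"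
        by eventually_elim simp
      then show ?case by (rule tendsto_eventually)
    qed
    show "(\<lambda>v. indicator {v \<in> path_set. cmod (v (s n)) > a} v :: ennreal) \<in> borel_measurable W" for n
      by (rule borel_measurable_indicator[OF m])
    show "(\<integral>\<^sup>+v. 1 \<partial>W) < \<infinity>" by (simp add: W.emeasure_space_1 del: space_W)
    show "AE v in W. indicator {v \<in> path_set. cmod (v (s n)) > a} v \<le> (1::ennreal)" for n
      by (rule AE_I2) (simp add: indicator_def)
  qed auto
  then have "(\<lambda>n. ennreal (measure W {v \<in> path_set. cmod (v (s n)) > a})) \<longlonglongrightarrow> ennreal 0"
    using m by (simp add: W.emeasure_eq_measure)
  then have "(\<lambda>n. measure W {v \<in> path_set. cmod (v (s n)) > a}) \<longlonglongrightarrow> 0"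
    by (subst (asm) tendsto_ennreal_iff) auto
  then have "eventually (\<lambda>n. measure W {v \<in> path_set. cmod (v (s n)) > a} < \<epsilon>) sequentially"
    using \<epsilon> by (rule order_tendstoD)
  then obtain n where "measure W {v \<in> path_set. cmod (v (s n)) > a} < \<epsilon>"
    by (auto simp: eventually_sequentially)
  then show thesis using that s by blast
qed

definition reach_bound :: "real \<Rightarrow> real \<Rightarrow> real \<Rightarrow> real \<Rightarrow> bool" where
  "reach_bound \<epsilon> h r0 \<delta> \<longleftrightarrow> (\<forall>g z. g \<in> path_set \<longrightarrow> g 0 = 0 \<longrightarrow> hits r0 g \<longrightarrow> cmod z \<le> \<delta> \<longrightarrow>
     measure W {v \<in> path_set. \<not> reaches (curve_until r0 g) h z v} \<le> \<epsilon>)"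

text \<open>The quantifiers over all \<open>h\<close> and \<open>r0\<close> carry the induction:
  each step makes one attempt within half of the time budget and uses the previous bound for the
  other half.\<close>

definition reach_defect :: "real \<Rightarrow> bool" where
  "reach_defect \<epsilon> \<longleftrightarrow> (\<forall>h>0. \<forall>r0>0. \<exists>\<delta>>0. reach_bound \<epsilon> h r0 \<delta>)"

text \<open>From a starting point very close to the origin of the curve, the path first has a chance
  \<open>reach_const\<close> to hit the curve within a short time \<open>s\<close>; if it fails, it is typically still
  close to the origin and starts afresh.\<close>

lemma reach_defect_step:
  assumes Q: "reach_defect \<epsilon>" and \<epsilon>: "\<epsilon> > 0"
  shows "reach_defect ((1 - reach_const / 2) * \<epsilon>)"
  unfolding reach_defect_def
proof (intro allI impI)
  fix h r0 :: real assume h: "h > 0" and r0: "r0 > 0"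
  have "h / 2 > 0" using h by simp
  then obtain \<delta>1 where "\<delta>1 > 0" "reach_bound \<epsilon> (h / 2) r0 \<delta>1"
    using Q r0 unfolding reach_defect_def by blast
  then have \<delta>1: "\<delta>1 > 0" "\<And>g z. g \<in> path_set \<Longrightarrow> g 0 = 0 \<Longrightarrow> hits r0 g \<Longrightarrow> cmod z \<le> \<delta>1 \<Longrightarrow>
     measure W {v \<in> path_set. \<not> reaches (curve_until r0 g) (h / 2) z v} \<le> \<epsilon>"
    unfolding reach_bound_def by blast+
  \<comment> \<open>A path started within \<open>\<delta>1 / 2\<close> is still within
    \<open>\<delta>1\<close> after the short time \<open>s\<close>, except with probability below
    \<open>reach_const / 2 * \<epsilon>\<close>. The bound by \<open>r0\<^sup>2\<close> makes the
    scaled estimate available at radius \<open>sqrt s\<close>.\<close>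
  obtain s where s: "0 < s" "s \<le> min (h / 2) (r0\<^sup>2)"
    "measure W {v \<in> path_set. cmod (v s) > \<delta>1 / 2} < reach_const / 2 * \<epsilon>"
  proof (rule small_displacement[of "\<delta>1 / 2" "reach_const / 2 * \<epsilon>" "min (h / 2) (r0\<^sup>2)"])
    show "reach_const / 2 * \<epsilon> > 0" using \<epsilon> reach_const_pos by simp
  qed (use \<delta>1(1) h r0 in auto)
  have sq: "0 < sqrt s" "sqrt s \<le> r0" "(sqrt s)\<^sup>2 \<le> s" using s r0 by (auto intro: real_le_lsqrt)
  show "\<exists>\<delta>>0. reach_bound ((1 - reach_const / 2) * \<epsilon>) h r0 \<delta>"
    unfolding reach_bound_def
  proof (intro exI[of _ "min (\<delta>1 / 2) (sqrt s)"] conjI allI impI)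
    fix g :: "real \<Rightarrow> complex" and z :: complex
    assume g: "g \<in> path_set" "g 0 = 0" "hits r0 g" and z: "cmod z \<le> min (\<delta>1 / 2) (sqrt s)"
    define K where "K = curve_until r0 g"
    have K: "closed K" "K \<noteq> {}" unfolding K_def
      using compact_curve_until[OF g(1)] curve_until_nonempty by (auto intro: compact_imp_closed)
    have s0: "s \<ge> 0" and h2: "h / 2 \<ge> 0" "h \<ge> 0" using s h by auto
    have vs [measurable]: "(\<lambda>v. v s) \<in> borel_measurable paths" by (rule measurable_eval_path[OF s0])
    have p1: "Measurable.pred (paths \<Otimes>\<^sub>M paths) (\<lambda>p. reaches K s z (fst p))"
      by (rule pred_reaches_compose[OF K s0]) auto
    have fs [measurable]: "(\<lambda>p. fst p s) \<in> borel_measurable (paths \<Otimes>\<^sub>M paths)"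
      by (rule measurable_path_at[OF measurable_fst s0])
    have p2: "Measurable.pred (paths \<Otimes>\<^sub>M paths) (\<lambda>p. reaches K (h / 2) (z + fst p s) (snd p))"
      by (rule pred_reaches_compose[OF K h2(1)]) measurable
    note [measurable] = p1 p2
    \<comment> \<open>Both attempts fail: the one before time \<open>s\<close>, and the one during
      the time \<open>h / 2\<close> after it, from a position within
      \<open>\<delta>1\<close>.\<close>
    define S where "S = {p \<in> space (paths \<Otimes>\<^sub>M paths). \<not> reaches K s z (fst p) \<and> cmod (z + fst p s) \<le> \<delta>1
        \<and> \<not> reaches K (h / 2) (z + fst p s) (snd p)}"
    have S [measurable]: "S \<in> sets (paths \<Otimes>\<^sub>M paths)" unfolding S_def by measurable
    let ?N = "{v \<in> path_set. \<not> reaches K h z v}" and ?D = "{v \<in> path_set. cmod (v s) > \<delta>1 / 2}"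
    let ?Ns = "{v \<in> path_set. \<not> reaches K s z v}"
    have D: "?D \<in> sets W"
    proof -
      have "{v \<in> space paths. cmod (v s) > \<delta>1 / 2} \<in> sets paths" by measurable
      then show ?thesis by simp
    qed
    have st: "stop_path s v \<in> path_set" "incr_path s v \<in> path_set" if "v \<in> path_set" for v
      using stop_path_in_path_set[OF that s0] measurable_space[OF measurable_incr_path[of "\<lambda>x. x" paths "\<lambda>_. s"], of v] that s0
      by auto
    have "emeasure W ?N \<le> (\<integral>\<^sup>+v. indicator ?D v + indicator S (stop_path s v, incr_path s v) \<partial>W)"
    proof -
      have "emeasure W ?N = (\<integral>\<^sup>+v. indicator ?N v \<partial>W)"
        using sets_not_reaches(1)[OF K h2(2), of z] by simp
      also have "\<dots> \<le> (\<integral>\<^sup>+v. indicator ?D v + indicator S (stop_path s v, incr_path s v) \<partial>W)"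
      proof (rule nn_integral_mono)
        fix v assume "v \<in> space W"
        then have v: "v \<in> path_set" by simp
        show "indicator ?N v \<le> (indicator ?D v + indicator S (stop_path s v, incr_path s v) :: ennreal)"
        proof (cases "v \<in> ?N \<and> v \<notin> ?D")
          case True
          then have n: "\<not> reaches K h z v" and d: "cmod (v s) \<le> \<delta>1 / 2" using v by auto
          have "\<not> reaches K s z (stop_path s v)"
          proof
            assume "reaches K s z (stop_path s v)"
            then obtain t where "t \<in> {0..s}" "z + v t \<in> K" by (auto simp: reaches_def stop_path_def)
            moreover have "s \<le> h" using s(2) h by linarith
            ultimately show False using n unfolding reaches_def by auto
          qed
          moreover have "cmod (z + v s) \<le> \<delta>1"
            using norm_triangle_ineq[of z "v s"] d z by simp
          moreover have "\<not> reaches K (h / 2) (z + v s) (incr_path s v)"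
          proof
            assume "reaches K (h / 2) (z + v s) (incr_path s v)"
            then obtain t where "t \<in> {0..h / 2}" "z + v (s + t) \<in> K" by (auto simp: reaches_def incr_path_def)
            then have "reaches K h z v" using s unfolding reaches_def by (intro bexI[of _ "s + t"]) auto
            then show False using n by simp
          qed
          ultimately have "(stop_path s v, incr_path s v) \<in> S"
            using st[OF v] by (simp add: S_def space_pair_measure stop_path_def)
          then show ?thesis by (simp add: indicator_def)
        qed (auto simp: indicator_def)
      qed
      finally show ?thesis .
    qed
    also have "\<dots> = emeasure W ?D + (\<integral>\<^sup>+v. indicator S (stop_path s v, incr_path s v) \<partial>W)"
    proof (subst nn_integral_add)
      have "(\<lambda>v. (stop_path s v, incr_path s v)) \<in> paths \<rightarrow>\<^sub>M paths \<Otimes>\<^sub>M paths"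
        using s0 by (intro measurable_Pair measurable_stop_path measurable_incr_path) auto
      from measurable_compose[OF this borel_measurable_indicator[OF S]]
      show "(\<lambda>v. indicator S (stop_path s v, incr_path s v) :: ennreal) \<in> borel_measurable W"
        by (simp only: measurable_cong_sets[OF sets_W refl])
    qed (use D in auto)
    also have "(\<integral>\<^sup>+v. indicator S (stop_path s v, incr_path s v) \<partial>W)
        = (\<integral>\<^sup>+v. (\<integral>\<^sup>+b. indicator S (stop_path s v, b) \<partial>W) \<partial>W)"
      by (rule nn_integral_markov[OF brownian_W s0]) measurable
    also have "\<dots> \<le> (\<integral>\<^sup>+v. indicator ?Ns v * ennreal \<epsilon> \<partial>W)"
    proof (rule nn_integral_mono)
      fix v assume "v \<in> space W"
      then have v: "v \<in> path_set" by simp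
      have st_iff: "reaches K s z (stop_path s v) \<longleftrightarrow> reaches K s z v"
        unfolding reaches_def stop_path_def by (auto simp: min_def)
      show "(\<integral>\<^sup>+b. indicator S (stop_path s v, b) \<partial>W) \<le> indicator ?Ns v * ennreal \<epsilon>"
      proof (cases "\<not> reaches K s z v \<and> cmod (z + v s) \<le> \<delta>1")
        case True
        have "(\<integral>\<^sup>+b. indicator S (stop_path s v, b) \<partial>W) = (\<integral>\<^sup>+b. indicator {b \<in> path_set. \<not> reaches K (h / 2) (z + v s) b} b \<partial>W)"
          using st(1)[OF v] True st_iff
          by (intro nn_integral_cong) (auto simp: S_def indicator_def space_pair_measure stop_path_def)
        also have "\<dots> = ennreal (measure W {b \<in> path_set. \<not> reaches K (h / 2) (z + v s) b})"
          using sets_not_reaches(1)[OF K h2(1), of "z + v s"] by (simp add: W.emeasure_eq_measure)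
        also have "\<dots> \<le> ennreal \<epsilon>"
          unfolding K_def using True by (intro ennreal_leI \<delta>1(2) g) auto
        finally show ?thesis using True v by (simp add: indicator_def)
      next
        case False
        then have "(\<integral>\<^sup>+b. indicator S (stop_path s v, b) \<partial>W) = (\<integral>\<^sup>+b. 0 \<partial>W)"
          using st_iff by (intro nn_integral_cong) (auto simp: S_def indicator_def stop_path_def)
        then show ?thesis by simp
      qed
    qed
    also have "(\<integral>\<^sup>+v. indicator ?Ns v * ennreal \<epsilon> \<partial>W) = emeasure W ?Ns * ennreal \<epsilon>"
      using sets_not_reaches(1)[OF K s0, of z] by (subst nn_integral_multc) auto
    finally have "ennreal (measure W ?N) \<le> ennreal (measure W ?D) + ennreal (measure W ?Ns) * ennreal \<epsilon>"
      by (simp add: W.emeasure_eq_measure add_left_mono)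
    also have "\<dots> = ennreal (measure W ?D + measure W ?Ns * \<epsilon>)"
      using \<epsilon> by (simp add: ennreal_mult'' ennreal_plus)
    finally have "measure W ?N \<le> measure W ?D + measure W ?Ns * \<epsilon>"
      using \<epsilon> by (subst (asm) ennreal_le_iff) auto
    also have "measure W ?Ns \<le> 1 - reach_const"
    proof -
      have "?Ns = space W - {v \<in> path_set. reaches K s z v}" by auto
      then have "measure W ?Ns = 1 - measure W {v \<in> path_set. reaches K s z v}"
        using W.prob_compl[of "{v \<in> path_set. reaches K s z v}"] sets_not_reaches(2)[OF K s0, of z] by simp
      moreover have "reach_const \<le> measure W {v \<in> path_set. reaches K s z v}"
        unfolding K_def by (rule reach_curve_scaled[OF g sq]) (use z in auto)
      ultimately show ?thesis by simp
    qed
    \<comment> \<open>Moving too far costs \<open>reach_const / 2 * \<epsilon>\<close> and failing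
      twice at most \<open>(1 - reach_const) * \<epsilon>\<close>, so half of the gain
      survives.\<close>
    then have "measure W ?D + measure W ?Ns * \<epsilon> \<le> reach_const / 2 * \<epsilon> + (1 - reach_const) * \<epsilon>"
      using s(3) \<epsilon> by (intro add_mono mult_right_mono) auto
    also have "\<dots> = (1 - reach_const / 2) * \<epsilon>" by (simp add: algebra_simps)
    finally show "measure W {v \<in> path_set. \<not> reaches (curve_until r0 g) h z v} \<le> (1 - reach_const / 2) * \<epsilon>"
      unfolding K_def .
  qed (use \<delta>1 s in auto)
qed

text \<open>Iterating the step from the trivial bound 1 gives geometric decay.\<close>

lemma reach_defect_all:
  assumes "\<epsilon> > 0"
  shows "reach_defect \<epsilon>"
proof -
  let ?q = "1 - reach_const / 2"
  have q: "0 < ?q" "?q < 1" using reach_const_pos reach_const_le_1 by auto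
  have "reach_defect (?q ^ n)" for n
  proof (induction n)
    case 0
    have "reach_bound 1 h r0 1" for h r0 unfolding reach_bound_def by simp
    then show ?case unfolding reach_defect_def by (auto intro!: exI[of _ 1])
  next
    case (Suc n)
    then show ?case using reach_defect_step[of "?q ^ n"] q by simp
  qed
  moreover obtain n where "?q ^ n < \<epsilon>" using real_arch_pow_inv[OF assms q(2)] by auto
  moreover have "reach_bound \<epsilon> h r0 \<delta>" if "reach_bound (?q ^ n) h r0 \<delta>" "?q ^ n < \<epsilon>" for n h r0 \<delta>
    using that unfolding reach_bound_def by (meson less_imp_le order_trans)
  ultimately show ?thesis unfolding reach_defect_def by meson
qed

text \<open>Limits the duration of the search for a contact: with high probability the path moves by
  less than \<open>R\<close> meanwhile.\<close>

lemma small_exit: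
  assumes R: "R > 0" and \<epsilon>: "\<epsilon> > 0"
  obtains h where "h > 0" "measure W {v \<in> path_set. hits R v \<and> exit_time R v \<le> h} < \<epsilon>"
proof -
  define H where "H n = {v \<in> path_set. hits R v \<and> exit_time R v \<le> 1 / real (Suc n)}" for n
  have H: "H n \<in> sets W" for n
    using pred_hits_before[of "1 / real (Suc n)" R] unfolding pred_def H_def by simp
  have dec: "decseq H"
  proof (rule decseq_SucI)
    fix n
    have "1 / real (Suc (Suc n)) \<le> 1 / real (Suc n)" by (simp add: field_simps)
    then show "H (Suc n) \<subseteq> H n" unfolding H_def by fastforce
  qed
  have "measure W (\<Inter>n. H n) = 0"
  proof -
    have "AE v in W. v \<notin> (\<Inter>n. H n)"
      using AE_start_0
    proof eventually_elim
      case (elim v)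
      show ?case
      proof
        assume v: "v \<in> (\<Inter>n. H n)"
        then have vp: "v \<in> path_set" "hits R v" by (auto simp: H_def)
        have "exit_time R v \<le> 1 / real (Suc n)" for n using v by (auto simp: H_def)
        then have "exit_time R v \<le> 0"
          by (intro LIMSEQ_le_const[OF LIMSEQ_inverse_real_of_nat]) (auto simp: inverse_eq_divide)
        then have "exit_time R v = 0" using exit_time_nonneg[of R v] by simp
        then show False using at_exit_time[OF vp] elim R by simp
      qed
    qed
    moreover have "(\<Inter>n. H n) \<in> sets W" using H by (intro sets.countable_INT) auto
    ultimately show ?thesis by (subst W.prob_eq_0) auto
  qed
  moreover have "(\<lambda>n. measure W (H n)) \<longlonglongrightarrow> measure W (\<Inter>n. H n)"
    by (rule W.finite_Lim_measure_decseq[OF _ dec]) (use H in auto)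
  ultimately have "(\<lambda>n. measure W (H n)) \<longlonglongrightarrow> 0" by simp
  then have "eventually (\<lambda>n. measure W (H n) < \<epsilon>) sequentially" using \<epsilon> by (rule order_tendstoD)
  then obtain n where "measure W (H n) < \<epsilon>" by (auto simp: eventually_sequentially)
  then show thesis using that[of "1 / real (Suc n)"] by (simp add: H_def)
qed

text \<open>A strong Markov argument at the first index \<open>k\<close> with
  \<open>x \<in> A k\<close>, along deterministic times. The first passage events are disjoint, each
  is decided by the path up to \<open>s k\<close> because of \<open>stop\<close>, and the simple
  Markov property at \<open>s k\<close> gives the factor \<open>\<eta>\<close>.\<close>

lemma first_passage_bound:
  assumes X: "brownian P \<nu> (\<lambda>x. x)" and P [measurable_cong]: "sets P = sets paths"
    and s: "\<And>k::nat. s k \<ge> 0"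
    and A [measurable]: "\<And>k. A k \<in> sets paths"
    and stop: "\<And>j k x. j \<le> k \<Longrightarrow> x \<in> path_set \<Longrightarrow> stop_path (s k) x \<in> A j \<longleftrightarrow> x \<in> A j"
    and B [measurable]: "B \<in> sets (borel \<Otimes>\<^sub>M paths)"
    and bound: "\<And>k x. x \<in> A k \<Longrightarrow> emeasure W {v \<in> path_set. (x (s k), v) \<in> B} \<le> \<eta>"
  shows "emeasure P {x \<in> path_set. \<exists>k. x \<in> A k \<and> (\<forall>j<k. x \<notin> A j) \<and> (x (s k), incr_path (s k) x) \<in> B} \<le> \<eta>"
    and "{x \<in> path_set. \<exists>k. x \<in> A k \<and> (\<forall>j<k. x \<notin> A j) \<and> (x (s k), incr_path (s k) x) \<in> B} \<in> sets paths"
proof -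
  interpret P: prob_space P using brownianD(1)[OF X] .
  have spP: "space P = path_set" using sets_eq_imp_space_eq[OF P] by simp
  define A' where "A' k = {x \<in> space paths. x \<in> A k \<and> (\<forall>j<k. x \<notin> A j)}" for k
  have A' [measurable]: "A' k \<in> sets paths" for k unfolding A'_def by measurable
  have A'_stop: "stop_path (s k) x \<in> A' k \<longleftrightarrow> x \<in> A' k" if "x \<in> path_set" for k x
    using that stop[of _ k x] stop_path_in_path_set[OF that s] unfolding A'_def by auto
  define E where "E k = {x \<in> path_set. x \<in> A' k \<and> (x (s k), incr_path (s k) x) \<in> B}" for k
  have sm: "(\<lambda>x. stop_path (s k) x) \<in> paths \<rightarrow>\<^sub>M paths" "(\<lambda>x. incr_path (s k) x) \<in> paths \<rightarrow>\<^sub>M paths" for k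
    using s by (auto intro!: measurable_stop_path measurable_incr_path)
  have ev [measurable]: "(\<lambda>x. x (s k)) \<in> borel_measurable paths" for k by (rule measurable_eval_path[OF s])
  have E [measurable]: "E k \<in> sets paths" for k
  proof -
    note [measurable] = sm
    have "{x \<in> space paths. x \<in> A' k \<and> (x (s k), incr_path (s k) x) \<in> B} \<in> sets paths" by measurable
    then show ?thesis by (simp add: E_def)
  qed
  have Ek: "emeasure P (E k) \<le> \<eta> * emeasure P (A' k)" for k
  proof -
    let ?F = "\<lambda>p. indicator (A' k) (fst p) * indicator B (fst p (s k), snd p) :: ennreal"
    have [measurable]: "(\<lambda>p. fst p (s k)) \<in> borel_measurable (paths \<Otimes>\<^sub>M paths)"
      by (rule measurable_path_at[OF measurable_fst s])
    have "emeasure P (E k) = (\<integral>\<^sup>+x. indicator (E k) x \<partial>P)" by (rule nn_integral_indicator[symmetric]) simp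
    also have "\<dots> = (\<integral>\<^sup>+x. ?F (stop_path (s k) x, incr_path (s k) x) \<partial>P)"
      using A'_stop by (intro nn_integral_cong) (auto simp: spP E_def indicator_def stop_path_def)
    also have "\<dots> = (\<integral>\<^sup>+x. (\<integral>\<^sup>+v. ?F (stop_path (s k) x, v) \<partial>W) \<partial>P)"
      by (rule nn_integral_markov[OF X s]) measurable
    also have "\<dots> \<le> (\<integral>\<^sup>+x. \<eta> * indicator (A' k) x \<partial>P)"
    proof (rule nn_integral_mono)
      fix x assume "x \<in> space P"
      then have x: "x \<in> path_set" by (simp add: spP)
      show "(\<integral>\<^sup>+v. ?F (stop_path (s k) x, v) \<partial>W) \<le> \<eta> * indicator (A' k) x"
      proof (cases "x \<in> A' k")
        case True
        have "(\<integral>\<^sup>+v. ?F (stop_path (s k) x, v) \<partial>W) = (\<integral>\<^sup>+v. indicator {v \<in> path_set. (x (s k), v) \<in> B} v \<partial>W)"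
          using True A'_stop[OF x] by (intro nn_integral_cong) (auto simp: indicator_def stop_path_def)
        also have "\<dots> = emeasure W {v \<in> path_set. (x (s k), v) \<in> B}"
        proof (rule nn_integral_indicator)
          have "{v \<in> space paths. (x (s k), v) \<in> B} \<in> sets paths" by measurable
          then show "{v \<in> path_set. (x (s k), v) \<in> B} \<in> sets W" by simp
        qed
        also have "\<dots> \<le> \<eta>" by (rule bound) (use True in \<open>simp add: A'_def\<close>)
        finally show ?thesis using True by simp
      next
        case False
        then show ?thesis using A'_stop[OF x] by simp
      qed
    qed
    also have "\<dots> = \<eta> * emeasure P (A' k)" by (rule nn_integral_cmult_indicator) simp
    finally show ?thesis .
  qed
  have disj: "disjoint_family A'"
    unfolding disjoint_family_on_def A'_def by (auto simp: less_linear) (metis less_linear)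
  have eq: "{x \<in> path_set. \<exists>k. x \<in> A k \<and> (\<forall>j<k. x \<notin> A j) \<and> (x (s k), incr_path (s k) x) \<in> B} = (\<Union>k. E k)"
    by (auto simp: E_def A'_def)
  show "{x \<in> path_set. \<exists>k. x \<in> A k \<and> (\<forall>j<k. x \<notin> A j) \<and> (x (s k), incr_path (s k) x) \<in> B} \<in> sets paths"
    unfolding eq using E by (intro sets.countable_UN) auto
  have "emeasure P (\<Union>k. E k) \<le> (\<Sum>k. emeasure P (E k))"
    by (rule emeasure_subadditive_countably) auto
  also have "\<dots> \<le> (\<Sum>k. \<eta> * emeasure P (A' k))"
    by (intro suminf_le Ek) auto
  also have "\<dots> = \<eta> * (\<Sum>k. emeasure P (A' k))" by simp
  also have "(\<Sum>k. emeasure P (A' k)) = emeasure P (\<Union>k. A' k)"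
    by (rule suminf_emeasure) (use disj in auto)
  also have "\<eta> * emeasure P (\<Union>k. A' k) \<le> \<eta> * 1"
    by (intro mult_left_mono P.emeasure_le_1) simp
  finally show "emeasure P {x \<in> path_set. \<exists>k. x \<in> A k \<and> (\<forall>j<k. x \<notin> A j) \<and> (x (s k), incr_path (s k) x) \<in> B} \<le> \<eta>"
    unfolding eq by simp
qed

end

section \<open>From a countable dense set of dilations to its closure\<close>

text \<open>Closeness is tested only at dyadic times of the first path and rational fractions of the
  second, so that the event is a countable combination; refining the grid enlarges it.\<close>

definition near_grid :: "complex set \<Rightarrow> real \<Rightarrow> real \<Rightarrow> nat \<Rightarrow> (real \<Rightarrow> complex) \<Rightarrow> (real \<Rightarrow> complex) \<Rightarrow> bool" where
  "near_grid D R \<delta> n x y \<longleftrightarrow> (\<exists>k::nat. real k / 2 ^ n \<le> exit_time R x \<and>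
     (\<exists>d\<in>D. \<exists>q\<in>\<rat> \<inter> {0..1}. cmod (x (real k / 2 ^ n) - d * y (q * exit_time R y)) < \<delta>))"

lemma pred_near_grid:
  assumes D: "countable D"
  shows "Measurable.pred (paths \<Otimes>\<^sub>M paths) (\<lambda>p. near_grid D R \<delta> n (fst p) (snd p))"
  unfolding near_grid_def pred_def
proof (intro sets.sets_Collect_countable_Ex sets.sets_Collect_conj sets.sets_Collect_countable_Ex'[OF _ D]
    sets.sets_Collect_countable_Ex'[OF _ countable_rat_interval])
  fix k :: nat
  show "{p \<in> space (paths \<Otimes>\<^sub>M paths). real k / 2 ^ n \<le> exit_time R (fst p)} \<in> sets (paths \<Otimes>\<^sub>M paths)"
    by measurable
  fix d q assume q: "q \<in> \<rat> \<inter> {0..1::real}"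
  have [measurable]: "(\<lambda>p. fst p (real k / 2 ^ n)) \<in> borel_measurable (paths \<Otimes>\<^sub>M paths)"
    by (rule measurable_path_at[OF measurable_fst]) simp
  have [measurable]: "(\<lambda>p. snd p (q * exit_time R (snd p))) \<in> borel_measurable (paths \<Otimes>\<^sub>M paths)"
    by (rule measurable_eval_random_time[OF measurable_snd]) (use q in \<open>auto simp: exit_time_nonneg\<close>)
  show "{p \<in> space (paths \<Otimes>\<^sub>M paths). cmod (fst p (real k / 2 ^ n) - d * snd p (q * exit_time R (snd p))) < \<delta>}
      \<in> sets (paths \<Otimes>\<^sub>M paths)"
    by measurable
qed

lemma near_grid_Suc: "near_grid D R \<delta> n x y \<Longrightarrow> near_grid D R \<delta> (Suc n) x y"
proof -
  assume "near_grid D R \<delta> n x y"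
  then obtain k d q where k: "real k / 2 ^ n \<le> exit_time R x" "d \<in> D" "q \<in> \<rat> \<inter> {0..1}"
    "cmod (x (real k / 2 ^ n) - d * y (q * exit_time R y)) < \<delta>"
    unfolding near_grid_def by blast
  have "real (2 * k) / 2 ^ Suc n = real k / 2 ^ n" by simp
  then show ?thesis unfolding near_grid_def using k by (intro exI[of _ "2 * k"]) metis
qed

lemma norm_le_until_exit:
  assumes "x \<in> path_set" "hits R x" "cmod (x 0) \<le> R" "0 \<le> t" "t \<le> exit_time R x"
  shows "cmod (x t) \<le> R"
  using before_exit_time[of t R x] norm_at_exit_time[OF assms(1-3)] assms(4,5)
  by (cases "t = exit_time R x") auto

section \<open>Close approach forces contact\<close>

context wiener
begin

definition avoids :: "complex set \<Rightarrow> (real \<Rightarrow> complex) \<Rightarrow> real \<Rightarrow> real \<Rightarrow> complex \<Rightarrow> (real \<Rightarrow> complex) \<Rightarrow> bool" where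
  "avoids D y T h z v \<longleftrightarrow> (\<forall>d\<in>D. \<not> reaches ((\<lambda>t. d * y t) ` {0..T}) h z v)"

lemma pred_avoids:
  assumes D: "countable D" and y: "y \<in> path_set" and "T \<ge> 0" "h \<ge> 0"
  shows "Measurable.pred (borel \<Otimes>\<^sub>M paths) (\<lambda>p. avoids D y T h (fst p) (snd p))"
  unfolding avoids_def pred_def
proof (intro sets.sets_Collect_countable_All'[OF _ D] sets.sets_Collect_neg)
  fix d
  have "continuous_on {0..T} (\<lambda>t. d * y t)"
    using y unfolding path_set_def by (auto intro!: continuous_intros intro: continuous_on_subset)
  then have "compact ((\<lambda>t. d * y t) ` {0..T})" by (rule compact_continuous_image) simp
  then have "closed ((\<lambda>t. d * y t) ` {0..T})" by (rule compact_imp_closed)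
  from pred_reaches[OF this _ assms(4)] assms(3)
  show "{p \<in> space (borel \<Otimes>\<^sub>M paths). reaches ((\<lambda>t. d * y t) ` {0..T}) h (fst p) (snd p)} \<in> sets (borel \<Otimes>\<^sub>M paths)"
    by (auto simp: pred_def)
qed

text \<open>Recentred at the nearby point \<open>d * y t\<close>, the rest of the dilated copy is a
  curve from 0. It reaches distance at least \<open>b * R\<close>, as \<open>y\<close> goes from
  modulus at most \<open>R\<close> to \<open>2 * R\<close> and \<open>cmod d \<ge> b\<close>, so
  \<open>reach_bound\<close> applies.\<close>

lemma avoids_prob_small:
  assumes y: "y \<in> path_set" "hits (2 * R) y" "cmod (y 0) \<le> R" and R: "R > 0"
    and D: "countable D" "d \<in> D" "cmod d \<ge> b" "b > 0" and h: "h \<ge> 0"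
    and rb: "reach_bound \<epsilon> h (b * R) \<delta>" and t: "0 \<le> t" "t \<le> exit_time R y"
    and z: "cmod (z - d * y t) \<le> \<delta>"
  shows "measure W {v \<in> path_set. avoids D y (exit_time (2 * R) y) h z v} \<le> \<epsilon>"
proof -
  let ?T = "exit_time (2 * R) y"
  define g where "g u = d * (y (t + u) - y t)" for u
  define u where "u = ?T - t"
  have hR: "hits R y" using hits_mono[OF y(2)] R by simp
  have u: "u \<ge> 0" using t exit_time_mono[OF y(1,2), of R] R by (simp add: u_def)
  have cont: "continuous_on {0..} (\<lambda>u. y (t + u))"
    using y(1) t(1) unfolding path_set_def
    by (auto intro!: continuous_on_compose2[of "{0..}" y] continuous_intros)
  have g: "g \<in> path_set" unfolding path_set_def g_def by (auto intro!: continuous_intros cont)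
  have "cmod (g u) \<ge> b * R"
  proof -
    have "cmod (y ?T) \<ge> 2 * R" by (rule at_exit_time[OF y(1,2)])
    moreover have "cmod (y t) \<le> R" by (rule norm_le_until_exit[OF y(1) hR y(3) t])
    ultimately have "R \<le> cmod (y ?T - y t)" using norm_triangle_ineq2[of "y ?T" "y t"] by linarith
    then have "b * R \<le> cmod d * cmod (y ?T - y t)" using D R by (intro mult_mono) auto
    then show ?thesis by (simp add: g_def u_def norm_mult)
  qed
  then have hg: "hits (b * R) g" "exit_time (b * R) g \<le> u"
    using u exit_time_le by (auto simp: hits_def)
  have sub: "avoids D y ?T h z v \<Longrightarrow> \<not> reaches (curve_until (b * R) g) h (z - d * y t) v" for v
  proof
    assume a: "avoids D y ?T h z v" and "reaches (curve_until (b * R) g) h (z - d * y t) v"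
    then obtain s w where s: "s \<in> {0..h}" and w: "w \<in> {0..exit_time (b * R) g}" "z - d * y t + v s = g w"
      by (auto simp: reaches_def curve_until_def)
    have "z + v s = d * y (t + w)" using w(2) by (simp add: g_def algebra_simps)
    moreover have "t + w \<in> {0..?T}" using w(1) hg(2) t u by (simp add: u_def)
    ultimately have "reaches ((\<lambda>t. d * y t) ` {0..?T}) h z v" using s unfolding reaches_def by blast
    then show False using a D(2) by (auto simp: avoids_def)
  qed
  have K: "closed (curve_until (b * R) g)" "curve_until (b * R) g \<noteq> {}"
    using compact_curve_until[OF g] curve_until_nonempty by (auto intro: compact_imp_closed)
  have "measure W {v \<in> path_set. avoids D y ?T h z v}
      \<le> measure W {v \<in> path_set. \<not> reaches (curve_until (b * R) g) h (z - d * y t) v}"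
    by (rule W.finite_measure_mono) (use sub sets_not_reaches(1)[OF K h] in auto)
  also have "\<dots> \<le> \<epsilon>" using rb g hg(1) z unfolding reach_bound_def by (simp add: g_def)
  finally show ?thesis .
qed

text \<open>The exceptional event to be excluded: no dilation in \<open>D\<close> gives a contact up
  to radius \<open>2 * R\<close>, yet up to radius \<open>R\<close> dilations in \<open>D'\<close>
  come arbitrarily close to one.\<close>

definition touching :: "complex set \<Rightarrow> complex set \<Rightarrow> real \<Rightarrow> (real \<Rightarrow> complex) \<Rightarrow> (real \<Rightarrow> complex) \<Rightarrow> bool" where
  "touching D D' R x y \<longleftrightarrow> hits (2 * R) x \<and> hits (2 * R) y \<and> cmod (x 0) \<le> R \<and> cmod (y 0) \<le> R \<and>
     nonint D (2 * R) x y \<and> (\<forall>m. \<exists>n. near_grid D' R (1 / real (Suc m)) n x y)"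

lemma pred_hits_norm:
  "Measurable.pred (paths \<Otimes>\<^sub>M paths) (\<lambda>p. hits (2 * R) (fst p) \<and> hits (2 * R) (snd p) \<and> cmod (fst p 0) \<le> R \<and> cmod (snd p 0) \<le> R)"
proof -
  have [measurable]: "(\<lambda>p. fst p 0) \<in> borel_measurable (paths \<Otimes>\<^sub>M paths)" "(\<lambda>p. snd p 0) \<in> borel_measurable (paths \<Otimes>\<^sub>M paths)"
    by (auto intro!: measurable_path_at[where t=0])
  show ?thesis by measurable
qed

lemma pred_touching:
  assumes "countable D" "countable D'"
  shows "Measurable.pred (paths \<Otimes>\<^sub>M paths) (\<lambda>p. touching D D' R (fst p) (snd p))"
proof -
  note [measurable] = pred_hits_norm[of R] pred_nonint[OF assms(1), of "2 * R"] pred_near_grid[OF assms(2)]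
  have "Measurable.pred (paths \<Otimes>\<^sub>M paths) (\<lambda>p. (hits (2 * R) (fst p) \<and> hits (2 * R) (snd p) \<and> cmod (fst p 0) \<le> R \<and> cmod (snd p 0) \<le> R)
     \<and> nonint D (2 * R) (fst p) (snd p) \<and> (\<forall>m. \<exists>n. near_grid D' R (1 / real (Suc m)) n (fst p) (snd p)))"
    by (intro pred_intros_logic pred_intros_countable pred_hits_norm pred_nonint[OF assms(1)] pred_near_grid[OF assms(2)])
  then show ?thesis unfolding touching_def by (simp only: conj_assoc)
qed

text \<open>After the first grid time close to a copy, the path either avoids all copies during time
  \<open>h\<close> or moves by \<open>R\<close> within time \<open>h\<close>; otherwise a contact
  occurs before radius \<open>2 * R\<close>, against \<open>nonint\<close>. Each alternative has
  probability at most \<open>\<epsilon> / 2\<close>, whatever the grid.\<close>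

lemma regularity_grid:
  assumes y: "y \<in> path_set" "hits (2 * R) y" "cmod (y 0) \<le> R" and R: "R > 0"
    and D: "countable D" "D' \<subseteq> D" "\<And>d. d \<in> D' \<Longrightarrow> cmod d \<ge> b" and b: "b > 0" and \<epsilon>: "\<epsilon> > 0"
  obtains \<delta> where "\<delta> > 0" "\<And>n. emeasure (Px 1) {x \<in> path_set. hits (2 * R) x \<and> cmod (x 0) \<le> R
     \<and> nonint D (2 * R) x y \<and> near_grid D' R \<delta> n x y} \<le> ennreal \<epsilon>"
proof -
  obtain h where h: "h > 0" "measure W {v \<in> path_set. hits R v \<and> exit_time R v \<le> h} < \<epsilon> / 2"
    using small_exit[OF R, of "\<epsilon> / 2"] \<epsilon> by auto
  obtain \<delta> where \<delta>: "\<delta> > 0" "reach_bound (\<epsilon> / 2) h (b * R) \<delta>"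
    using reach_defect_all[of "\<epsilon> / 2"] \<epsilon> h(1) b R unfolding reach_defect_def by (meson half_gt_zero mult_pos_pos)
  let ?T = "exit_time (2 * R) y"
  show thesis
  proof (rule that[OF \<delta>(1)])
    fix n :: nat
    define s where "s k = real k / 2 ^ n" for k
    have s: "s k \<ge> 0" for k by (simp add: s_def)
    have s_mono: "j \<le> k \<Longrightarrow> s j \<le> s k" for j k by (simp add: s_def divide_right_mono)
    \<comment> \<open>With \<open>y\<close> fixed, closeness is membership in an open set, so it is
      decided by the position at the grid time.\<close>
    define U where "U = (\<Union>d\<in>D'. \<Union>q\<in>\<rat> \<inter> {0..1}. ball (d * y (q * exit_time R y)) \<delta>)"
    have U: "open U" unfolding U_def by (intro open_UN ballI open_ball)
    define A where "A k = {x \<in> path_set. x (s k) \<in> U}" for k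
    have A: "A k \<in> sets paths" for k
      using measurable_sets[OF measurable_eval_path[OF s], of U k] U unfolding A_def by (auto simp: vimage_def Int_def conj_commute)
    define B where "B = {p \<in> space (borel \<Otimes>\<^sub>M paths). avoids D y ?T h (fst p) (snd p) \<or> (hits R (snd p) \<and> exit_time R (snd p) \<le> h)}"
    have B: "B \<in> sets (borel \<Otimes>\<^sub>M paths)"
    proof -
      have "Measurable.pred (borel \<Otimes>\<^sub>M paths) (\<lambda>p. avoids D y ?T h (fst p) (snd p))"
        using pred_avoids[OF D(1) y(1) exit_time_nonneg] h(1) by simp
      moreover have "Measurable.pred (borel \<Otimes>\<^sub>M paths) (\<lambda>p. hits R (snd p) \<and> exit_time R (snd p) \<le> h)"
        using measurable_compose[OF measurable_snd pred_hits_before] h(1) by simp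
      ultimately show ?thesis unfolding B_def pred_def by (intro sets.sets_Collect_disj)
    qed
    have stop: "stop_path (s k) x \<in> A j \<longleftrightarrow> x \<in> A j" if "j \<le> k" "x \<in> path_set" for j k x
      using stop_path_in_path_set[OF that(2) s] that s_mono[OF that(1)] by (simp add: A_def stop_path_def)
    have bound: "emeasure W {v \<in> path_set. (x (s k), v) \<in> B} \<le> ennreal \<epsilon>" if "x \<in> A k" for k x
    proof -
      from that obtain d q where dq: "d \<in> D'" "q \<in> \<rat> \<inter> {0..1}" "cmod (x (s k) - d * y (q * exit_time R y)) < \<delta>"
        by (auto simp: A_def U_def dist_norm norm_minus_commute)
      have q: "0 \<le> q * exit_time R y" "q * exit_time R y \<le> exit_time R y"
        using dq(2) exit_time_nonneg[of R y] by (auto simp: mult_left_le_one_le)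
      have 1: "measure W {v \<in> path_set. avoids D y ?T h (x (s k)) v} \<le> \<epsilon> / 2"
        by (rule avoids_prob_small[OF y R D(1) _ D(3)[OF dq(1)] b _ \<delta>(2) q]) (use dq D(2) h(1) in auto)
      have m1: "{v \<in> path_set. avoids D y ?T h (x (s k)) v} \<in> sets W"
      proof -
        have "Measurable.pred paths (\<lambda>v. avoids D y ?T h (x (s k)) v)"
          using measurable_compose[OF _ pred_avoids[OF D(1) y(1) exit_time_nonneg, of h "2 * R"], of "\<lambda>v. (x (s k), v)" paths] h(1)
          by simp
        then show ?thesis by (simp add: pred_def)
      qed
      have m2: "{v \<in> path_set. hits R v \<and> exit_time R v \<le> h} \<in> sets W"
        using pred_hits_before[of h R] h(1) by (simp add: pred_def)
      have "{v \<in> path_set. (x (s k), v) \<in> B} = {v \<in> path_set. avoids D y ?T h (x (s k)) v} \<union> {v \<in> path_set. hits R v \<and> exit_time R v \<le> h}"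
        by (auto simp: B_def space_pair_measure)
      then have "emeasure W {v \<in> path_set. (x (s k), v) \<in> B}
          \<le> emeasure W {v \<in> path_set. avoids D y ?T h (x (s k)) v} + emeasure W {v \<in> path_set. hits R v \<and> exit_time R v \<le> h}"
        using emeasure_subadditive[OF m1 m2] by simp
      also have "\<dots> \<le> ennreal (\<epsilon> / 2) + ennreal (\<epsilon> / 2)"
        using 1 h(2) unfolding W.emeasure_eq_measure by (intro add_mono ennreal_leI) auto
      also have "\<dots> = ennreal \<epsilon>" using \<epsilon> by (simp add: ennreal_plus[symmetric] del: ennreal_plus)
      finally show ?thesis .
    qed
    have fp: "emeasure (Px 1) {x \<in> path_set. \<exists>k. x \<in> A k \<and> (\<forall>j<k. x \<notin> A j) \<and> (x (s k), incr_path (s k) x) \<in> B} \<le> ennreal \<epsilon>"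
      "{x \<in> path_set. \<exists>k. x \<in> A k \<and> (\<forall>j<k. x \<notin> A j) \<and> (x (s k), incr_path (s k) x) \<in> B} \<in> sets paths"
      by (rule first_passage_bound[OF brownian_Px[OF zero_le_one] sets_Px s A _ B], simp add: stop, rule bound, assumption)+
    have "{x \<in> path_set. hits (2 * R) x \<and> cmod (x 0) \<le> R \<and> nonint D (2 * R) x y \<and> near_grid D' R \<delta> n x y}
        \<subseteq> {x \<in> path_set. \<exists>k. x \<in> A k \<and> (\<forall>j<k. x \<notin> A j) \<and> (x (s k), incr_path (s k) x) \<in> B}"
    proof
      fix x assume "x \<in> {x \<in> path_set. hits (2 * R) x \<and> cmod (x 0) \<le> R \<and> nonint D (2 * R) x y \<and> near_grid D' R \<delta> n x y}"
      then have x: "x \<in> path_set" "hits (2 * R) x" "cmod (x 0) \<le> R" "nonint D (2 * R) x y" "near_grid D' R \<delta> n x y" by auto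
      have hR: "hits R x" using hits_mono[OF x(2)] R by simp
      obtain k0 where k0: "s k0 \<le> exit_time R x" "x \<in> A k0"
        using x(1,5) unfolding near_grid_def A_def U_def s_def by (fastforce simp: dist_norm norm_minus_commute)
      \<comment> \<open>The first close grid time is no later than the one supplied by
        \<open>near_grid\<close>, hence not after the exit at radius \<open>R\<close>.\<close>
      define k where "k = (LEAST k. x \<in> A k)"
      have k: "x \<in> A k" "k \<le> k0" "\<forall>j<k. x \<notin> A j"
        unfolding k_def using k0(2) by (auto intro: LeastI Least_le dest: not_less_Least)
      have sk: "s k \<le> exit_time R x" using s_mono[OF k(2)] k0(1) by linarith
      have v: "incr_path (s k) x \<in> path_set"
        using measurable_space[OF measurable_incr_path[of "\<lambda>x. x" paths "\<lambda>_. s k"], of x] x(1) s by auto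
      have "avoids D y ?T h (x (s k)) (incr_path (s k) x) \<or> (hits R (incr_path (s k) x) \<and> exit_time R (incr_path (s k) x) \<le> h)"
      proof (rule ccontr)
        assume neg: "\<not> ?thesis"
        then obtain d u t where d: "d \<in> D" and u: "u \<in> {0..h}" and t: "t \<in> {0..?T}"
          and eq: "x (s k) + incr_path (s k) x u = d * y t"
          unfolding avoids_def reaches_def by blast
        have small: "cmod (incr_path (s k) x w) < R" if "w \<in> {0..h}" for w
        proof (rule ccontr)
          assume "\<not> ?thesis"
          then have "hits R (incr_path (s k) x)" "exit_time R (incr_path (s k) x) \<le> h"
            using that exit_time_le[of w R "incr_path (s k) x"] by (auto simp: hits_def not_less)
          then show False using neg by blast
        qed
        have xs: "cmod (x (s k)) \<le> R" by (rule norm_le_until_exit[OF x(1) hR x(3) s sk])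
        \<comment> \<open>From modulus at most \<open>R\<close>, a displacement below
          \<open>R\<close> cannot reach modulus \<open>2 * R\<close>.\<close>
        have "s k + u \<le> exit_time (2 * R) x"
        proof (rule ccontr)
          let ?\<tau> = "exit_time (2 * R) x"
          assume "\<not> ?thesis"
          then have lt: "?\<tau> < s k + u" by simp
          have big: "cmod (x ?\<tau>) \<ge> 2 * R" by (rule at_exit_time[OF x(1,2)])
          show False
          proof (cases "?\<tau> \<le> s k")
            case True
            then have "cmod (x ?\<tau>) \<le> R"
              using sk by (intro norm_le_until_exit[OF x(1) hR x(3) exit_time_nonneg]) simp
            then show False using big R by simp
          next
            case False
            then have "cmod (incr_path (s k) x (?\<tau> - s k)) < R" using lt u by (intro small) auto
            then have "cmod (x ?\<tau> - x (s k)) < R" by (simp add: incr_path_def)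
            then show False using big xs norm_triangle_ineq2[of "x ?\<tau>" "x (s k)"] by linarith
          qed
        qed
        then have "s k + u \<in> {0..exit_time (2 * R) x}" using s[of k] u by auto
        then have "x (s k + u) \<noteq> d * y t" using x(4) d t unfolding nonint_def by blast
        then show False using eq by (simp add: incr_path_def)
      qed
      then show "x \<in> {x \<in> path_set. \<exists>k. x \<in> A k \<and> (\<forall>j<k. x \<notin> A j) \<and> (x (s k), incr_path (s k) x) \<in> B}"
        using x(1) k v by (auto simp: B_def space_pair_measure)
    qed
    then show "emeasure (Px 1) {x \<in> path_set. hits (2 * R) x \<and> cmod (x 0) \<le> R
        \<and> nonint D (2 * R) x y \<and> near_grid D' R \<delta> n x y} \<le> ennreal \<epsilon>"
      using order_trans[OF emeasure_mono fp(1)] fp(2) by simp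
  qed
qed

text \<open>The second path is frozen. The bound of \<open>regularity_grid\<close> is uniform in the
  grid and the events increase with it, so it holds for their union; then \<open>\<epsilon>\<close>
  tends to 0.\<close>

lemma AE_not_touching_section:
  assumes y: "y \<in> path_set" and R: "R > 0"
    and D: "countable D" "D' \<subseteq> D" "\<And>d. d \<in> D' \<Longrightarrow> cmod d \<ge> b" and b: "b > 0"
  shows "AE x in Px 1. \<not> touching D D' R x y"
proof (cases "hits (2 * R) y \<and> cmod (y 0) \<le> R")
  case True
  interpret P: prob_space "Px 1" by (rule prob_space_Px) simp
  have D'c: "countable D'" using D by (meson countable_subset)
  have sec: "{x \<in> path_set. Q (x, y)} \<in> sets (Px 1)"
    if "Measurable.pred (paths \<Otimes>\<^sub>M paths) Q" for Q
  proof -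
    have "{p \<in> space (paths \<Otimes>\<^sub>M paths). Q p} \<in> sets (paths \<Otimes>\<^sub>M paths)" using that by (simp add: pred_def)
    from sets_Pair2[OF this, of y]
    have "(\<lambda>x. (x, y)) -` {p \<in> space (paths \<Otimes>\<^sub>M paths). Q p} \<in> sets paths" .
    also have "(\<lambda>x. (x, y)) -` {p \<in> space (paths \<Otimes>\<^sub>M paths). Q p} = {x \<in> path_set. Q (x, y)}"
      using y by (auto simp: space_pair_measure)
    finally show ?thesis by simp
  qed
  let ?T = "{x \<in> path_set. touching D D' R x y}"
  have T: "?T \<in> sets (Px 1)" using sec[OF pred_touching[OF D(1) D'c, of R]] by simp
  have "emeasure (Px 1) ?T \<le> ennreal \<epsilon>" if \<epsilon>: "\<epsilon> > 0" for \<epsilon>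
  proof -
    from True have y': "hits (2 * R) y" "cmod (y 0) \<le> R" by auto
    obtain \<delta> where \<delta>: "\<delta> > 0" "\<And>n. emeasure (Px 1) {x \<in> path_set. hits (2 * R) x \<and> cmod (x 0) \<le> R
     \<and> nonint D (2 * R) x y \<and> near_grid D' R \<delta> n x y} \<le> ennreal \<epsilon>"
      by (rule regularity_grid[OF y y' R D b \<epsilon>], assumption, rule that)
    define G where "G n = {x \<in> path_set. hits (2 * R) x \<and> cmod (x 0) \<le> R \<and> nonint D (2 * R) x y \<and> near_grid D' R \<delta> n x y}" for n
    have G: "G n \<in> sets (Px 1)" for n
    proof -
      have "Measurable.pred (paths \<Otimes>\<^sub>M paths) (\<lambda>p. (hits (2 * R) (fst p) \<and> hits (2 * R) (snd p) \<and> cmod (fst p 0) \<le> R \<and> cmod (snd p 0) \<le> R)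
         \<and> nonint D (2 * R) (fst p) (snd p) \<and> near_grid D' R \<delta> n (fst p) (snd p))"
        by (intro pred_intros_logic pred_hits_norm pred_nonint[OF D(1)] pred_near_grid[OF D'c])
      from sec[OF this] show ?thesis using y' by (simp add: G_def conj_assoc)
    qed
    have inc: "incseq G" by (rule incseq_SucI) (auto simp: G_def intro: near_grid_Suc)
    obtain m :: nat where m: "1 / real (Suc m) < \<delta>" using nat_approx_posE[OF \<delta>(1)] by auto
    have "?T \<subseteq> (\<Union>n. G n)"
    proof
      fix x assume x: "x \<in> ?T"
      then obtain n where "near_grid D' R (1 / real (Suc m)) n x y" by (auto simp: touching_def)
      then have "near_grid D' R \<delta> n x y" using m unfolding near_grid_def by (meson less_trans)
      then show "x \<in> (\<Union>n. G n)" using x by (auto simp: G_def touching_def)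
    qed
    then have "emeasure (Px 1) ?T \<le> emeasure (Px 1) (\<Union>n. G n)" using G by (intro emeasure_mono) auto
    also have "\<dots> = (SUP n. emeasure (Px 1) (G n))"
      using G inc by (intro SUP_emeasure_incseq[symmetric]) auto
    also have "\<dots> \<le> ennreal \<epsilon>" using \<delta>(2) by (intro SUP_least) (simp add: G_def)
    finally show ?thesis .
  qed
  note small = this
  have "emeasure (Px 1) ?T \<le> 0"
  proof (rule ennreal_le_epsilon)
    fix e :: real assume "0 < e"
    from small[OF this] show "emeasure (Px 1) ?T \<le> 0 + ennreal e" by (simp only: add_0)
  qed
  then show ?thesis
    using T by (subst AE_iff_measurable[OF T]) auto
qed (auto simp: touching_def)

lemma AE_not_touching:
  assumes R: "R > 0" and D: "countable D" "D' \<subseteq> D" "\<And>d. d \<in> D' \<Longrightarrow> cmod d \<ge> b" and b: "b > 0"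
  shows "AE p in Px2. \<not> touching D D' R (fst p) (snd p)"
proof -
  interpret pair_prob_space "Px 1" "Px 1" by (rule pair_prob_space_Px) simp
  have D'c: "countable D'" using D by (meson countable_subset)
  have "{p \<in> space (paths \<Otimes>\<^sub>M paths). touching D D' R (fst p) (snd p)} \<in> sets (paths \<Otimes>\<^sub>M paths)"
    using pred_touching[OF D(1) D'c, of R] by (simp add: pred_def)
  then have "space (paths \<Otimes>\<^sub>M paths) - {p \<in> space (paths \<Otimes>\<^sub>M paths). touching D D' R (fst p) (snd p)} \<in> sets (paths \<Otimes>\<^sub>M paths)"
    by (rule sets.Diff[OF sets.top])
  also have "space (paths \<Otimes>\<^sub>M paths) - {p \<in> space (paths \<Otimes>\<^sub>M paths). touching D D' R (fst p) (snd p)}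
      = {p \<in> space Px2. \<not> touching D D' R (fst p) (snd p)}"
    by (auto simp: space_pair_measure)
  finally have m: "{p \<in> space Px2. \<not> touching D D' R (fst p) (snd p)} \<in> sets Px2" by (simp only: sets_Px2)
  have "AE y in Px 1. AE x in Px 1. \<not> touching D D' R x y"
    by (rule AE_I2, rule AE_not_touching_section[OF _ R D b]) simp_all
  then have "AE x in Px 1. AE y in Px 1. \<not> touching D D' R x y"
    using AE_commute[OF m] by simp
  then have "AE x in Px 1. AE y in Px 1. \<not> touching D D' R (fst (x, y)) (snd (x, y))" by simp
  then show ?thesis by (rule AE_pair_measure[OF m])
qed

text \<open>Three approximations of accuracy \<open>\<delta> / 3\<close>: the dilation by a point of
  \<open>D'\<close>, the time of \<open>y\<close> by a rational fraction, and the time of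
  \<open>x\<close> by a dyadic point from below, which keeps it before the exit.\<close>

lemma near_grid_of_intersection:
  assumes x: "x \<in> path_set" and y: "y \<in> path_set"
    and s: "0 \<le> s" "s \<le> exit_time R x" and t: "0 \<le> t" "t \<le> exit_time R y"
    and eq: "x s = a * y t" and a: "a \<in> closure D'" and \<delta>: "\<delta> > 0"
  shows "\<exists>n. near_grid D' R \<delta> n x y"
proof -
  have cx: "continuous_on {0..} x" and cy: "continuous_on {0..} y" using x y by (auto simp: path_set_def)
  \<comment> \<open>The summand 1 keeps the denominator positive when
    \<open>y t = 0\<close>.\<close>
  have "\<delta> / (3 * (1 + cmod (y t))) > 0"
    using \<delta> by (intro divide_pos_pos mult_pos_pos add_pos_nonneg) auto
  then obtain d where d: "d \<in> D'" "dist d a < \<delta> / (3 * (1 + cmod (y t)))"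
    using a by (meson closure_approachable)
  have ad: "cmod (a * y t - d * y t) < \<delta> / 3"
  proof -
    have "cmod (a * y t - d * y t) = dist d a * cmod (y t)"
      by (simp add: dist_norm norm_mult[symmetric] left_diff_distrib norm_minus_commute)
    also have "\<dots> \<le> dist d a * (1 + cmod (y t))" by (intro mult_left_mono) auto
    also have "\<dots> < \<delta> / (3 * (1 + cmod (y t))) * (1 + cmod (y t))"
      using d(2) by (intro mult_strict_right_mono) (auto intro: add_pos_nonneg)
    also have "\<dots> = \<delta> / 3"
    proof -
      have "1 + cmod (y t) \<noteq> 0" using norm_ge_zero[of "y t"] by linarith
      then show ?thesis by (simp add: divide_simps)
    qed
    finally show ?thesis .
  qed
  obtain q where q: "q \<in> \<rat> \<inter> {0..1}" "cmod (d * y t - d * y (q * exit_time R y)) < \<delta> / 3"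
  proof -
    obtain u where u: "u \<in> {0..1}" "t = u * exit_time R y"
      using unit_interval_mult_image[OF exit_time_nonneg, of R y] t by fastforce
    have "continuous_on {0..1} (\<lambda>u. d * y (u * exit_time R y))"
      by (intro continuous_intros continuous_on_compose2[OF cy])
         (auto intro!: mult_nonneg_nonneg exit_time_nonneg)
    then obtain e where e: "e > 0" "\<And>w. w \<in> {0..1} \<Longrightarrow> dist w u < e \<Longrightarrow> dist (d * y (w * exit_time R y)) (d * y (u * exit_time R y)) < \<delta> / 3"
      using u(1) \<delta> unfolding continuous_on_iff by (metis divide_pos_pos zero_less_numeral)
    obtain q where "q \<in> \<rat> \<inter> {0..1}" "dist q u < e"
      using closure_rat_interval u(1) e(1) by (meson closure_approachable subsetD)
    then show thesis using that[of q] e(2)[of q] u(2) by (simp add: dist_norm norm_minus_commute)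
  qed
  obtain n k :: nat where nk: "real k / 2 ^ n \<le> s" "cmod (x (real k / 2 ^ n) - x s) < \<delta> / 3"
  proof -
    obtain e where e: "e > 0" "\<And>w. w \<in> {0..} \<Longrightarrow> dist w s < e \<Longrightarrow> dist (x w) (x s) < \<delta> / 3"
      using cx s(1) \<delta> unfolding continuous_on_iff by (metis atLeast_iff divide_pos_pos zero_less_numeral)
    obtain n where n: "(1 / 2) ^ n < e" using real_arch_pow_inv[OF e(1), of "1 / 2"] by auto
    define k where "k = nat \<lfloor>2 ^ n * s\<rfloor>"
    have k: "real k = of_int \<lfloor>2 ^ n * s\<rfloor>" using s(1) by (simp add: k_def)
    have "real k \<le> 2 ^ n * s" unfolding k by linarith
    then have le: "real k / 2 ^ n \<le> s" by (simp add: divide_le_eq mult.commute)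
    have "(2 ^ n * s - 1) / 2 ^ n \<le> real k / 2 ^ n" unfolding k by (intro divide_right_mono) (linarith, simp)
    then have "s - real k / 2 ^ n \<le> (1 / 2) ^ n" by (simp add: diff_divide_distrib power_divide)
    then have "dist (real k / 2 ^ n) s < e" using n le by (simp add: dist_real_def)
    then show thesis using that[OF le] e(2)[of "real k / 2 ^ n"] by (simp add: dist_norm)
  qed
  have "cmod (x (real k / 2 ^ n) - d * y (q * exit_time R y))
      \<le> cmod (x (real k / 2 ^ n) - x s) + cmod (a * y t - d * y t) + cmod (d * y t - d * y (q * exit_time R y))"
  proof -
    have "x (real k / 2 ^ n) - d * y (q * exit_time R y)
        = (x (real k / 2 ^ n) - x s) + (a * y t - d * y t) + (d * y t - d * y (q * exit_time R y))"
      using eq by simp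
    moreover have "cmod (p + q + r) \<le> cmod p + cmod q + cmod r" for p q r :: complex
      using norm_triangle_ineq[of "p + q" r] norm_triangle_ineq[of p q] by linarith
    ultimately show ?thesis by (simp only:)
  qed
  then have "cmod (x (real k / 2 ^ n) - d * y (q * exit_time R y)) < \<delta>" using nk ad q by simp
  then have "near_grid D' R \<delta> n x y"
    unfolding near_grid_def using nk(1) s(2) d(1) q(1)
    by (intro exI[of _ k] conjI bexI[of _ d] bexI[of _ q]) auto
  then show ?thesis ..
qed

text \<open>If the two paths met for a dilation in the closure of \<open>D\<close>, then near the first contact the
  first path would immediately hit nearby dilated copies of the second one.\<close>

theorem nonint_regularity:
  assumes R: "R \<ge> 1" and D: "countable D" "A \<subseteq> closure D" "0 \<in> A \<Longrightarrow> 0 \<in> D"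
  shows "AE p in Px2. nonint D (2 * R) (fst p) (snd p) \<longrightarrow> nonint A R (fst p) (snd p)"
proof -
  \<comment> \<open>Small dilations shrink the copy of the second path, so no uniform hitting
    estimate covers all of \<open>D\<close>. The countably many sets \<open>?D i\<close> have moduli
    bounded below and together contain every nonzero element.\<close>
  let ?D = "\<lambda>i::nat. {d \<in> D. cmod d \<ge> 1 / real (Suc i)}"
  have "AE p in Px2. \<not> touching D (?D i) R (fst p) (snd p)" for i
    by (rule AE_not_touching[where b="1 / real (Suc i)"]) (use R D(1) in auto)
  then have "AE p in Px2. \<forall>i. \<not> touching D (?D i) R (fst p) (snd p)" by (simp add: AE_all_countable)
  moreover note AE_hits_pair[OF zero_le_one, of "2 * R"]
  moreover have "AE p in Px2. cmod (fst p 0) \<le> R \<and> cmod (snd p 0) \<le> R"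
  proof -
    interpret pair_prob_space "Px 1" "Px 1" by (rule pair_prob_space_Px) simp
    have [measurable]: "(\<lambda>x. x 0) \<in> borel_measurable (Px 1)" by (simp add: measurable_eval_path)
    have "AE z in distr (Px 1) borel (\<lambda>x. x 0). cmod z = 1"
      unfolding brownianD(3)[OF brownian_Px[OF zero_le_one]] by (rule AE_circ) simp
    then have "AE x in Px 1. cmod (x 0) = 1" by (subst (asm) AE_distr_iff) auto
    then have n: "AE x in Px 1. cmod (x 0) \<le> R" by eventually_elim (use R in simp)
    then have n2: "AE x in Px 1. AE y in Px 1. cmod (fst (x, y) 0) \<le> R \<and> cmod (snd (x, y) 0) \<le> R"
      by eventually_elim (use n in simp)
    have [measurable]: "(\<lambda>p. fst p 0) \<in> borel_measurable (paths \<Otimes>\<^sub>M paths)" "(\<lambda>p. snd p 0) \<in> borel_measurable (paths \<Otimes>\<^sub>M paths)"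
      by (auto intro!: measurable_path_at[where t=0])
    have "{p \<in> space (paths \<Otimes>\<^sub>M paths). cmod (fst p 0) \<le> R \<and> cmod (snd p 0) \<le> R} \<in> sets (paths \<Otimes>\<^sub>M paths)"
      by measurable
    then have "{p \<in> space Px2. cmod (fst p 0) \<le> R \<and> cmod (snd p 0) \<le> R} \<in> sets Px2"
    proof -
      assume "{p \<in> space (paths \<Otimes>\<^sub>M paths). cmod (fst p 0) \<le> R \<and> cmod (snd p 0) \<le> R} \<in> sets (paths \<Otimes>\<^sub>M paths)"
      moreover have "space Px2 = space (paths \<Otimes>\<^sub>M paths)" by (simp add: space_pair_measure)
      ultimately show ?thesis by (simp only: sets_Px2)
    qed
    then show ?thesis using n2 by (rule AE_pair_measure)
  qed
  ultimately show ?thesis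
  proof eventually_elim
    case (elim p)
    obtain x y where p: "p = (x, y)" by (cases p)
    show ?case
      unfolding p fst_conv snd_conv
    proof
      assume n: "nonint D (2 * R) x y"
      have hx: "x \<in> path_set" "hits (2 * R) x" and hy: "y \<in> path_set" "hits (2 * R) y" using elim p by auto
      show "nonint A R x y"
        unfolding nonint_def
      proof (intro ballI notI)
        fix s t a assume s: "s \<in> {0..exit_time R x}" and t: "t \<in> {0..exit_time R y}" and a: "a \<in> A" and eq: "x s = a * y t"
        have "nonint D R x y" using nonint_mono[OF hx(1) hy(1) hx(2) hy(2) _ n] R by simp
        then have "a \<noteq> 0" using D(3) a eq s t unfolding nonint_def by blast
        then obtain i :: nat where i: "1 / real (Suc i) < cmod a" using nat_approx_posE[of "cmod a"] by auto
        \<comment> \<open>Since \<open>cmod a\<close> exceeds the threshold strictly, the points of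
          \<open>D\<close> close to \<open>a\<close> exceed it as well.\<close>
        have "a \<in> closure (?D i)"
          unfolding closure_approachable
        proof (intro allI impI)
          fix e :: real assume e: "e > 0"
          have "min e (cmod a - 1 / real (Suc i)) > 0" using e i by simp
          then obtain d where d: "d \<in> D" "dist d a < min e (cmod a - 1 / real (Suc i))"
            using D(2) a by (meson closure_approachable subsetD)
          then have "cmod d \<ge> 1 / real (Suc i)"
            using norm_triangle_ineq2[of a d] by (simp add: dist_norm norm_minus_commute)
          then show "\<exists>d\<in>?D i. dist d a < e" using d by auto
        qed
        then have "\<exists>n. near_grid (?D i) R \<delta> n x y" if "\<delta> > 0" for \<delta>
          using near_grid_of_intersection[OF hx(1) hy(1) _ _ _ _ eq _ that] s t by auto
        then have "touching D (?D i) R x y"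
          using elim p n unfolding touching_def by auto
        then show False using elim p by auto
      qed
    qed
  qed
qed

end

section \<open>Existence of the exponent\<close>

text \<open>Fekete's lemma for a real variable: monotonicity compares \<open>G x\<close> with the
  value at the largest multiple of \<open>a\<close> below \<open>x\<close>, and subadditivity bounds
  that value by the same multiple of \<open>G a\<close>.\<close>

lemma subadditive_antimono_limit:
  fixes G :: "real \<Rightarrow> real"
  assumes sub: "\<And>x y. x \<ge> 1 \<Longrightarrow> y \<ge> 1 \<Longrightarrow> G (x + y) \<le> G x + G y"
    and anti: "\<And>x y. 1 \<le> x \<Longrightarrow> x \<le> y \<Longrightarrow> G y \<le> G x"
    and lower: "\<And>x. x \<ge> 1 \<Longrightarrow> b * x \<le> G x"
  shows "\<exists>L. ((\<lambda>x. G x / x) \<longlongrightarrow> L) at_top"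
proof -
  define L where "L = (INF x\<in>{1..}. G x / x)"
  have bdd: "bdd_below ((\<lambda>x. G x / x) ` {1..})"
    using lower by (intro bdd_belowI[of _ b]) (auto simp: field_simps)
  have ge: "L \<le> G x / x" if "x \<ge> 1" for x
    unfolding L_def using bdd that by (intro cINF_lower) auto
  have iter: "G (real (Suc n) * a) \<le> real (Suc n) * G a" if a: "a \<ge> 1" for n a
  proof (induction n)
    case (Suc n)
    have "1 * 1 \<le> real (Suc n) * a" using a by (intro mult_mono) auto
    then have "G (real (Suc n) * a + a) \<le> G (real (Suc n) * a) + G a" using a by (intro sub) auto
    then show ?case using Suc by (simp add: algebra_simps)
  qed simp
  have up: "G x / x \<le> G a / a + \<bar>G a\<bar> / x" if a: "a \<ge> 1" and x: "x \<ge> a" for a x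
  proof -
    define n where "n = nat \<lfloor>x / a\<rfloor>"
    have "x / a \<ge> 1" using a x by simp
    then have n: "real n = of_int \<lfloor>x / a\<rfloor>" "n \<ge> 1" by (simp_all add: n_def le_nat_iff)
    have nl: "real n \<le> x / a" "x / a - 1 \<le> real n" unfolding n by linarith+
    have "real n * a \<le> x" using nl(1) a by (simp add: field_simps)
    moreover have "1 * 1 \<le> real n * a" using a n(2) by (intro mult_mono) auto
    ultimately have "G x \<le> G (real n * a)" by (intro anti) auto
    also have "\<dots> \<le> real n * G a" using iter[OF a, of "n - 1"] n(2) by simp
    \<comment> \<open>Rounding \<open>x / a\<close> down costs at most
      \<open>\<bar>G a\<bar>\<close>, and only when \<open>G a\<close> is negative.\<close>
    also have "\<dots> \<le> x / a * G a + \<bar>G a\<bar>"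
    proof (cases "G a \<ge> 0")
      case True
      then have "real n * G a \<le> x / a * G a" using nl(1) by (intro mult_right_mono) auto
      then show ?thesis using True by simp
    next
      case False
      then have "real n * G a \<le> (x / a - 1) * G a" using nl(2) by (intro mult_right_mono_neg) auto
      then show ?thesis using False by (simp add: algebra_simps)
    qed
    finally have "G x / x \<le> (x / a * G a + \<bar>G a\<bar>) / x" using a x by (intro divide_right_mono) auto
    also have "\<dots> = G a / a + \<bar>G a\<bar> / x" using a x by (simp add: add_divide_distrib)
    finally show ?thesis .
  qed
  have "((\<lambda>x. G x / x) \<longlongrightarrow> L) at_top"
  proof (rule order_tendstoI)
    fix l assume "l < L"
    then show "eventually (\<lambda>x. l < G x / x) at_top"
      using ge by (intro eventually_mono[OF eventually_ge_at_top[of 1]]) (auto intro: less_le_trans)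
  next
    fix u assume "L < u"
    then obtain a where a: "a \<ge> 1" "G a / a < u"
      unfolding L_def using bdd cINF_less_iff[of "{1..}" "\<lambda>x. G x / x" u] by auto
    have "((\<lambda>x. G a / a + \<bar>G a\<bar> / x) \<longlongrightarrow> G a / a + 0) at_top"
      by (intro tendsto_add tendsto_const tendsto_divide_0[OF tendsto_const] filterlim_at_top_imp_at_infinity filterlim_ident)
    then have "eventually (\<lambda>x. G a / a + \<bar>G a\<bar> / x < u) at_top"
      using a(2) by (intro order_tendstoD(2)) auto
    then show "eventually (\<lambda>x. G x / x < u) at_top"
      using eventually_ge_at_top[of a] by eventually_elim (use up[OF a(1)] in \<open>auto intro: le_less_trans\<close>)
  qed
  then show ?thesis ..
qed

lemma submultiplicative_log_limit:
  fixes p :: "real \<Rightarrow> real"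
  assumes K: "K \<ge> 1"
    and sub: "\<And>R R'. R \<ge> 1 \<Longrightarrow> R' \<ge> 1 \<Longrightarrow> p (2 * R * R') \<le> K * p R * p R'"
    and anti: "\<And>R R'. 1 \<le> R \<Longrightarrow> R \<le> R' \<Longrightarrow> p R' \<le> p R"
    and c: "c > 0" and C: "C > 0" and lower: "\<And>R. R \<ge> 1 \<Longrightarrow> c * R powr (- C) \<le> p R"
  shows "\<exists>L. ((\<lambda>R. ln (p R) / ln R) \<longlongrightarrow> L) at_top"
proof -
  have pos: "p R > 0" if "R \<ge> 1" for R
    using lower[OF that] c that by (smt (verit) mult_pos_pos powr_gt_zero)
  have ln2: "0 < ln (2::real)" "ln (2::real) \<le> 1" using ln_le_minus_one[of "2::real"] by auto
  \<comment> \<open>The shift by \<open>ln 2\<close> absorbs the factor 2 of the radius and the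
    summand \<open>ln K\<close> absorbs the constant, so that \<open>G\<close> is exactly
    subadditive.\<close>
  define G where "G x = ln (p (exp (x - ln 2))) + ln K" for x
  have e1: "exp (x - ln 2) \<ge> 1" if "x \<ge> 1" for x :: real using that ln2 by simp
  have "\<exists>L. ((\<lambda>x. G x / x) \<longlongrightarrow> L) at_top"
  proof (rule subadditive_antimono_limit[where b="- \<bar>ln c\<bar> - C"])
    fix x y :: real assume x: "x \<ge> 1" and y: "y \<ge> 1"
    have eq: "2 * exp (x - ln 2) * exp (y - ln 2) = exp (x + y - ln 2)"
      by (simp add: exp_diff exp_add)
    have "p (exp (x + y - ln 2)) \<le> K * p (exp (x - ln 2)) * p (exp (y - ln 2))"
      using sub[OF e1[OF x] e1[OF y]] unfolding eq .
    then have "ln (p (exp (x + y - ln 2))) \<le> ln (K * p (exp (x - ln 2)) * p (exp (y - ln 2)))"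
      using x y ln2 by (intro ln_mono pos) auto
    also have "\<dots> = ln K + ln (p (exp (x - ln 2))) + ln (p (exp (y - ln 2)))"
      using K pos[OF e1[OF x]] pos[OF e1[OF y]] by (simp add: ln_mult)
    finally show "G (x + y) \<le> G x + G y" by (simp add: G_def)
  next
    fix x y :: real assume x: "1 \<le> x" "x \<le> y"
    have "p (exp (y - ln 2)) \<le> p (exp (x - ln 2))" using x e1[OF x(1)] by (intro anti) auto
    moreover have "p (exp (y - ln 2)) > 0" using x by (intro pos e1) auto
    ultimately show "G y \<le> G x" by (simp add: G_def)
  next
    fix x :: real assume x: "x \<ge> 1"
    have "c * exp (x - ln 2) powr (- C) \<le> p (exp (x - ln 2))" by (rule lower[OF e1[OF x]])
    then have "ln (c * exp (x - ln 2) powr (- C)) \<le> ln (p (exp (x - ln 2)))"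
      using c by (intro ln_mono) auto
    also have "ln (c * exp (x - ln 2) powr (- C)) = ln c - C * (x - ln 2)"
      using c by (simp add: ln_mult ln_powr)
    finally have "ln c - C * (x - ln 2) \<le> ln (p (exp (x - ln 2)))" .
    moreover have "ln K \<ge> 0" using K by simp
    ultimately have "ln c - C * (x - ln 2) \<le> G x" unfolding G_def by linarith
    moreover have "(- \<bar>ln c\<bar> - C) * x \<le> ln c - C * (x - ln 2)"
    proof -
      have "- \<bar>ln c\<bar> * x \<le> ln c" using x mult_left_mono[of 1 x "\<bar>ln c\<bar>"] by simp
      moreover have "0 \<le> C * ln 2" using C ln2 by simp
      ultimately show ?thesis by (simp add: algebra_simps)
    qed
    ultimately show "(- \<bar>ln c\<bar> - C) * x \<le> G x" by linarith
  qed
  then obtain L where L: "((\<lambda>x. G x / x) \<longlongrightarrow> L) at_top" ..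
  have lim: "filterlim (\<lambda>R. ln R + ln 2) at_top (at_top :: real filter)"
    by (rule filterlim_tendsto_add_at_top[OF tendsto_const ln_at_top, of "ln 2", unfolded add.commute[of "ln 2"]])
  have "((\<lambda>R. G (ln R + ln 2) / (ln R + ln 2)) \<longlongrightarrow> L) at_top"
    by (rule filterlim_compose[OF L lim])
  moreover have inf: "filterlim (\<lambda>R::real. ln R) at_infinity at_top"
    by (rule filterlim_at_top_imp_at_infinity[OF ln_at_top])
  have "((\<lambda>R::real. 1 + ln 2 / ln R) \<longlongrightarrow> 1 + 0) at_top"
    by (intro tendsto_add tendsto_const tendsto_divide_0[OF tendsto_const inf])
  moreover have "((\<lambda>R::real. ln K / ln R) \<longlongrightarrow> 0) at_top"
    by (intro tendsto_divide_0[OF tendsto_const inf])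
  \<comment> \<open>Back at \<open>x = ln R + ln 2\<close>: the factor
    \<open>1 + ln 2 / ln R\<close> restores the denominator \<open>ln R\<close>, and subtracting
    \<open>ln K / ln R\<close> removes the added constant.\<close>
  ultimately have "((\<lambda>R. G (ln R + ln 2) / (ln R + ln 2) * (1 + ln 2 / ln R) - ln K / ln R) \<longlongrightarrow> L * (1 + 0) - 0) at_top"
    by (intro tendsto_diff tendsto_mult)
  moreover have "eventually (\<lambda>R. G (ln R + ln 2) / (ln R + ln 2) * (1 + ln 2 / ln R) - ln K / ln R = ln (p R) / ln R) at_top"
    using eventually_gt_at_top[of 1]
  proof eventually_elim
    case (elim R)
    then have l: "ln R > 0" by simp
    have "G (ln R + ln 2) / (ln R + ln 2) * (1 + ln 2 / ln R) = G (ln R + ln 2) / ln R"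
    proof -
      have "1 + ln 2 / ln R = (ln R + ln 2) / ln R" using l by (simp add: add_divide_distrib)
      moreover have "ln R + ln 2 \<noteq> 0" using l ln2 by linarith
      ultimately show ?thesis by simp
    qed
    then show ?case using elim by (simp add: G_def diff_divide_distrib[symmetric])
  qed
  ultimately have "((\<lambda>R. ln (p R) / ln R) \<longlongrightarrow> L * (1 + 0) - 0) at_top"
    by (rule Lim_transform_eventually)
  then show ?thesis by blast
qed

section \<open>From the given processes to path space\<close>

lemma (in prob_space) brownian_of_planar_brownian_motion:
  assumes B: "planar_brownian_motion B"
  obtains X where "brownian M (distr M borel (B 0)) X" "AE \<omega> in M. \<forall>t\<ge>0. X \<omega> t = B t \<omega>"
proof -
  have Bm: "\<And>t. t \<ge> 0 \<Longrightarrow> B t \<in> borel_measurable M"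
    and Bc: "AE \<omega> in M. continuous_on {0..} (\<lambda>t. B t \<omega>)"
    and Bi: "\<And>(n::nat) (t :: nat \<Rightarrow> real). t 0 = 0 \<and> (\<forall>i<n. t i < t (Suc i)) \<Longrightarrow>
        indep_vars (\<lambda>_. borel) (\<lambda>i \<omega>. if i = 0 then B 0 \<omega> else B (t i) \<omega> - B (t (i - 1)) \<omega>) {0..n}"
    and Bd: "\<And>s t. 0 \<le> s \<and> s < t \<Longrightarrow> distributed M lborel (\<lambda>\<omega>. B t \<omega> - B s \<omega>)
          (\<lambda>z. ennreal (normal_density 0 (sqrt (t - s)) (Re z) * normal_density 0 (sqrt (t - s)) (Im z)))"
    using B unfolding planar_brownian_motion_def by blast+
  obtain N where N: "{\<omega> \<in> space M. \<not> continuous_on {0..} (\<lambda>t. B t \<omega>)} \<subseteq> N" "emeasure M N = 0" "N \<in> sets M"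
    using AE_E[OF Bc] by blast
  \<comment> \<open>Paths are set to 0 on a measurable null set that contains all discontinuous
    ones, so that \<open>X\<close> takes values in \<open>path_set\<close> everywhere.\<close>
  define X where "X \<omega> t = (if \<omega> \<in> N then 0 else B t \<omega>)" for \<omega> t
  have "AE \<omega> in M. \<omega> \<notin> N" using N by (intro AE_not_in) (auto simp: null_sets_def)
  then have eq: "AE \<omega> in M. \<forall>t\<ge>0. X \<omega> t = B t \<omega>"
    by eventually_elim (simp add: X_def)
  have X_meas: "X \<in> M \<rightarrow>\<^sub>M paths"
  proof (rule measurable_pathsI)
    show "continuous_on {0..} (X \<omega>)" if "\<omega> \<in> space M" for \<omega>
      using that N(1) unfolding X_def by (cases "\<omega> \<in> N") auto
    show "(\<lambda>\<omega>. X \<omega> t) \<in> borel_measurable M" if "t \<ge> 0" for t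
      unfolding X_def using N(3) Bm[OF that] by measurable
  qed
  note Xt [measurable] = measurable_path_at[OF X_meas]
  have "brownian M (distr M borel (B 0)) X"
    unfolding brownian_def
  proof (intro conjI allI impI)
    show "distr M borel (\<lambda>\<omega>. X \<omega> 0) = distr M borel (B 0)"
      by (rule distr_cong_AE) (use eq Bm Xt in auto)
    fix n t assume t: "increasing_times n t"
    have D: "indep_vars (\<lambda>_. borel) (\<lambda>i \<omega>. if i = 0 then B 0 \<omega> else B (t i) \<omega> - B (t (i - 1)) \<omega>) {0..n}"
      by (rule Bi) (use t in \<open>simp add: increasing_times_def\<close>)
    have m1: "(\<lambda>\<omega>. path_increments t (X \<omega>) i) \<in> borel_measurable M"
      and m2: "(\<lambda>\<omega>. if i = 0 then B 0 \<omega> else B (t i) \<omega> - B (t (i - 1)) \<omega>) \<in> borel_measurable M"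
      if "i \<in> {0..n}" for i
      using that increasing_times_nonneg[OF t, of i] increasing_times_nonneg[OF t, of "i - 1"] Bm
      unfolding path_increments_def by (cases "i = 0"; auto)+
    have eqD: "AE \<omega> in M. \<forall>i\<in>{0..n}. path_increments t (X \<omega>) i = (if i = 0 then B 0 \<omega> else B (t i) \<omega> - B (t (i - 1)) \<omega>)"
      using eq
    proof eventually_elim
      case (elim \<omega>)
      then show ?case
        using increasing_times_nonneg[OF t] unfolding path_increments_def by auto
    qed
    have "distr M (Pi\<^sub>M {0..n} (\<lambda>_. borel)) (\<lambda>\<omega>. \<lambda>i\<in>{0..n}. path_increments t (X \<omega>) i)
        = distr M (Pi\<^sub>M {0..n} (\<lambda>_. borel)) (\<lambda>\<omega>. \<lambda>i\<in>{0..n}. if i = 0 then B 0 \<omega> else B (t i) \<omega> - B (t (i - 1)) \<omega>)"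
    proof (rule distr_cong_AE)
      show "AE \<omega> in M. (\<lambda>i\<in>{0..n}. path_increments t (X \<omega>) i) = (\<lambda>i\<in>{0..n}. if i = 0 then B 0 \<omega> else B (t i) \<omega> - B (t (i - 1)) \<omega>)"
        using eqD by eventually_elim (auto simp: fun_eq_iff restrict_def)
    qed (auto intro!: measurable_restrict m1 m2)
    also have "\<dots> = Pi\<^sub>M {0..n} (\<lambda>i. distr M borel (\<lambda>\<omega>. if i = 0 then B 0 \<omega> else B (t i) \<omega> - B (t (i - 1)) \<omega>))"
      using D by (subst (asm) indep_vars_iff_distr_eq_PiM') (auto intro: m2)
    also have "\<dots> = Pi\<^sub>M {0..n} (\<lambda>i. distr M borel (\<lambda>\<omega>. path_increments t (X \<omega>) i))"
    proof (rule PiM_cong[OF refl])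
      fix i assume i: "i \<in> {0..n}"
      show "distr M borel (\<lambda>\<omega>. if i = 0 then B 0 \<omega> else B (t i) \<omega> - B (t (i - 1)) \<omega>) = distr M borel (\<lambda>\<omega>. path_increments t (X \<omega>) i)"
      proof (rule distr_cong_AE[OF refl refl _ m2[OF i] m1[OF i]])
        show "AE \<omega> in M. (if i = 0 then B 0 \<omega> else B (t i) \<omega> - B (t (i - 1)) \<omega>) = path_increments t (X \<omega>) i"
          using eqD by eventually_elim (use i in simp)
      qed
    qed
    finally show "indep_vars (\<lambda>_. borel) (\<lambda>i \<omega>. path_increments t (X \<omega>) i) {0..n}"
      by (subst indep_vars_iff_distr_eq_PiM') (auto intro: m1)
  next
    fix s t :: real assume st: "0 \<le> s \<and> s < t"
    have "distr M borel (\<lambda>\<omega>. X \<omega> t - X \<omega> s) = distr M lborel (\<lambda>\<omega>. B t \<omega> - B s \<omega>)"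
      by (rule distr_cong_AE) (use eq Bm Xt st in \<open>auto intro!: borel_measurable_diff\<close>)
    also have "\<dots> = density lborel (\<lambda>z. ennreal (normal_density 0 (sqrt (t - s)) (Re z) * normal_density 0 (sqrt (t - s)) (Im z)))"
      by (rule distributed_distr_eq_density[OF Bd[OF st], symmetric, symmetric])
    also have "\<dots> = gauss (t - s)"
      using st by (simp only: normal_density_product gauss_def diff_gt_0_iff_gt)
    finally show "distr M borel (\<lambda>\<omega>. X \<omega> t - X \<omega> s) = gauss (t - s)" .
  qed (use X_meas prob_space_axioms in auto)
  then show thesis using that eq by blast
qed

text \<open>Independence is tested on cylinders, and the cylinder events of \<open>X1\<close> and
  \<open>X2\<close> agree almost surely with those of the given processes.\<close>

lemma (in prob_space) indep_paths_of_indep_processes: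
  assumes ind: "indep_processes B1 B2"
    and X1: "X1 \<in> M \<rightarrow>\<^sub>M paths" "AE \<omega> in M. \<forall>t\<ge>0. X1 \<omega> t = B1 t \<omega>"
    and X2: "X2 \<in> M \<rightarrow>\<^sub>M paths" "AE \<omega> in M. \<forall>t\<ge>0. X2 \<omega> t = B2 t \<omega>"
  shows "indep_var paths X1 paths X2"
proof (rule indep_var_pathsI[OF X1(1) X2(1)])
  let ?N = "Pi\<^sub>M {0::real..} (\<lambda>_. borel :: complex measure)"
  let ?B1 = "\<lambda>\<omega>. \<lambda>t\<in>{0..}. B1 t \<omega>" and ?B2 = "\<lambda>\<omega>. \<lambda>t\<in>{0..}. B2 t \<omega>"
  have ind': "indep_var ?N ?B1 ?N ?B2" using ind unfolding indep_processes_def .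
  have Bm: "?B1 \<in> M \<rightarrow>\<^sub>M ?N" "?B2 \<in> M \<rightarrow>\<^sub>M ?N"
    using ind' unfolding indep_var_eq by auto
  fix J J' :: "real set" and U U' :: "real \<Rightarrow> complex set"
  assume J: "finite J" "J \<subseteq> {0..}" "\<And>t. open (U t)" and J': "finite J'" "J' \<subseteq> {0..}" "\<And>t. open (U' t)"
  define S where "S J U = {f \<in> space ?N. \<forall>t\<in>J. f t \<in> U t}" for J :: "real set" and U :: "real \<Rightarrow> complex set"
  have S: "S J U \<in> sets ?N" if "finite J" "J \<subseteq> {0..}" "\<And>t. open (U t)" for J U
    unfolding S_def using that
    by (intro sets.sets_Collect_finite_All) (auto intro!: measurable_sets_Collect[OF measurable_component_singleton])
  have cyl: "{\<omega> \<in> space M. \<forall>t\<in>J. X \<omega> t \<in> U t} \<in> sets M"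
    if "X \<in> M \<rightarrow>\<^sub>M paths" "finite J" "J \<subseteq> {0..}" "\<And>t. open (U t)" for X J U
    using that by (intro sets.sets_Collect_finite_All) (auto intro!: measurable_sets_Collect[OF measurable_path_at[OF that(1)]])
  have eq: "prob {\<omega> \<in> space M. \<forall>t\<in>J. X \<omega> t \<in> U t} = prob ((\<lambda>\<omega>. \<lambda>t\<in>{0..}. B t \<omega>) -` S J U \<inter> space M)"
    if X: "X \<in> M \<rightarrow>\<^sub>M paths" "AE \<omega> in M. \<forall>t\<ge>0. X \<omega> t = B t \<omega>" and B: "(\<lambda>\<omega>. \<lambda>t\<in>{0..}. B t \<omega>) \<in> M \<rightarrow>\<^sub>M ?N"
      and J: "finite J" "J \<subseteq> {0..}" "\<And>t. open (U t)" for X B J U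
  proof (rule finite_measure_eq_AE)
    show "AE \<omega> in M. (\<omega> \<in> {\<omega> \<in> space M. \<forall>t\<in>J. X \<omega> t \<in> U t}) = (\<omega> \<in> (\<lambda>\<omega>. \<lambda>t\<in>{0..}. B t \<omega>) -` S J U \<inter> space M)"
      using X(2)
    proof eventually_elim
      case (elim \<omega>)
      have "(\<forall>t\<in>J. X \<omega> t \<in> U t) \<longleftrightarrow> (\<forall>t\<in>J. (\<lambda>t\<in>{0..}. B t \<omega>) t \<in> U t)"
        using elim J(2) by (intro ball_cong) auto
      then show ?case by (auto simp: S_def space_PiM)
    qed
  qed (use cyl[OF X(1) J] measurable_sets[OF B S[OF J]] in auto)
  have "prob {\<omega> \<in> space M. (\<forall>t\<in>J. X1 \<omega> t \<in> U t) \<and> (\<forall>t\<in>J'. X2 \<omega> t \<in> U' t)}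
      = prob ((\<lambda>\<omega>. (?B1 \<omega>, ?B2 \<omega>)) -` (S J U \<times> S J' U') \<inter> space M)"
  proof (rule finite_measure_eq_AE)
    show "AE \<omega> in M. (\<omega> \<in> {\<omega> \<in> space M. (\<forall>t\<in>J. X1 \<omega> t \<in> U t) \<and> (\<forall>t\<in>J'. X2 \<omega> t \<in> U' t)})
        = (\<omega> \<in> (\<lambda>\<omega>. (?B1 \<omega>, ?B2 \<omega>)) -` (S J U \<times> S J' U') \<inter> space M)"
      using X1(2) X2(2)
    proof eventually_elim
      case (elim \<omega>)
      have "(\<forall>t\<in>J. X1 \<omega> t \<in> U t) \<longleftrightarrow> (\<forall>t\<in>J. (\<lambda>t\<in>{0..}. B1 t \<omega>) t \<in> U t)"
        using elim J(2) by (intro ball_cong) auto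
      moreover have "(\<forall>t\<in>J'. X2 \<omega> t \<in> U' t) \<longleftrightarrow> (\<forall>t\<in>J'. (\<lambda>t\<in>{0..}. B2 t \<omega>) t \<in> U' t)"
        using elim J'(2) by (intro ball_cong) auto
      ultimately show ?case by (auto simp: S_def space_PiM)
    qed
    have "{\<omega> \<in> space M. (\<forall>t\<in>J. X1 \<omega> t \<in> U t) \<and> (\<forall>t\<in>J'. X2 \<omega> t \<in> U' t)}
        = {\<omega> \<in> space M. \<forall>t\<in>J. X1 \<omega> t \<in> U t} \<inter> {\<omega> \<in> space M. \<forall>t\<in>J'. X2 \<omega> t \<in> U' t}" by auto
    then show "{\<omega> \<in> space M. (\<forall>t\<in>J. X1 \<omega> t \<in> U t) \<and> (\<forall>t\<in>J'. X2 \<omega> t \<in> U' t)} \<in> events"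
      using cyl[OF X1(1) J] cyl[OF X2(1) J'] by auto
    show "(\<lambda>\<omega>. (?B1 \<omega>, ?B2 \<omega>)) -` (S J U \<times> S J' U') \<inter> space M \<in> events"
      by (rule measurable_sets[OF measurable_Pair[OF Bm]]) (use S[OF J] S[OF J'] in auto)
  qed
  also have "\<dots> = prob (?B1 -` S J U \<inter> space M) * prob (?B2 -` S J' U' \<inter> space M)"
    by (rule indep_varD[OF ind' S[OF J] S[OF J']])
  also have "prob (?B1 -` S J U \<inter> space M) = prob {\<omega> \<in> space M. \<forall>t\<in>J. X1 \<omega> t \<in> U t}"
    by (rule eq[OF X1 Bm(1) J, symmetric])
  also have "prob (?B2 -` S J' U' \<inter> space M) = prob {\<omega> \<in> space M. \<forall>t\<in>J'. X2 \<omega> t \<in> U' t}"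
    by (rule eq[OF X2 Bm(2) J', symmetric])
  finally show "prob {\<omega> \<in> space M. (\<forall>t\<in>J. X1 \<omega> t \<in> U t) \<and> (\<forall>t\<in>J'. X2 \<omega> t \<in> U' t)}
      = prob {\<omega> \<in> space M. \<forall>t\<in>J. X1 \<omega> t \<in> U t} * prob {\<omega> \<in> space M. \<forall>t\<in>J'. X2 \<omega> t \<in> U' t}" .
qed

text \<open>A path that starts in the closed disc first meets the circle when its modulus first
  reaches \<open>R\<close>, so the extended hitting time is the real exit time.\<close>

lemma path_until_hit_eq:
  assumes x: "x \<in> path_set" "hits R x" "cmod (x 0) \<le> R" and B: "\<And>t. t \<ge> 0 \<Longrightarrow> x t = B t \<omega>"
  shows "path_until_hit B R \<omega> = x ` {0..exit_time R x}"
proof -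
  have "circle_hitting_time B R \<omega> = ereal (exit_time R x)"
    unfolding circle_hitting_time_def
  proof (rule antisym)
    have "exit_time R x \<in> {t. 0 \<le> t \<and> B t \<omega> \<in> sphere 0 R}"
      using norm_at_exit_time[OF x] B[OF exit_time_nonneg] exit_time_nonneg[of R x] by simp
    then show "(INF t\<in>{t. 0 \<le> t \<and> B t \<omega> \<in> sphere 0 R}. ereal t) \<le> ereal (exit_time R x)"
      by (rule INF_lower)
    show "ereal (exit_time R x) \<le> (INF t\<in>{t. 0 \<le> t \<and> B t \<omega> \<in> sphere 0 R}. ereal t)"
      by (rule INF_greatest) (use B exit_time_le[of _ R x] in auto)
  qed
  then show ?thesis unfolding path_until_hit_def using B by (auto intro!: image_cong)
qed

lemma disjoint_dilation_iff_nonint: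
  "x ` {0..exit_time R x} \<inter> (A * y ` {0..exit_time R y}) = {} \<longleftrightarrow> nonint A R x y"
proof -
  have "w \<in> A * y ` {0..exit_time R y} \<longleftrightarrow> (\<exists>d\<in>A. \<exists>t\<in>{0..exit_time R y}. w = d * y t)" for w
    unfolding set_times_def by blast
  moreover have "x ` {0..exit_time R x} \<inter> S = {} \<longleftrightarrow> (\<forall>s\<in>{0..exit_time R x}. x s \<notin> S)" for S
    by auto
  ultimately show ?thesis unfolding nonint_def by (simp only:) blast
qed

context wiener
begin

definition nonint_measure :: "complex set \<Rightarrow> real \<Rightarrow> real" where
  "nonint_measure D R = measure Px2 (nonint_event D R)"

lemma nonint_measure_submultiplicative:
  assumes "countable D" "R \<ge> 1" "R' \<ge> 1"
  shows "nonint_measure D (2 * R * R') \<le> 16 * nonint_measure D R * nonint_measure D R'"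
proof -
  interpret P: prob_space Px2 by (rule prob_space_Px2) simp
  have "ennreal (nonint_measure D (2 * R * R')) \<le> 16 * ennreal (nonint_measure D R) * ennreal (nonint_measure D R')"
    using nonint_submultiplicative[OF assms] by (simp add: P.emeasure_eq_measure nonint_measure_def)
  also have "\<dots> = ennreal (16 * nonint_measure D R * nonint_measure D R')"
    by (simp add: ennreal_mult nonint_measure_def)
  finally show ?thesis by (subst (asm) ennreal_le_iff) (auto simp: nonint_measure_def)
qed

lemma nonint_measure_antimono:
  assumes "countable D" "R \<le> R'"
  shows "nonint_measure D R' \<le> nonint_measure D R"
proof -
  interpret P: prob_space Px2 by (rule prob_space_Px2) simp
  show ?thesis
    unfolding nonint_measure_def
  proof (rule P.finite_measure_mono_AE)
    show "AE p in Px2. p \<in> nonint_event D R' \<longrightarrow> p \<in> nonint_event D R"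
      using AE_hits_pair[OF zero_le_one, of R']
    proof eventually_elim
      case (elim p)
      then show ?case using nonint_mono[of "fst p" "snd p" R' R D D] assms(2) by (simp add: nonint_event_def)
    qed
    show "nonint_event D R \<in> sets Px2" using nonint_event_sets[OF assms(1)] by (simp only: sets_Px2)
  qed
qed

end

theorem mainTheorem1:
  fixes M :: "'a measure"
    and B1 B2 :: "real \<Rightarrow> 'a \<Rightarrow> complex"
    and A :: "complex set"
  assumes "prob_space M"
    and "A \<noteq> {}"
    and "prob_space.planar_brownian_motion M B1"
    and "prob_space.planar_brownian_motion M B2"
    and "distr M borel (B1 0) = uniform_unit_circle"
    and "distr M borel (B2 0) = uniform_unit_circle"
    and "prob_space.indep_processes M B1 B2"
    and "\<exists>c>0. \<exists>C>0. \<forall>R\<ge>1. nonintersection_prob M B1 B2 A R \<ge> c * R powr (- C)"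
  shows "\<exists>\<xi>::real. ((\<lambda>R. ln (nonintersection_prob M B1 B2 A R) / ln R) \<longlongrightarrow> - \<xi>) at_top"
proof -
  interpret prob_space M by fact
  obtain X1 where X1: "brownian M (circ 1) X1" "AE \<omega> in M. \<forall>t\<ge>0. X1 \<omega> t = B1 t \<omega>"
    by (rule brownian_of_planar_brownian_motion[OF assms(3), unfolded assms(5) circ_1[symmetric]]) (rule that)
  obtain X2 where X2: "brownian M (circ 1) X2" "AE \<omega> in M. \<forall>t\<ge>0. X2 \<omega> t = B2 t \<omega>"
    by (rule brownian_of_planar_brownian_motion[OF assms(4), unfolded assms(6) circ_1[symmetric]]) (rule that)
  note X1_meas [measurable] = brownianD(2)[OF X1(1)] and X2_meas [measurable] = brownianD(2)[OF X2(1)]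
  \<comment> \<open>The increments of the first motion from its starting point supply the law from 0
    that the locale asks for.\<close>
  define W where "W = distr M paths (\<lambda>\<omega>. incr_path 0 (X1 \<omega>))"
  have bW: "brownian W (return borel 0) (\<lambda>x. x)"
    unfolding W_def by (rule brownian_distr[OF brownian_incr_path[OF X1(1)]]) simp
  have sW: "sets W = sets paths" by (simp add: W_def)
  interpret wiener W
  proof
    show "brownian (start_law (circ 1) W) (circ 1) (\<lambda>x. x)"
      using brownian_distr[OF X1(1)] unfolding brownian_law[OF X1(1) bW sW] .
  qed (fact bW sW)+
  have ind: "indep_var paths X1 paths X2"
    by (rule indep_paths_of_indep_processes[OF assms(7) X1_meas X1(2) X2_meas X2(2)])
  have joint: "distr M (paths \<Otimes>\<^sub>M paths) (\<lambda>\<omega>. (X1 \<omega>, X2 \<omega>)) = Px2"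
    using ind brownian_circ_law[OF X1(1)] brownian_circ_law[OF X2(1)] by (simp add: indep_var_distribution_eq)
  have pair_meas [measurable]: "(\<lambda>\<omega>. (X1 \<omega>, X2 \<omega>)) \<in> M \<rightarrow>\<^sub>M paths \<Otimes>\<^sub>M paths" by measurable
  obtain D0 where D0: "countable D0" "D0 \<subseteq> A" "A \<subseteq> closure D0" using separable by metis
  define D where "D = D0 \<union> (A \<inter> {0})"
  have D: "countable D" "D \<subseteq> A" "A \<subseteq> closure D" "0 \<in> A \<Longrightarrow> 0 \<in> D"
    using D0 closure_mono[of D0 D] by (auto simp: D_def intro: countable_subset[of "A \<inter> {0}" "{0}"])
  define q where "q = nonintersection_prob M B1 B2 A"
  define F where "F R = {\<omega> \<in> space M. path_until_hit B1 R \<omega> \<inter> (A * path_until_hit B2 R \<omega>) = {}}" for R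
  have q: "q R = measure (completion M) (F R)" for R
    by (simp add: q_def nonintersection_prob_def F_def)
  obtain c C where cC: "c > 0" "C > 0" "\<And>R. R \<ge> 1 \<Longrightarrow> c * R powr (- C) \<le> q R"
    using assms(8) unfolding q_def by auto
  have q_pos: "q R > 0" if "R \<ge> 1" for R
    using cC(3)[OF that] cC(1) that by (smt (verit) mult_pos_pos powr_gt_zero)
  \<comment> \<open>The assumed lower bound yields measurability: a set outside the completed
    sigma-algebra would have measure 0.\<close>
  have F_sets: "F R \<in> sets (completion M)" if "R \<ge> 1" for R
    using q_pos[OF that] measure_notin_sets[of "F R" "completion M"] unfolding q by force
  define E where "E R = {\<omega> \<in> space M. nonint D R (X1 \<omega>) (X2 \<omega>)}" for R
  have E_vimage: "E R = (\<lambda>\<omega>. (X1 \<omega>, X2 \<omega>)) -` nonint_event D R \<inter> space M" for R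
    using measurable_space[OF X1_meas] measurable_space[OF X2_meas] by (auto simp: E_def nonint_event_def)
  have E_sets: "E R \<in> sets M" for R
    unfolding E_vimage by (rule measurable_sets[OF pair_meas nonint_event_sets[OF D(1)]])
  have E_measure: "measure (completion M) (E R) = nonint_measure D R" for R
  proof -
    have "measure (completion M) (E R) = measure M (E R)" by (rule measure_completion[OF E_sets])
    also have "\<dots> = measure (distr M (paths \<Otimes>\<^sub>M paths) (\<lambda>\<omega>. (X1 \<omega>, X2 \<omega>))) (nonint_event D R)"
      unfolding E_vimage by (rule measure_distr[OF pair_meas nonint_event_sets[OF D(1)], symmetric])
    finally show ?thesis unfolding joint nonint_measure_def .
  qed
  interpret cM: prob_space "completion M"
    by (rule prob_spaceI) (simp add: emeasure_completion emeasure_space_1)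
  have F_iff: "AE \<omega> in M. \<omega> \<in> F R \<longleftrightarrow> nonint A R (X1 \<omega>) (X2 \<omega>)" if R: "R \<ge> 1" for R
  proof -
    have start: "AE \<omega> in M. cmod (X \<omega> 0) \<le> R" if X: "brownian M (circ 1) X" for X
    proof -
      have X0 [measurable]: "(\<lambda>\<omega>. X \<omega> 0) \<in> borel_measurable M" by (rule measurable_path_at[OF brownianD(2)[OF X]]) simp
      have "AE z in distr M borel (\<lambda>\<omega>. X \<omega> 0). cmod z = 1"
        unfolding brownianD(3)[OF X] by (rule AE_circ) simp
      then have "AE \<omega> in M. cmod (X \<omega> 0) = 1" by (subst (asm) AE_distr_iff) auto
      then show ?thesis by eventually_elim (use R in simp)
    qed
    show ?thesis
      using X1(2) X2(2) start[OF X1(1)] start[OF X2(1)] AE_hits[OF X1(1), of R] AE_hits[OF X2(1), of R] AE_space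
    proof eventually_elim
      case (elim \<omega>)
      have "path_until_hit B1 R \<omega> = X1 \<omega> ` {0..exit_time R (X1 \<omega>)}"
        by (rule path_until_hit_eq) (use elim measurable_space[OF X1_meas] in auto)
      moreover have "path_until_hit B2 R \<omega> = X2 \<omega> ` {0..exit_time R (X2 \<omega>)}"
        by (rule path_until_hit_eq) (use elim measurable_space[OF X2_meas] in auto)
      moreover have "\<omega> \<in> space M" using elim by simp
      ultimately show ?case unfolding F_def by (simp only: mem_Collect_eq disjoint_dilation_iff_nonint simp_thms)
    qed
  qed
  have upper: "q R \<le> nonint_measure D R" if R: "R \<ge> 1" for R
    unfolding q E_measure[symmetric]
  proof (rule cM.finite_measure_mono_AE)
    have "AE \<omega> in M. \<omega> \<in> F R \<longrightarrow> \<omega> \<in> E R"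
      using F_iff[OF R] AE_space by eventually_elim (use D(2) in \<open>auto simp: E_def nonint_def\<close>)
    then show "AE \<omega> in completion M. \<omega> \<in> F R \<longrightarrow> \<omega> \<in> E R" by (rule AE_completion)
  qed (use E_sets in auto)
  have lower: "nonint_measure D (2 * R) \<le> q R" if R: "R \<ge> 1" for R
    unfolding q E_measure[symmetric]
  proof (rule cM.finite_measure_mono_AE[OF _ F_sets[OF R]])
    have "AE p in distr M (paths \<Otimes>\<^sub>M paths) (\<lambda>\<omega>. (X1 \<omega>, X2 \<omega>)). nonint D (2 * R) (fst p) (snd p) \<longrightarrow> nonint A R (fst p) (snd p)"
      unfolding joint by (rule nonint_regularity[OF R D(1,3,4)])
    from AE_distrD[OF pair_meas this]
    have "AE \<omega> in M. nonint D (2 * R) (X1 \<omega>) (X2 \<omega>) \<longrightarrow> nonint A R (X1 \<omega>) (X2 \<omega>)" by simp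
    then have "AE \<omega> in M. \<omega> \<in> E (2 * R) \<longrightarrow> \<omega> \<in> F R"
      using F_iff[OF R] by eventually_elim (auto simp: E_def)
    then show "AE \<omega> in completion M. \<omega> \<in> E (2 * R) \<longrightarrow> \<omega> \<in> F R" by (rule AE_completion)
  qed
  obtain L where L: "((\<lambda>R. ln (nonint_measure D R) / ln R) \<longlongrightarrow> L) at_top"
    by (rule exE[OF submultiplicative_log_limit[OF one_le_numeral nonint_measure_submultiplicative[OF D(1)]
      nonint_measure_antimono[OF D(1)] cC(1,2) order_trans[OF cC(3) upper]]])
  have "((\<lambda>R. ln (q R) / ln R) \<longlongrightarrow> L) at_top"
  proof (rule tendsto_sandwich[OF _ _ _ L])
    \<comment> \<open>The factor \<open>1 + ln 2 / ln R\<close> changes the denominator from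
      \<open>ln (2 * R)\<close> to \<open>ln R\<close> and tends to 1, so doubling the radius does
      not affect the limit.\<close>
    show "eventually (\<lambda>R. ln (nonint_measure D (2 * R)) / ln (2 * R) * (1 + ln 2 / ln R) \<le> ln (q R) / ln R) at_top"
      using eventually_gt_at_top[of 1]
    proof eventually_elim
      case (elim R)
      have l: "ln R > 0" "ln (2 * R) > 0" using elim by auto
      have pos: "nonint_measure D (2 * R) > 0"
        using upper[of "2 * R"] q_pos[of "2 * R"] elim by simp
      have "1 + ln 2 / ln R = ln (2 * R) / ln R" using l elim by (simp add: ln_mult add_divide_distrib)
      then have "ln (nonint_measure D (2 * R)) / ln (2 * R) * (1 + ln 2 / ln R) = ln (nonint_measure D (2 * R)) / ln R"
        using l by simp
      also have "\<dots> \<le> ln (q R) / ln R"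
        using lower[of R] pos l elim by (intro divide_right_mono ln_mono) auto
      finally show ?case .
    qed
    show "eventually (\<lambda>R. ln (q R) / ln R \<le> ln (nonint_measure D R) / ln R) at_top"
      using eventually_gt_at_top[of 1]
    proof eventually_elim
      case (elim R)
      then show ?case using upper[of R] q_pos[of R] by (intro divide_right_mono ln_mono) auto
    qed
    have "filterlim (\<lambda>R::real. 2 * R) at_top at_top"
      by (rule filterlim_tendsto_pos_mult_at_top[OF tendsto_const _ filterlim_ident]) simp
    from filterlim_compose[OF L this]
    have "((\<lambda>R. ln (nonint_measure D (2 * R)) / ln (2 * R)) \<longlongrightarrow> L) at_top" .
    moreover have "((\<lambda>R::real. 1 + ln 2 / ln R) \<longlongrightarrow> 1 + 0) at_top"
      by (intro tendsto_add tendsto_const tendsto_divide_0[OF tendsto_const] filterlim_at_top_imp_at_infinity ln_at_top)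
    ultimately have "((\<lambda>R. ln (nonint_measure D (2 * R)) / ln (2 * R) * (1 + ln 2 / ln R)) \<longlongrightarrow> L * (1 + 0)) at_top"
      by (rule tendsto_mult)
    then show "((\<lambda>R. ln (nonint_measure D (2 * R)) / ln (2 * R) * (1 + ln 2 / ln R)) \<longlongrightarrow> L) at_top" by simp
  qed
  then show ?thesis unfolding q_def by (intro exI[of _ "- L"]) simp
qed

end
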